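(* Let $f\in C^1([0,\infty))$ satisfy $f(0)=f(1)=0$, $f(u)>0$ for $u\in(0,1)$, $f(u)<0$ for $u\in(1,\infty)$, and $f'(0)=0$. Let $\phi\in L^2(\mathbb{R})\cap L^\infty(\mathbb{R})$ satisfy $\phi\ge 0$, $\phi(-x)=\phi(x)$ for all $x$, and $\phi$ non-increasing on $(0,\infty)$. Let $u(x,t)$ be the solution of $u_t=u_{xx}+f(u)$, $x\in\mathbb{R}$, $t>0$, with $u(x,0)=\phi(x)$. Then one of the following holds: 1. $\lim_{t\to\infty}u(x,t)=1$ locally uniformly in $\mathbb{R}$; 2. $\lim_{t\to\infty}u(x,t)=0$ uniformly in $\mathbb{R}$.
   Context: The solution $u$ is the unique classical solution of the Cauchy problem in $C^2_1(\mathbb{R}\times(0,\infty))\cap L^\infty(\mathbb{R}\times(0,\infty))$ ($C^2$ in $x$, $C^1$ in $t$) with $u\in C([0,\infty);L^2(\mathbb{R}))\cap C((0,\infty);H^2(\mathbb{R}))$. *)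

theory Defs
  imports "HOL-Analysis.Analysis"
begin

text \<open>Elements of \<open>L\<^sup>2\<close>, \<open>H\<^sup>k\<close> and \<open>L\<^sup>\<infinity>\<close> are represented by functions rather than by
  classes modulo null sets.\<close>

definition in_L2 :: "(real \<Rightarrow> real) \<Rightarrow> bool" where
  "in_L2 v \<longleftrightarrow> v \<in> borel_measurable lebesgue \<and> integrable lebesgue (\<lambda>x. (v x)\<^sup>2)"

definition L2_norm :: "(real \<Rightarrow> real) \<Rightarrow> real" where
  "L2_norm v = sqrt (LINT x|lebesgue. (v x)\<^sup>2)"

definition in_Linf :: "'a measure \<Rightarrow> ('a \<Rightarrow> real) \<Rightarrow> bool" where
  "in_Linf M v \<longleftrightarrow> v \<in> borel_measurable M \<and> (\<exists>C. AE z in M. \<bar>v z\<bar> \<le> C)"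

text \<open>The test functions \<open>C\<^sub>c\<^sup>\<infinity>(\<real>)\<close>.\<close>

definition test_function :: "(real \<Rightarrow> real) \<Rightarrow> bool" where
  "test_function \<psi> \<longleftrightarrow>
     (\<forall>k x. (deriv ^^ k) \<psi> differentiable (at x)) \<and> compact (closure {x. \<psi> x \<noteq> 0})"

text \<open>This is only used for \<open>v\<close> and \<open>g\<close> in \<open>L\<^sup>2\<close>, where both integrals exist.\<close>

definition weak_deriv :: "nat \<Rightarrow> (real \<Rightarrow> real) \<Rightarrow> (real \<Rightarrow> real) \<Rightarrow> bool" where
  "weak_deriv k v g \<longleftrightarrow>
     (\<forall>\<psi>. test_function \<psi> \<longrightarrow>
        (LINT x|lebesgue. v x * (deriv ^^ k) \<psi> x) = (-1) ^ k * (LINT x|lebesgue. g x * \<psi> x))"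

definition in_Hk :: "nat \<Rightarrow> (real \<Rightarrow> real) \<Rightarrow> bool" where
  "in_Hk k v \<longleftrightarrow> in_L2 v \<and> (\<forall>j\<le>k. \<exists>g. in_L2 g \<and> weak_deriv j v g)"

text \<open>Weak derivatives are unique up to null sets, so the norm does not depend on the choice.\<close>

definition Hk_norm :: "nat \<Rightarrow> (real \<Rightarrow> real) \<Rightarrow> real" where
  "Hk_norm k v = sqrt (\<Sum>j\<le>k. (L2_norm (SOME g. in_L2 g \<and> weak_deriv j v g))\<^sup>2)"

text \<open>\<open>u x t\<close> is the value at position \<open>x\<close> and time \<open>t\<close>; a curve \<open>t \<mapsto> u(\<cdot>,t)\<close> over the time set \<open>I\<close> is
  continuous with respect to the norm of the target space.\<close>

definition continuous_in_L2 :: "real set \<Rightarrow> (real \<Rightarrow> real \<Rightarrow> real) \<Rightarrow> bool" where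
  "continuous_in_L2 I u \<longleftrightarrow>
     (\<forall>t\<in>I. in_L2 (\<lambda>x. u x t)) \<and>
     (\<forall>s\<in>I. ((\<lambda>t. L2_norm (\<lambda>x. u x t - u x s)) \<longlongrightarrow> 0) (at s within I))"

definition continuous_in_Hk :: "nat \<Rightarrow> real set \<Rightarrow> (real \<Rightarrow> real \<Rightarrow> real) \<Rightarrow> bool" where
  "continuous_in_Hk k I u \<longleftrightarrow>
     (\<forall>t\<in>I. in_Hk k (\<lambda>x. u x t)) \<and>
     (\<forall>s\<in>I. ((\<lambda>t. Hk_norm k (\<lambda>x. u x t - u x s)) \<longlongrightarrow> 0) (at s within I))"

text \<open>In the next definition, \<open>u\<close> is of class \<open>C\<^sup>2\<close> in \<open>x\<close> and \<open>C\<^sup>1\<close> in \<open>t\<close>, with \<open>u\<close> and the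
  derivatives \<open>ux\<close>, \<open>uxx\<close>, \<open>ut\<close> jointly continuous on \<open>\<real> \<times> (0,\<infinity>)\<close>. Since \<open>f\<close> is only meaningful on
  \<open>[0,\<infinity>)\<close>, a solution has to take its values there. The initial condition is an equality
  in \<open>L\<^sup>2\<close>.\<close>

definition is_solution ::
    "(real \<Rightarrow> real) \<Rightarrow> (real \<Rightarrow> real) \<Rightarrow> (real \<Rightarrow> real \<Rightarrow> real) \<Rightarrow> bool" where
  "is_solution f \<phi> u \<longleftrightarrow>
     (\<forall>x. \<forall>t>0. u x t \<ge> 0) \<and>
     (\<exists>ux uxx ut.
        (\<forall>x. \<forall>t>0. ((\<lambda>y. u y t) has_real_derivative ux x t) (at x)) \<and>
        (\<forall>x. \<forall>t>0. ((\<lambda>y. ux y t) has_real_derivative uxx x t) (at x)) \<and>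
        (\<forall>x. \<forall>t>0. ((\<lambda>s. u x s) has_real_derivative ut x t) (at t)) \<and>
        continuous_on (UNIV \<times> {0<..}) (\<lambda>(x, t). u x t) \<and>
        continuous_on (UNIV \<times> {0<..}) (\<lambda>(x, t). ux x t) \<and>
        continuous_on (UNIV \<times> {0<..}) (\<lambda>(x, t). uxx x t) \<and>
        continuous_on (UNIV \<times> {0<..}) (\<lambda>(x, t). ut x t) \<and>
        (\<forall>x. \<forall>t>0. ut x t = uxx x t + f (u x t))) \<and>
     in_Linf (lebesgue_on (UNIV \<times> {0<..})) (\<lambda>(x, t). u x t) \<and>
     continuous_in_L2 {0..} u \<and>
     continuous_in_Hk 2 {0<..} u \<and>
     (AE x in lebesgue. u x 0 = \<phi> x)"

end

theory Submission
  imports Defs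
begin

text \<open>
  Reflecting in the points \<open>c \<ge> 0\<close> and comparing shows that \<open>u(\<cdot>,t)\<close> inherits evenness and monotonicity
  from \<open>\<phi>\<close>. So \<open>u(0,t)\<close> is the maximum of \<open>u(\<cdot>,t)\<close>, and uniform decay means \<open>u(0,t) \<rightarrow> 0\<close>. Moreover
  \<open>d/dt u(0,t) \<le> f(u(0,t))\<close>, so \<open>u\<close> is eventually at most \<open>1 + \<epsilon>\<close>.

  Let \<open>h\<close> be the reaction term frozen outside \<open>[0,1]\<close> and \<open>H\<close> its primitive. Everything hinges on whether
  the solution is at some time \<^emph>\<open>wide\<close>: \<open>u(\<cdot>,t\<^sub>0) \<ge> \<delta>\<close> on \<open>[-x,x]\<close> for some \<open>\<delta> \<in> (0,1]\<close> and \<open>x > 0\<close> with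
  \<open>H(\<delta>) x\<^sup>2 \<ge> 4 \<delta>\<^sup>2\<close>.

  If it is, a stationary solution of \<open>v'' + h(v) = 0\<close> that vanishes at two points of \<open>[-x,x]\<close> and has
  height \<open>a \<le> \<delta>\<close> in between fits below \<open>u(\<cdot>,t\<^sub>0)\<close>, hence \<open>u(0,t) \<ge> a\<close> for all later times
  (\<open>plateau_persists\<close>). In one space dimension diffusion alone carries this bound, halved, to every
  bounded interval. On a long interval the reaction is then bounded below by a positive constant as long
  as \<open>u \<le> 1 - \<epsilon>\<close>, and it lifts \<open>u\<close> above a very flat parabola of height \<open>1 - \<epsilon>\<close>
  (\<open>spreads_if_centre_bounded_below\<close>).

  If it never is, then \<open>H(min(u,1)) < 4/x\<^sup>2\<close> at all positive times. The potential part of the energy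
  \<open>\<integral> u\<^sub>x\<^sup>2/2 - G(u) dx\<close>, where \<open>G' = f\<close>, is therefore bounded below uniformly in time, so the total
  dissipation \<open>\<integral>\<integral> u\<^sub>t\<^sup>2\<close> is finite, and close to every late time there is a quiet time \<open>s\<close> with
  the integral of \<open>u\<^sub>t(\<cdot>,s)\<^sup>2\<close> over \<open>[-L,L]\<close> as small as desired (\<open>dissipation_vanishes\<close>).
  At a quiet time \<open>u(\<cdot>,s)\<close> nearly solves \<open>v'' + f(v) = 0\<close>. If \<open>u(0,s)\<close> stayed away from \<open>0\<close>, then \<open>u(\<cdot>,s)\<close>, which is small at some fixed point \<open>X\<close>
  because it is not wide, would pass through a range of values where \<open>f\<close> is bounded below; there it
  acquires a definite negative slope, which it can hardly lose afterwards since \<open>f(u)\<close> is almost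
  nonnegative. It would become negative (\<open>quiet_time_contradiction\<close>). So \<open>u(0,t) \<rightarrow> 0\<close>.

  Integrals over unbounded intervals, in the symmetry and energy arguments, are truncated with the cutoff
  \<open>(1 - (x/R)\<^sup>2)\<^sup>2\<close>; the errors caused by it are \<open>O(1/R)\<close> and disappear as \<open>R \<rightarrow> \<infinity>\<close>.
\<close>

section \<open>Minima, antiderivatives and second order equations\<close>

lemma second_derivative_nonneg_at_minimum:
  fixes p p' :: "real \<Rightarrow> real"
  assumes S: "open S" "x \<in> S"
    and p: "\<And>y. y \<in> S \<Longrightarrow> (p has_real_derivative p' y) (at y)"
    and p': "(p' has_real_derivative c) (at x)"
    and min: "\<And>y. y \<in> S \<Longrightarrow> p x \<le> p y"
  shows "0 \<le> c"
proof (rule ccontr)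
  assume "\<not> 0 \<le> c"
  obtain e where e: "0 < e" "ball x e \<subseteq> S"
    using S openE by blast
  have "p' x = 0"
    using DERIV_local_min[OF p[OF S(2)] e(1)] min e(2) by (auto simp: dist_real_def subset_iff)
  moreover obtain d where d: "0 < d" "\<And>h. 0 < h \<Longrightarrow> h < d \<Longrightarrow> p' (x + h) < p' x"
    using DERIV_neg_dec_right[OF p'] \<open>\<not> 0 \<le> c\<close> by auto
  moreover define h where "h = min d e / 2"
  ultimately have h: "0 < h" "h < d" "h < e"
    using e by auto
  have in_S: "y \<in> S" if "x \<le> y" "y \<le> x + h" for y
    using e h that by (auto simp: dist_real_def subset_iff)
  obtain z where z: "x < z" "z < x + h" "p (x + h) - p x = (x + h - x) * p' z"
    using MVT2[of x "x + h" p p'] p in_S h by auto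
  have "p' z < 0"
    using d(2)[of "z - x"] z h \<open>p' x = 0\<close> by auto
  then have "p (x + h) < p x"
    using z(3) mult_pos_neg[OF h(1) \<open>p' z < 0\<close>] by simp
  moreover have "p x \<le> p (x + h)"
    using min[OF in_S[of "x + h"]] h by auto
  ultimately show False by simp
qed

lemma has_real_derivative_nonpos_at_left_minimum:
  fixes p :: "real \<Rightarrow> real"
  assumes "(p has_real_derivative c) (at t)" "s < t" "\<And>r. s \<le> r \<Longrightarrow> r \<le> t \<Longrightarrow> p t \<le> p r"
  shows "c \<le> 0"
proof (rule ccontr)
  assume "\<not> c \<le> 0"
  then obtain d where d: "0 < d" "\<And>h. 0 < h \<Longrightarrow> h < d \<Longrightarrow> p (t - h) < p t"
    using DERIV_pos_inc_left[OF assms(1)] by auto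
  define h where "h = min d (t - s) / 2"
  have "0 < h" "h < d" "h \<le> t - s"
    using d assms(2) by (auto simp: h_def)
  with d(2)[of h] assms(3)[of "t - h"] show False by auto
qed

text \<open>Multiplying by \<open>exp (- (L + 1) t)\<close> turns the zeroth
  order term into a strictly positive one at a negative minimum, which contradicts the signs of the
  time derivative and the second space derivative there.\<close>

lemma parabolic_minimum_principle:
  fixes w wx wxx wt :: "real \<Rightarrow> real \<Rightarrow> real"
  assumes cont: "continuous_on ({a..b} \<times> {t0..t1}) (\<lambda>(x, t). w x t)"
    and dx: "\<And>x t. a < x \<Longrightarrow> x < b \<Longrightarrow> t0 < t \<Longrightarrow> t \<le> t1 \<Longrightarrow> ((\<lambda>y. w y t) has_real_derivative wx x t) (at x)"
    and dxx: "\<And>x t. a < x \<Longrightarrow> x < b \<Longrightarrow> t0 < t \<Longrightarrow> t \<le> t1 \<Longrightarrow> ((\<lambda>y. wx y t) has_real_derivative wxx x t) (at x)"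
    and dt: "\<And>x t. a < x \<Longrightarrow> x < b \<Longrightarrow> t0 < t \<Longrightarrow> t \<le> t1 \<Longrightarrow> ((\<lambda>s. w x s) has_real_derivative wt x t) (at t)"
    and super: "\<And>x t. a < x \<Longrightarrow> x < b \<Longrightarrow> t0 < t \<Longrightarrow> t \<le> t1 \<Longrightarrow> w x t < 0 \<Longrightarrow> wt x t \<ge> wxx x t + L * w x t"
    and left: "\<And>t. t0 \<le> t \<Longrightarrow> t \<le> t1 \<Longrightarrow> w a t \<ge> 0"
    and right: "\<And>t. t0 \<le> t \<Longrightarrow> t \<le> t1 \<Longrightarrow> w b t \<ge> 0"
    and init: "\<And>x. a \<le> x \<Longrightarrow> x \<le> b \<Longrightarrow> w x t0 \<ge> 0"
    and x: "a \<le> x" "x \<le> b" and t: "t0 \<le> t" "t \<le> t1"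
  shows "w x t \<ge> 0"
proof (rule ccontr)
  assume neg: "\<not> w x t \<ge> 0"
  define z where "z x t = exp (- (L + 1) * t) * w x t" for x t
  have "continuous_on ({a..b} \<times> {t0..t1}) (\<lambda>p. exp (- (L + 1) * snd p))"
    by (intro continuous_intros)
  moreover have "continuous_on ({a..b} \<times> {t0..t1}) (\<lambda>p. w (fst p) (snd p))"
    using cont by (simp add: split_beta')
  ultimately have "continuous_on ({a..b} \<times> {t0..t1}) (\<lambda>p. z (fst p) (snd p))"
    unfolding z_def by (rule continuous_on_mult)
  moreover have "compact ({a..b} \<times> {t0..t1})"
    by (intro compact_Times compact_Icc)
  moreover have "(x, t) \<in> {a..b} \<times> {t0..t1}"
    using x t by auto
  then have "{a..b} \<times> {t0..t1} \<noteq> {}"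
    by blast
  ultimately have "\<exists>p\<in>{a..b} \<times> {t0..t1}. \<forall>q\<in>{a..b} \<times> {t0..t1}. z (fst p) (snd p) \<le> z (fst q) (snd q)"
    by (intro continuous_attains_inf)
  then obtain p where p: "p \<in> {a..b} \<times> {t0..t1}"
      "\<And>q. q \<in> {a..b} \<times> {t0..t1} \<Longrightarrow> z (fst p) (snd p) \<le> z (fst q) (snd q)"
    by blast
  obtain y s where ys: "p = (y, s)" by force
  have y: "a \<le> y" "y \<le> b" and s: "t0 \<le> s" "s \<le> t1"
    using p(1) ys by auto
  have min: "z y s \<le> z y' s'" if "a \<le> y'" "y' \<le> b" "t0 \<le> s'" "s' \<le> t1" for y' s'
    using p(2)[of "(y', s')"] ys that by auto
  have "z x t < 0"
    using neg by (auto simp: z_def mult_pos_neg)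
  then have "z y s < 0"
    using min[OF x t] by simp
  then have w_neg: "w y s < 0"
    by (simp add: z_def mult_less_0_iff)
  have int: "a < y" "y < b" "t0 < s"
    using w_neg left[of s] right[of s] init[of y] y s by (metis linorder_not_less order.order_iff_strict)+
  have "0 \<le> exp (- (L + 1) * s) * wxx y s"
  proof (rule second_derivative_nonneg_at_minimum)
    show "open {a<..<b}" "y \<in> {a<..<b}"
      using int by auto
    show "((\<lambda>x. z x s) has_real_derivative exp (- (L + 1) * s) * wx q s) (at q)"
      if "q \<in> {a<..<b}" for q
      unfolding z_def using dx[of q s] that int s by (auto intro!: derivative_eq_intros)
    show "((\<lambda>x. exp (- (L + 1) * s) * wx x s) has_real_derivative exp (- (L + 1) * s) * wxx y s) (at y)"
      using dxx[of y s] int s by (auto intro!: derivative_eq_intros)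
    show "z y s \<le> z q s" if "q \<in> {a<..<b}" for q
      using min[of q s] that s by auto
  qed
  then have wxx: "0 \<le> wxx y s"
    by (simp add: zero_le_mult_iff)
  have "exp (- (L + 1) * s) * (wt y s - (L + 1) * w y s) \<le> 0"
  proof (rule has_real_derivative_nonpos_at_left_minimum[where p = "z y" and s = t0])
    show "((\<lambda>r. z y r) has_real_derivative exp (- (L + 1) * s) * (wt y s - (L + 1) * w y s)) (at s)"
      unfolding z_def using dt[of y s] int s
      by (auto intro!: derivative_eq_intros simp: algebra_simps)
    show "t0 < s" by fact
    show "z y s \<le> z y r" if "t0 \<le> r" "r \<le> s" for r
      using min[of y r] that s y by auto
  qed
  then have "wt y s - (L + 1) * w y s \<le> 0"
    by (simp add: mult_le_0_iff)
  moreover have "wt y s \<ge> wxx y s + L * w y s"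
    using super int s w_neg by auto
  ultimately show False
    using wxx w_neg by (simp add: algebra_simps)
qed

lemma global_antiderivative:
  fixes h :: "real \<Rightarrow> real"
  assumes "continuous_on UNIV h"
  obtains H where "H 0 = 0" "\<And>x. (H has_real_derivative h x) (at x)"
proof -
  obtain F where F: "\<And>x. (F has_vector_derivative h x) (at x)"
    using einterval_antiderivative[of "-\<infinity>" "\<infinity>" h] assms
    by (auto simp: continuous_on_eq_continuous_at)
  show ?thesis
  proof (rule that[of "\<lambda>x. F x - F 0"])
    show "F 0 - F 0 = 0" by simp
    show "((\<lambda>x. F x - F 0) has_real_derivative h x) (at x)" for x
      using F[of x] by (auto simp: has_real_derivative_iff_has_vector_derivative[symmetric] intro!: derivative_eq_intros)
  qed
qed

lemma nonneg_if_convex_critical_zero: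
  fixes q q' q'' :: "real \<Rightarrow> real"
  assumes q: "\<And>x. (q has_real_derivative q' x) (at x)"
    and q': "\<And>x. (q' has_real_derivative q'' x) (at x)"
    and "\<And>x. q'' x \<ge> 0" "q 0 = 0" "q' 0 = 0"
  shows "q x \<ge> 0"
proof -
  have mono: "q' a \<le> q' b" if "a \<le> b" for a b
    using DERIV_nonneg_imp_nondecreasing[OF that] q' assms(3) by blast
  show ?thesis
  proof (cases "x \<ge> 0")
    case True
    have "q 0 \<le> q x"
      using True by (rule DERIV_nonneg_imp_nondecreasing) (metis q mono assms(5))
    then show ?thesis using assms by simp
  next
    case False
    then have "q 0 \<le> q x"
      by (intro DERIV_nonpos_imp_nonincreasing[of x 0]) (auto, metis q mono assms(5))
    then show ?thesis using assms by simp
  qed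
qed

text \<open>Chosen as an operator on functions, so that it can be iterated in a fixed point argument.\<close>

definition second_antiderivative :: "(real \<Rightarrow> real) \<Rightarrow> real \<Rightarrow> real" where
  "second_antiderivative h = (SOME p. p 0 = 0 \<and> (\<exists>p'. p' 0 = 0 \<and>
     (\<forall>x. (p has_real_derivative p' x) (at x) \<and> (p' has_real_derivative h x) (at x))))"

lemma second_antiderivative:
  assumes "continuous_on UNIV h"
  obtains p' where "second_antiderivative h 0 = 0" "p' 0 = 0"
    "\<And>x. (second_antiderivative h has_real_derivative p' x) (at x)"
    "\<And>x. (p' has_real_derivative h x) (at x)"
proof -
  obtain p' where p': "p' 0 = 0" "\<And>x. (p' has_real_derivative h x) (at x)"
    using global_antiderivative[OF assms] by blast
  have "continuous_on UNIV p'"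
    using p'(2) by (intro DERIV_continuous_on) auto
  then obtain p where p: "p 0 = 0" "\<And>x. (p has_real_derivative p' x) (at x)"
    using global_antiderivative by blast
  have "\<exists>p. p 0 = 0 \<and> (\<exists>p'. p' 0 = 0 \<and>
     (\<forall>x. (p has_real_derivative p' x) (at x) \<and> (p' has_real_derivative h x) (at x)))"
    using p p' by blast
  from someI_ex[OF this] show ?thesis
    using that unfolding second_antiderivative_def by blast
qed

text \<open>The weight \<open>cosh (l x)\<close> satisfies \<open>y'' = l\<^sup>2 y\<close>, so integrating twice gains the factor \<open>1 / l\<^sup>2\<close>. This
  is what makes the Picard operator below a contraction on the whole line for large \<open>l\<close>.\<close>

lemma second_antiderivative_bound:
  assumes p: "\<And>x. (p has_real_derivative p' x) (at x)" "\<And>x. (p' has_real_derivative h x) (at x)"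
    "p 0 = 0" "p' 0 = 0" and "l > 0"
    and h: "\<And>x. \<bar>h x\<bar> \<le> C * cosh (l * x)"
  shows "\<bar>p x\<bar> \<le> C / l\<^sup>2 * cosh (l * x)"
proof -
  have C: "C \<ge> 0"
    using h[of 0] by auto
  have *: "0 \<le> C / l\<^sup>2 * (cosh (l * x) - 1) - s * p x" if "\<bar>s\<bar> = 1" for s :: real
  proof (rule nonneg_if_convex_critical_zero[where q = "\<lambda>x. C / l\<^sup>2 * (cosh (l * x) - 1) - s * p x"
        and q' = "\<lambda>x. C / l * sinh (l * x) - s * p' x" and q'' = "\<lambda>x. C * cosh (l * x) - s * h x"])
    show "((\<lambda>x. C / l\<^sup>2 * (cosh (l * x) - 1) - s * p x) has_real_derivative C / l * sinh (l * x) - s * p' x) (at x)" for x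
      using \<open>l > 0\<close> p by (auto intro!: derivative_eq_intros simp: power2_eq_square)
    show "((\<lambda>x. C / l * sinh (l * x) - s * p' x) has_real_derivative C * cosh (l * x) - s * h x) (at x)" for x
      using \<open>l > 0\<close> p by (auto intro!: derivative_eq_intros)
    show "0 \<le> C * cosh (l * x) - s * h x" for x
    proof -
      have "s * h x \<le> \<bar>s\<bar> * \<bar>h x\<bar>"
        by (metis abs_ge_self abs_mult)
      with h[of x] that show ?thesis by simp
    qed
  qed (use p in auto)
  have "C / l\<^sup>2 * (cosh (l * x) - 1) \<le> C / l\<^sup>2 * cosh (l * x)"
    using C by (intro mult_left_mono) auto
  then show ?thesis
    using *[of 1] *[of "-1"] by auto
qed

text \<open>Writing \<open>v(x) = w(x) cosh (l x)\<close> with \<open>w\<close> bounded and continuous, the integral equation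
  \<open>v = a - \<integral>\<integral> h(v)\<close> becomes a fixed point problem whose Lipschitz constant is \<open>K / l\<^sup>2 \<le> 1/2\<close>.\<close>

lemma second_order_ode_exists:
  fixes h :: "real \<Rightarrow> real"
  assumes lip: "\<And>x y. \<bar>h x - h y\<bar> \<le> K * \<bar>x - y\<bar>" and bdd: "\<And>x. \<bar>h x\<bar> \<le> B"
  obtains v v' where "v 0 = a" "v' 0 = 0" "\<And>x. (v has_real_derivative v' x) (at x)"
    "\<And>x. (v' has_real_derivative - h (v x)) (at x)"
proof -
  have K: "K \<ge> 0"
    using lip[of 0 1] by auto
  have "K-lipschitz_on UNIV h"
    using lip K by (auto simp: lipschitz_on_def dist_real_def)
  then have cont_h: "continuous_on UNIV h"
    by (rule lipschitz_on_continuous_on)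
  define l where "l = K + 1"
  have l: "l > 0" "K / l\<^sup>2 \<le> 1 / 2"
    using K by (auto simp: l_def divide_simps power2_eq_square) (simp add: algebra_simps)
  define \<Phi> where "\<Phi> w = second_antiderivative (\<lambda>x. h (w x * cosh (l * x)))" for w :: "real \<Rightarrow>\<^sub>C real"
  define T where "T w x = (a - \<Phi> w x) / cosh (l * x)" for w x
  have c: "continuous_on UNIV (\<lambda>x. h (apply_bcontfun w x * cosh (l * x)))" for w
    by (rule continuous_on_compose2[OF cont_h]) (intro continuous_intros continuous_on_apply_bcontfun, auto)
  have \<Phi>: "\<exists>p'. \<Phi> w 0 = 0 \<and> p' 0 = 0 \<and> (\<forall>x. (\<Phi> w has_real_derivative p' x) (at x)) \<and>
      (\<forall>x. (p' has_real_derivative h (w x * cosh (l * x))) (at x))" for w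
    by (rule second_antiderivative[OF c[of w]]) (unfold \<Phi>_def, blast)
  have cosh1: "1 \<le> cosh (x::real)" for x
    by (rule cosh_real_ge_1)
  have "\<bar>\<Phi> w x\<bar> \<le> B / l\<^sup>2 * cosh (l * x)" for w x
  proof -
    obtain p' where "\<Phi> w 0 = 0" "p' 0 = 0" "\<And>x. (\<Phi> w has_real_derivative p' x) (at x)"
      "\<And>x. (p' has_real_derivative h (w x * cosh (l * x))) (at x)"
      using \<Phi>[of w] by auto
    moreover have "\<bar>h (w x * cosh (l * x))\<bar> \<le> B * cosh (l * x)" for x
    proof -
      have "B * 1 \<le> B * cosh (l * x)"
        using bdd[of 0] by (intro mult_left_mono cosh1) auto
      then show ?thesis using bdd[of "w x * cosh (l * x)"] by simp
    qed
    ultimately show ?thesis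
      using second_antiderivative_bound[of "\<Phi> w" p' "\<lambda>x. h (w x * cosh (l * x))" l B x] l(1) by blast
  qed
  then have bound_T: "\<bar>T w x\<bar> \<le> \<bar>a\<bar> + B / l\<^sup>2" for w x
  proof -
    have "\<bar>a - \<Phi> w x\<bar> \<le> \<bar>a\<bar> * 1 + B / l\<^sup>2 * cosh (l * x)"
      using \<open>\<bar>\<Phi> w x\<bar> \<le> B / l\<^sup>2 * cosh (l * x)\<close> by linarith
    also have "\<dots> \<le> \<bar>a\<bar> * cosh (l * x) + B / l\<^sup>2 * cosh (l * x)"
      by (intro add_right_mono mult_left_mono cosh1) auto
    finally show ?thesis
      unfolding T_def by (simp add: abs_divide divide_le_eq algebra_simps cosh_real_pos)
  qed
  have T_bcont: "T w \<in> bcontfun" for w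
  proof -
    have "continuous_on UNIV (\<Phi> w)"
      using \<Phi>[of w] by (auto intro: DERIV_continuous_on)
    then have "continuous_on UNIV (T w)"
      unfolding T_def by (auto intro!: continuous_intros)
    moreover have "bounded (range (T w))"
      using bound_T by (auto simp: bounded_iff)
    ultimately show ?thesis
      by (simp add: bcontfun_def)
  qed
  define TT where "TT w = Bcontfun (T w)" for w
  have TT: "apply_bcontfun (TT w) = T w" for w
    unfolding TT_def by (rule Bcontfun_inverse[OF T_bcont])
  have contr: "dist (TT w1) (TT w2) \<le> 1 / 2 * dist w1 w2" for w1 w2
  proof (rule dist_bound)
    fix x
    obtain p1 where p1: "\<Phi> w1 0 = 0" "p1 0 = 0" "\<And>x. (\<Phi> w1 has_real_derivative p1 x) (at x)"
      "\<And>x. (p1 has_real_derivative h (w1 x * cosh (l * x))) (at x)"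
      using \<Phi>[of w1] by auto
    obtain p2 where p2: "\<Phi> w2 0 = 0" "p2 0 = 0" "\<And>x. (\<Phi> w2 has_real_derivative p2 x) (at x)"
      "\<And>x. (p2 has_real_derivative h (w2 x * cosh (l * x))) (at x)"
      using \<Phi>[of w2] by auto
    have "\<bar>\<Phi> w1 x - \<Phi> w2 x\<bar> \<le> K * dist w1 w2 / l\<^sup>2 * cosh (l * x)"
    proof (rule second_antiderivative_bound[where p = "\<lambda>x. \<Phi> w1 x - \<Phi> w2 x" and p' = "\<lambda>x. p1 x - p2 x"
          and h = "\<lambda>x. h (w1 x * cosh (l * x)) - h (w2 x * cosh (l * x))"])
      show "\<bar>h (w1 x * cosh (l * x)) - h (w2 x * cosh (l * x))\<bar> \<le> K * dist w1 w2 * cosh (l * x)" for x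
      proof -
        have "\<bar>h (w1 x * cosh (l * x)) - h (w2 x * cosh (l * x))\<bar> \<le> K * \<bar>w1 x * cosh (l * x) - w2 x * cosh (l * x)\<bar>"
          by (rule lip)
        also have "\<dots> = K * (dist (w1 x) (w2 x) * cosh (l * x))"
          using cosh_real_pos[of "l * x"] by (simp add: dist_real_def abs_mult flip: left_diff_distrib)
        also have "\<dots> \<le> K * (dist w1 w2 * cosh (l * x))"
          using K by (intro mult_left_mono mult_right_mono dist_bounded) auto
        finally show ?thesis by (simp add: mult.assoc)
      qed
    qed (use p1 p2 l in \<open>auto intro!: derivative_intros\<close>)
    also have "\<dots> \<le> 1 / 2 * dist w1 w2 * cosh (l * x)"
      using mult_right_mono[OF l(2), of "dist w1 w2 * cosh (l * x)"] by (simp add: ac_simps)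
    finally have "\<bar>\<Phi> w1 x - \<Phi> w2 x\<bar> / cosh (l * x) \<le> 1 / 2 * dist w1 w2"
      by (simp add: divide_le_eq cosh_real_pos)
    moreover have "dist (TT w1 x) (TT w2 x) = \<bar>\<Phi> w1 x - \<Phi> w2 x\<bar> / cosh (l * x)"
      unfolding TT T_def dist_real_def
      by (simp add: abs_divide abs_minus_commute flip: diff_divide_distrib)
    ultimately show "dist (TT w1 x) (TT w2 x) \<le> 1 / 2 * dist w1 w2" by simp
  qed
  then obtain w where w: "TT w = w"
    using banach_fix_type[of "1 / 2" TT] by auto
  define v where "v x = w x * cosh (l * x)" for x
  have v_eq: "v x = a - \<Phi> w x" for x
    using TT[of w] w by (simp add: v_def T_def)
  obtain p' where p': "\<Phi> w 0 = 0" "p' 0 = 0" "\<And>x. (\<Phi> w has_real_derivative p' x) (at x)"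
      "\<And>x. (p' has_real_derivative h (w x * cosh (l * x))) (at x)"
    using \<Phi>[of w] by auto
  show ?thesis
  proof (rule that[of v "\<lambda>x. - p' x"])
    show "(v has_real_derivative - p' x) (at x)" for x
      unfolding v_eq using p' by (auto intro!: derivative_eq_intros)
    show "((\<lambda>x. - p' x) has_real_derivative - h (v x)) (at x)" for x
      using p' by (auto intro!: derivative_eq_intros simp: v_def)
  qed (use p' v_eq in auto)
qed

section \<open>Stationary profiles and smooth evolutions\<close>

text \<open>By conservation of \<open>v'\<^sup>2 / 2 + H(v)\<close>, the deficit \<open>m = a - v\<close> satisfies \<open>m'\<^sup>2 \<ge> 2 k m\<close>, that is
  \<open>(\<surd>m)' \<ge> \<surd>(k/2)\<close>. Hence \<open>m(x) \<ge> k x\<^sup>2 / 2\<close> as long as \<open>v \<ge> 0\<close>, and \<open>v\<close> has to vanish by the time this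
  reaches \<open>a\<close>.\<close>

lemma concave_profile_reaches_zero:
  fixes v v' h H :: "real \<Rightarrow> real"
  assumes v: "\<And>y. (v has_real_derivative v' y) (at y)" "v 0 = a" "v' 0 = 0"
    and v': "\<And>y. (v' has_real_derivative - h (v y)) (at y)"
    and H: "\<And>s. (H has_real_derivative h s) (at s)"
    and h: "\<And>s. h s \<ge> 0" "h a > 0"
    and a: "a > 0" and k: "k > 0"
    and slope: "\<And>s. 0 \<le> s \<Longrightarrow> s \<le> a \<Longrightarrow> k * (a - s) \<le> H a - H s"
    and x: "x > 0" "2 * a \<le> k * x\<^sup>2"
  obtains r where "0 < r" "r \<le> x" "v r = 0" "\<And>y. 0 \<le> y \<Longrightarrow> y \<le> r \<Longrightarrow> 0 \<le> v y \<and> v y \<le> a"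
proof -
  have v'_anti: "v' q \<le> v' p" if "p \<le> q" for p q
    by (rule DERIV_nonpos_imp_nonincreasing[OF that]) (use v' h in \<open>metis neg_le_0_iff_le\<close>)
  have v_anti: "v q \<le> v p" if "0 \<le> p" "p \<le> q" for p q
    by (rule DERIV_nonpos_imp_nonincreasing[OF that(2)]) (metis v(1,3) v'_anti order_trans that(1))
  have cont: "continuous_on S v" for S
    using v(1) by (meson DERIV_continuous_on DERIV_subset subset_UNIV)
  have "\<exists>y\<in>{0..x}. v y \<le> 0"
  proof (rule ccontr)
    assume "\<not> ?thesis"
    then have pos: "v y > 0" if "0 \<le> y" "y \<le> x" for y
      using that by force
    obtain d where d: "0 < d" "\<And>e. 0 < e \<Longrightarrow> e < d \<Longrightarrow> v' (0 + e) < v' 0"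
      using DERIV_neg_dec_right[OF v'[of 0]] h(2) v(2) by auto
    have v'_neg: "v' y < 0" if "0 < y" for y
    proof -
      define e where "e = min (d / 2) y"
      have "v' e < 0" "e \<le> y"
        using d(2)[of e] d(1) that v(3) by (auto simp: e_def)
      then show ?thesis using v'_anti[of e y] by simp
    qed
    have below: "v y < a" if y: "0 < y" for y
    proof -
      obtain z where z: "0 < z" "z < y" "v y - v 0 = (y - 0) * v' z"
        using MVT2[of 0 y v v'] y v(1) by blast
      then show ?thesis
        using v'_neg[OF z(1)] mult_pos_neg[OF y, of "v' z"] v(2) by simp
    qed
    \<comment> \<open>Conservation of energy for the equation \<open>v'' + h(v) = 0\<close>.\<close>
    have energy: "(v' y)\<^sup>2 / 2 + H (v y) = H a" for y
    proof -
      have "((\<lambda>y. (v' y)\<^sup>2 / 2 + H (v y)) has_real_derivative 0) (at y)" for y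
        using v(1) v' by (auto intro!: derivative_eq_intros DERIV_chain2[OF H])
      then have "(v' y)\<^sup>2 / 2 + H (v y) = (v' 0)\<^sup>2 / 2 + H (v 0)"
        by (rule DERIV_isconst_all[rule_format])
      then show ?thesis using v by simp
    qed
    define m where "m y = sqrt (a - v y)" for y
    have dm: "(m has_real_derivative - v' y / (2 * sqrt (a - v y))) (at y)" if "0 < y" for y
      unfolding m_def using below[OF that] v(1)
      by (auto intro!: derivative_eq_intros simp: divide_simps)
    have "continuous_on {0..x} m"
      unfolding m_def by (intro continuous_intros cont)
    then obtain l z where lz: "0 < z" "z < x" "(m has_real_derivative l) (at z)" "m x - m 0 = (x - 0) * l"
      using MVT[of 0 x m] x(1) dm by (metis real_differentiable_def)
    have l: "l = - v' z / (2 * sqrt (a - v z))"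
      using DERIV_unique lz(3) dm[OF lz(1)] by blast
    have "2 * k * (a - v z) \<le> (v' z)\<^sup>2"
      using energy[of z] slope[of "v z"] pos[of z] below[of z] lz by (simp add: algebra_simps)
    then have "sqrt (2 * k * (a - v z)) \<le> \<bar>v' z\<bar>"
      using real_sqrt_le_mono[of "2 * k * (a - v z)" "(v' z)\<^sup>2"] by simp
    then have "sqrt (2 * k) * sqrt (a - v z) \<le> - v' z"
      using v'_neg[OF lz(1)] by (simp add: real_sqrt_mult)
    then have "sqrt (2 * k) / 2 \<le> l"
      unfolding l using below[OF lz(1)] by (simp add: field_simps)
    then have "x * (sqrt (2 * k) / 2) \<le> m x"
      using lz(4) x(1) v(2) by (simp add: m_def)
    moreover have "0 \<le> x * (sqrt (2 * k) / 2)"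
      using x k by simp
    ultimately have "(x * (sqrt (2 * k) / 2))\<^sup>2 \<le> (m x)\<^sup>2"
      by (rule power_mono)
    then have "k * x\<^sup>2 / 2 \<le> a - v x"
      using below[OF x(1)] k by (simp add: m_def power_mult_distrib power_divide field_simps)
    then show False
      using x(2) pos[of x] x(1) by simp
  qed
  then obtain y where y: "0 \<le> y" "y \<le> x" "v y \<le> 0" by auto
  then obtain r where r: "0 \<le> r" "r \<le> y" "v r = 0"
    using IVT2'[of v y 0 0] a v(2) cont by auto
  show ?thesis
  proof (rule that[of r])
    show "0 < r" using r a v(2) by (cases "r = 0") auto
    show "0 \<le> v z \<and> v z \<le> a" if "0 \<le> z" "z \<le> r" for z
      using v_anti[of 0 z] v_anti[of z r] that r v(2) by auto
  qed (use r y in auto)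
qed

text \<open>The height \<open>a\<close> is chosen so that \<open>H\<close> lies below the line of slope \<open>k = H(\<delta>) / (2 \<delta>)\<close> through
  \<open>(a, H(a))\<close> on \<open>[0,a]\<close>: take a maximiser of \<open>H(s) - k s\<close> on \<open>[0,\<delta>]\<close>. This works however irregular \<open>h\<close> is,
  whereas the profile of height exactly \<open>\<delta>\<close> need not be that narrow.\<close>

lemma compact_stationary_profile:
  fixes h H :: "real \<Rightarrow> real"
  assumes lip: "\<And>x y. \<bar>h x - h y\<bar> \<le> K * \<bar>x - y\<bar>" and bdd: "\<And>x. \<bar>h x\<bar> \<le> B"
    and nonneg: "\<And>x. h x \<ge> 0"
    and H: "\<And>s. (H has_real_derivative h s) (at s)" "H 0 = 0"
    and \<delta>: "\<delta> > 0" and x: "x > 0" "4 * \<delta>\<^sup>2 \<le> H \<delta> * x\<^sup>2"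
  obtains a v v' l r where "0 < a" "a \<le> \<delta>" "v 0 = a" "- x \<le> l" "l < 0" "0 < r" "r \<le> x"
    "v l = 0" "v r = 0" "\<And>y. l \<le> y \<Longrightarrow> y \<le> r \<Longrightarrow> 0 \<le> v y \<and> v y \<le> a"
    "\<And>y. (v has_real_derivative v' y) (at y)" "\<And>y. (v' has_real_derivative - h (v y)) (at y)"
proof -
  define k where "k = H \<delta> / (2 * \<delta>)"
  have "0 < H \<delta> * x\<^sup>2"
    using x(2) \<delta> by (smt (verit) zero_less_power)
  then have H\<delta>: "H \<delta> > 0"
    using x(1) by (simp add: zero_less_mult_iff)
  then have k: "k > 0"
    using \<delta> by (simp add: k_def)
  have "continuous_on {0..\<delta>} (\<lambda>s. H s - k * s)"
    using H(1) by (intro continuous_intros) (meson DERIV_continuous_on DERIV_subset subset_UNIV)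
  then obtain a where a: "a \<in> {0..\<delta>}" "\<And>s. s \<in> {0..\<delta>} \<Longrightarrow> H s - k * s \<le> H a - k * a"
    using continuous_attains_sup[of "{0..\<delta>}" "\<lambda>s. H s - k * s"] \<delta> by auto
  have "H \<delta> - k * \<delta> > 0"
    using H\<delta> \<delta> by (simp add: k_def)
  then have "a \<noteq> 0"
    using a(2)[of \<delta>] \<delta> H(2) by auto
  then have a_pos: "a > 0" using a(1) by auto
  \<comment> \<open>The graph of \<open>H(s) - k s\<close> has slope \<open>h(a) - k\<close> at its maximiser, so \<open>h(a) < k\<close> would give larger values to the left.\<close>
  have "h a > 0"
  proof (rule ccontr)
    assume "\<not> h a > 0"
    have "((\<lambda>s. H s - k * s) has_real_derivative h a - k) (at a)"
      using H(1) by (auto intro!: derivative_eq_intros)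
    moreover have "h a - k < 0"
      using \<open>\<not> h a > 0\<close> k by simp
    ultimately obtain d where d: "0 < d" "\<And>e. 0 < e \<Longrightarrow> e < d \<Longrightarrow> H a - k * a < H (a - e) - k * (a - e)"
      using DERIV_neg_dec_left by blast
    define e where "e = min (d / 2) a"
    have "0 < e" "e < d" "e \<le> a"
      using d a_pos by (auto simp: e_def)
    then show False
      using d(2)[of e] a(2)[of "a - e"] a(1) by auto
  qed
  have slope: "k * (a - s) \<le> H a - H s" if "0 \<le> s" "s \<le> a" for s
    using a(2)[of s] that a(1) by (simp add: algebra_simps)
  have "k * x\<^sup>2 \<ge> 2 * \<delta>"
    using x(2) \<delta> by (simp add: k_def field_simps power2_eq_square)
  then have width: "2 * a \<le> k * x\<^sup>2"
    using a(1) by simp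
  obtain v v' where v: "v 0 = a" "v' 0 = 0" "\<And>x. (v has_real_derivative v' x) (at x)"
    "\<And>x. (v' has_real_derivative - h (v x)) (at x)"
    using second_order_ode_exists[OF lip bdd, of a] by blast
  obtain r where r: "0 < r" "r \<le> x" "v r = 0" "\<And>y. 0 \<le> y \<Longrightarrow> y \<le> r \<Longrightarrow> 0 \<le> v y \<and> v y \<le> a"
    using concave_profile_reaches_zero[OF v(3,1,2,4) H(1) nonneg \<open>h a > 0\<close> a_pos k slope x(1) width] by blast
  have mirror: "((\<lambda>y. v (- y)) has_real_derivative - v' (- y)) (at y)"
    "((\<lambda>y. - v' (- y)) has_real_derivative - h (v (- y))) (at y)" for y
    using v(3)[of "- y"] DERIV_minus[OF v(4)[of "- y", unfolded DERIV_mirror]] by (simp_all add: DERIV_mirror)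
  have z: "v (- 0) = a" "- v' (- 0) = 0"
    using v by auto
  obtain l where l: "0 < l" "l \<le> x" "v (- l) = 0" "\<And>y. 0 \<le> y \<Longrightarrow> y \<le> l \<Longrightarrow> 0 \<le> v (- y) \<and> v (- y) \<le> a"
    using concave_profile_reaches_zero[OF mirror(1) z mirror(2) H(1) nonneg \<open>h a > 0\<close> a_pos k slope x(1) width]
    by blast
  show ?thesis
  proof (rule that[of a v "- l" r v'])
    show "0 \<le> v y \<and> v y \<le> a" if "- l \<le> y" "y \<le> r" for y
      using r(4)[of y] l(4)[of "- y"] that by (cases "0 \<le> y") auto
  qed (use a a_pos v r l in auto)
qed

locale smooth_evolution =
  fixes w wx wxx wt :: "real \<Rightarrow> real \<Rightarrow> real"
  assumes dx: "\<And>x t. 0 < t \<Longrightarrow> ((\<lambda>y. w y t) has_real_derivative wx x t) (at x)"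
    and dxx: "\<And>x t. 0 < t \<Longrightarrow> ((\<lambda>y. wx y t) has_real_derivative wxx x t) (at x)"
    and dt: "\<And>x t. 0 < t \<Longrightarrow> ((\<lambda>s. w x s) has_real_derivative wt x t) (at t)"
    and cont_w: "continuous_on (UNIV \<times> {0<..}) (\<lambda>(x, t). w x t)"
    and cont_wx: "continuous_on (UNIV \<times> {0<..}) (\<lambda>(x, t). wx x t)"
    and cont_wxx: "continuous_on (UNIV \<times> {0<..}) (\<lambda>(x, t). wxx x t)"
    and cont_wt: "continuous_on (UNIV \<times> {0<..}) (\<lambda>(x, t). wt x t)"
begin

lemma continuous_along:
  assumes "continuous_on S a" "continuous_on S b" "\<And>z. z \<in> S \<Longrightarrow> 0 < b z"
  shows "continuous_on S (\<lambda>z. w (a z) (b z))" "continuous_on S (\<lambda>z. wx (a z) (b z))"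
    "continuous_on S (\<lambda>z. wxx (a z) (b z))" "continuous_on S (\<lambda>z. wt (a z) (b z))"
  using continuous_on_compose2[OF cont_w continuous_on_Pair[OF assms(1,2)]]
    continuous_on_compose2[OF cont_wx continuous_on_Pair[OF assms(1,2)]]
    continuous_on_compose2[OF cont_wxx continuous_on_Pair[OF assms(1,2)]]
    continuous_on_compose2[OF cont_wt continuous_on_Pair[OF assms(1,2)]] assms(3)
  by auto

lemma weighted_integral_time_derivative:
  fixes j j' \<eta> :: "real \<Rightarrow> real"
  assumes j: "\<And>s. (j has_real_derivative j' s) (at s)" "continuous_on UNIV j'"
    and \<eta>: "continuous_on UNIV \<eta>" and t: "0 < t"
  shows "((\<lambda>t. integral {a..b} (\<lambda>x. \<eta> x * j (w x t))) has_real_derivative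
           integral {a..b} (\<lambda>x. \<eta> x * (j' (w x t) * wt x t))) (at t)"
proof -
  have cj: "continuous_on S (\<lambda>z. j (k z))" "continuous_on S (\<lambda>z. j' (k z))" "continuous_on S (\<lambda>z. \<eta> (k z))"
    if "continuous_on S k" for S and k :: "'z::topological_space \<Rightarrow> real"
  proof -
    have "continuous_on UNIV j"
      using j(1) by (auto intro: DERIV_continuous_on)
    then show "continuous_on S (\<lambda>z. j (k z))" "continuous_on S (\<lambda>z. j' (k z))" "continuous_on S (\<lambda>z. \<eta> (k z))"
      using continuous_on_compose2[OF _ that] j(2) \<eta> by auto
  qed
  have "((\<lambda>t. integral (cbox a b) (\<lambda>x. \<eta> x * j (w x t))) has_real_derivative
           integral (cbox a b) (\<lambda>x. \<eta> x * (j' (w x t) * wt x t))) (at t within {0<..})"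
  proof (rule leibniz_rule_field_derivative)
    show "((\<lambda>t. \<eta> x * j (w x t)) has_real_derivative \<eta> x * (j' (w x s) * wt x s)) (at s within {0<..})"
      if "s \<in> {0<..}" for s x
      using that by (auto intro!: DERIV_cmult DERIV_chain2[OF j(1)] DERIV_subset[OF dt])
    show "(\<lambda>x. \<eta> x * j (w x s)) integrable_on cbox a b" if "s \<in> {0<..}" for s
      using that by (intro integrable_continuous continuous_on_mult cj continuous_along continuous_on_id continuous_on_const) auto
    show "continuous_on ({0<..} \<times> cbox a b) (\<lambda>(s, x). \<eta> x * (j' (w x s) * wt x s))"
      unfolding split_beta'
      by (intro continuous_on_mult cj continuous_along continuous_on_fst continuous_on_snd continuous_on_id) auto
  qed (use t in auto)
  then show ?thesis
    using t at_within_open[of t "{0<..}"] by simp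
qed

text \<open>The identity integrates the derivative of \<open>\<eta> j'(w) w\<^sub>x - \<eta>' j(w)\<close>. The two kinds of boundary condition
  on the right cover a cutoff that ends there and a solution that vanishes there.\<close>

lemma weighted_integration_by_parts:
  fixes j j' j'' \<eta> \<eta>' \<eta>'' :: "real \<Rightarrow> real"
  assumes j: "\<And>s. (j has_real_derivative j' s) (at s)" "\<And>s. (j' has_real_derivative j'' s) (at s)"
      "continuous_on UNIV j''"
    and \<eta>: "\<And>x. (\<eta> has_real_derivative \<eta>' x) (at x)" "\<And>x. (\<eta>' has_real_derivative \<eta>'' x) (at x)"
      "continuous_on UNIV \<eta>''"
    and t: "0 < t" and ab: "a \<le> b"
    and left: "\<eta> a = 0" "\<eta>' a = 0"
    and right: "\<eta> b = 0 \<and> \<eta>' b = 0 \<or> j (w b t) = 0 \<and> j' (w b t) = 0"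
  shows "integral {a..b} (\<lambda>x. \<eta> x * (j' (w x t) * wxx x t)) =
    integral {a..b} (\<lambda>x. \<eta>'' x * j (w x t)) - integral {a..b} (\<lambda>x. \<eta> x * (j'' (w x t) * (wx x t)\<^sup>2))"
proof -
  have C: "continuous_on UNIV j" "continuous_on UNIV j'" "continuous_on UNIV \<eta>"
    using j \<eta> by (auto intro: DERIV_continuous_on)
  have cj: "continuous_on {a..b} (\<lambda>x. j (w x t))" "continuous_on {a..b} (\<lambda>x. j' (w x t))" "continuous_on {a..b} (\<lambda>x. j'' (w x t))"
    by (rule continuous_on_compose2[OF C(1)] continuous_on_compose2[OF C(2)] continuous_on_compose2[OF j(3)];
        use t in \<open>auto intro!: continuous_along continuous_intros\<close>)+
  have ce: "continuous_on {a..b} \<eta>" "continuous_on {a..b} \<eta>''"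
    using C(3) \<eta>(3) continuous_on_subset by blast+
  have cw: "continuous_on {a..b} (\<lambda>x. wx x t)" "continuous_on {a..b} (\<lambda>x. wxx x t)"
    using t by (auto intro!: continuous_along continuous_intros)
  have i: "(\<lambda>x. \<eta> x * (j' (w x t) * wxx x t)) integrable_on {a..b}"
      "(\<lambda>x. \<eta> x * (j'' (w x t) * (wx x t)\<^sup>2)) integrable_on {a..b}"
      "(\<lambda>x. \<eta>'' x * j (w x t)) integrable_on {a..b}"
    by (intro integrable_continuous_real continuous_on_mult continuous_on_power cj ce cw)+
  have "((\<lambda>x. (\<eta> x * (j' (w x t) * wxx x t) + \<eta> x * (j'' (w x t) * (wx x t)\<^sup>2)) - \<eta>'' x * j (w x t)) has_integral
     (\<eta> b * j' (w b t) * wx b t - \<eta>' b * j (w b t)) - (\<eta> a * j' (w a t) * wx a t - \<eta>' a * j (w a t))) {a..b}"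
  proof (rule fundamental_theorem_of_calculus[OF ab])
    fix x
    have "((\<lambda>x. \<eta> x * j' (w x t) * wx x t - \<eta>' x * j (w x t)) has_real_derivative
      (\<eta> x * (j' (w x t) * wxx x t) + \<eta> x * (j'' (w x t) * (wx x t)\<^sup>2)) - \<eta>'' x * j (w x t)) (at x)"
      using t by (auto intro!: derivative_eq_intros \<eta> DERIV_chain2[OF j(1)] DERIV_chain2[OF j(2)] dx dxx
          simp: algebra_simps power2_eq_square)
    then show "((\<lambda>x. \<eta> x * j' (w x t) * wx x t - \<eta>' x * j (w x t)) has_vector_derivative
      (\<eta> x * (j' (w x t) * wxx x t) + \<eta> x * (j'' (w x t) * (wx x t)\<^sup>2)) - \<eta>'' x * j (w x t)) (at x within {a..b})"
      by (simp add: has_real_derivative_iff_has_vector_derivative has_vector_derivative_at_within)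
  qed
  then have "((\<lambda>x. (\<eta> x * (j' (w x t) * wxx x t) + \<eta> x * (j'' (w x t) * (wx x t)\<^sup>2)) - \<eta>'' x * j (w x t)) has_integral 0) {a..b}"
    using left right by auto
  moreover have "((\<lambda>x. (\<eta> x * (j' (w x t) * wxx x t) + \<eta> x * (j'' (w x t) * (wx x t)\<^sup>2)) - \<eta>'' x * j (w x t)) has_integral
     (integral {a..b} (\<lambda>x. \<eta> x * (j' (w x t) * wxx x t)) + integral {a..b} (\<lambda>x. \<eta> x * (j'' (w x t) * (wx x t)\<^sup>2)))
      - integral {a..b} (\<lambda>x. \<eta>'' x * j (w x t))) {a..b}"
    using i by (intro has_integral_diff has_integral_add integrable_integral)
  ultimately show ?thesis
    by (auto dest: has_integral_unique)
qed

end

section \<open>Comparison on a half-line\<close>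

lemma has_real_derivative_max_zero_power:
  fixes s :: real
  shows "((\<lambda>s. max 0 s ^ Suc (Suc n)) has_real_derivative real (Suc (Suc n)) * max 0 s ^ Suc n) (at s)"
proof -
  consider "s > 0" | "s < 0" | "s = 0" by linarith
  then show ?thesis
  proof cases
    case 1
    have "((\<lambda>s. s ^ Suc (Suc n)) has_real_derivative real (Suc (Suc n)) * max 0 s ^ Suc n) (at s)"
      using 1 DERIV_pow[of "Suc (Suc n)" s] by simp
    then show ?thesis
      by (rule has_field_derivative_transform_within_open[of _ _ _ "{0<..}"]) (use 1 in auto)
  next
    case 2
    have "((\<lambda>s. 0) has_real_derivative real (Suc (Suc n)) * max 0 s ^ Suc n) (at s)"
      using 2 by auto
    then show ?thesis
      by (rule has_field_derivative_transform_within_open[of _ _ _ "{..<0}"]) (use 2 in auto)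
  next
    case 3
    have "((\<lambda>h. (max 0 h ^ Suc (Suc n)) / h) \<longlongrightarrow> 0) (at (0::real))"
    proof (rule Lim_null_comparison)
      show "\<forall>\<^sub>F h in at (0::real). norm (max 0 h ^ Suc (Suc n) / h) \<le> \<bar>h\<bar> ^ Suc n"
        by (rule always_eventually) (auto simp: max_def abs_mult power_abs abs_divide intro!: mult_nonpos_nonneg)
      show "((\<lambda>h. \<bar>h\<bar> ^ Suc n) \<longlongrightarrow> 0) (at (0::real))"
        by (rule tendsto_eq_intros refl | simp)+
    qed
    then show ?thesis
      using 3 by (simp add: has_field_derivative_iff)
  qed
qed

text \<open>A cutoff for which \<open>\<eta>'\<^sup>2 \<le> C R\<^sup>-\<^sup>2 \<eta>\<close> and \<open>\<bar>\<eta>''\<bar> \<le> C R\<^sup>-\<^sup>2\<close> on \<open>[-R,R]\<close>, where it is meant to be used; it vanishes to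
  first order at the endpoints, so integration by parts leaves no boundary terms. The primed versions are
  its derivatives.\<close>

definition cutoff :: "real \<Rightarrow> real \<Rightarrow> real" where
  "cutoff R x = (1 - (x / R)\<^sup>2)\<^sup>2"

definition cutoff' :: "real \<Rightarrow> real \<Rightarrow> real" where
  "cutoff' R x = - 4 * (x / R) * (1 - (x / R)\<^sup>2) / R"

definition cutoff'' :: "real \<Rightarrow> real \<Rightarrow> real" where
  "cutoff'' R x = (12 * (x / R)\<^sup>2 - 4) / R\<^sup>2"

lemma cutoff_deriv:
  assumes "R > 0"
  shows "(cutoff R has_real_derivative cutoff' R x) (at x)"
    "(cutoff' R has_real_derivative cutoff'' R x) (at x)"
  unfolding cutoff_def[abs_def] cutoff'_def[abs_def] cutoff''_def using assms
  by (auto intro!: derivative_eq_intros simp: field_simps power2_eq_square)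

lemma continuous_cutoff:
  "continuous_on S (cutoff R)" "continuous_on S (cutoff' R)" "continuous_on S (cutoff'' R)"
proof -
  have "continuous_on UNIV (cutoff R)" "continuous_on UNIV (cutoff' R)" "continuous_on UNIV (cutoff'' R)"
    unfolding cutoff_def[abs_def] cutoff'_def[abs_def] cutoff''_def[abs_def] divide_inverse
    by (intro continuous_intros)+
  then show "continuous_on S (cutoff R)" "continuous_on S (cutoff' R)" "continuous_on S (cutoff'' R)"
    using continuous_on_subset by blast+
qed

lemma cutoff_boundary:
  assumes "R > 0"
  shows "cutoff R R = 0" "cutoff R (- R) = 0" "cutoff' R R = 0" "cutoff' R (- R) = 0"
  using assms by (simp_all add: cutoff_def cutoff'_def)

lemma cutoff_nonneg: "cutoff R x \<ge> 0"
  by (simp add: cutoff_def)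

lemma cutoff_bounds:
  assumes "R > 0" "- R \<le> x" "x \<le> R"
  shows "cutoff R x \<le> 1" "\<bar>cutoff'' R x\<bar> \<le> 8 / R\<^sup>2" "(cutoff' R x)\<^sup>2 \<le> 16 / R\<^sup>2 * cutoff R x"
proof -
  have "\<bar>x / R\<bar> \<le> 1"
    using assms by (auto simp: abs_le_iff divide_simps)
  then have q: "(x / R)\<^sup>2 \<le> 1"
    by (simp add: abs_square_le_1)
  then show "cutoff R x \<le> 1"
    unfolding cutoff_def by (intro power_le_one) auto
  have "\<bar>12 * (x / R)\<^sup>2 - 4\<bar> \<le> 8"
    using q zero_le_power2[of "x / R"] by linarith
  then show "\<bar>cutoff'' R x\<bar> \<le> 8 / R\<^sup>2"
    unfolding cutoff''_def by (simp add: abs_divide divide_right_mono)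
  have "(cutoff' R x)\<^sup>2 = 16 / R\<^sup>2 * cutoff R x * (x / R)\<^sup>2"
    unfolding cutoff'_def cutoff_def by (simp add: power_mult_distrib power_divide)
  also have "\<dots> \<le> 16 / R\<^sup>2 * cutoff R x * 1"
    by (intro mult_left_mono q mult_nonneg_nonneg cutoff_nonneg) auto
  finally show "(cutoff' R x)\<^sup>2 \<le> 16 / R\<^sup>2 * cutoff R x" by simp
qed

lemma cutoff_ge_half:
  assumes "R > 0" "\<bar>x\<bar> \<le> R / 2"
  shows "cutoff R x \<ge> 1 / 2"
proof -
  have "\<bar>x / R\<bar> \<le> 1 / 2"
    using assms by (auto simp: abs_divide divide_simps)
  then have "(x / R)\<^sup>2 \<le> (1 / 2)\<^sup>2"
    by (metis abs_ge_zero power2_abs power_mono)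
  then have "(3 / 4)\<^sup>2 \<le> (1 - (x / R)\<^sup>2)\<^sup>2"
    by (intro power_mono) (auto simp: power2_eq_square)
  then show ?thesis
    unfolding cutoff_def by (rule order_trans[rotated]) (simp add: power2_eq_square)
qed

context smooth_evolution
begin

text \<open>The initial values are attained only in an integral sense, so a pointwise maximum principle does not
  apply; instead \<open>\<integral> \<eta> (w\<^sup>+)\<^sup>3\<close> is estimated. The cube is used because it is twice continuously
  differentiable. With the cutoff \<open>\<eta>\<close> of radius \<open>R\<close>, this integral grows at most at the exponential
  rate \<open>3 K\<close>, up to the error \<open>\<integral> \<eta>'' (w\<^sup>+)\<^sup>3 = O(1/R)\<close>, and it starts from \<open>0\<close>.\<close>

lemma nonpos_on_half_line:
  assumes bdd: "\<And>x t. 0 < t \<Longrightarrow> \<bar>w x t\<bar> \<le> M"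
    and edge: "\<And>t. 0 < t \<Longrightarrow> w c t = 0"
    and sub: "\<And>x t. 0 < t \<Longrightarrow> x < c \<Longrightarrow> 0 < w x t \<Longrightarrow> wt x t \<le> wxx x t + K * w x t" and K: "K \<ge> 0"
    and init: "\<And>R. ((\<lambda>s. integral {- R..c} (\<lambda>x. max 0 (w x s) ^ 3)) \<longlongrightarrow> 0) (at_right 0)"
    and x: "x \<le> c" and t: "0 < t"
  shows "w x t \<le> 0"
proof -
  define j j' j'' :: "real \<Rightarrow> real" where "j s = max 0 s ^ 3" and "j' s = 3 * max 0 s ^ 2" and "j'' s = 6 * max 0 s" for s
  have M: "M \<ge> 0" using bdd[OF t, of 0] by simp
  have j: "(j has_real_derivative j' s) (at s)" "(j' has_real_derivative j'' s) (at s)" for s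
  proof -
    show "(j has_real_derivative j' s) (at s)"
      using has_real_derivative_max_zero_power[of 1 s] unfolding j_def[abs_def] j'_def
      by (simp add: numeral_3_eq_3 numeral_2_eq_2)
    show "(j' has_real_derivative j'' s) (at s)"
      using DERIV_cmult[OF has_real_derivative_max_zero_power[of 0 s], of 3] unfolding j'_def[abs_def] j''_def
      by (simp add: numeral_2_eq_2)
  qed
  have cj: "continuous_on UNIV j" "continuous_on UNIV j'" "continuous_on UNIV j''"
    unfolding j_def[abs_def] j'_def[abs_def] j''_def[abs_def] by (intro continuous_intros)+
  have cjw: "continuous_on S (\<lambda>x. j (w x s))" "continuous_on S (\<lambda>x. j' (w x s))" "continuous_on S (\<lambda>x. j'' (w x s))"
    if "0 < s" for S s
    by (rule continuous_on_compose2[OF cj(1)] continuous_on_compose2[OF cj(2)] continuous_on_compose2[OF cj(3)];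
        use that in \<open>auto intro!: continuous_along continuous_intros\<close>)+
  have j_nonneg: "0 \<le> j s" "0 \<le> j' s" "0 \<le> j'' s" for s
    by (auto simp: j_def j'_def j''_def)
  have jw: "j (w x s) \<le> M ^ 3" if "0 < s" for x s
    unfolding j_def using bdd[OF that, of x] M by (intro power_mono) auto
  define G where "G R s = integral {- R..c} (\<lambda>x. cutoff R x * j (w x s))" for R s
  have G_bound: "G R t \<le> exp (3 * K * t) * (16 * M ^ 3 / R * t)" if R: "R > 0" "\<bar>c\<bar> < R" for R
  proof -
    define D where "D s = integral {- R..c} (\<lambda>x. cutoff R x * (j' (w x s) * wt x s))" for s
    have dG: "(G R has_real_derivative D s) (at s)" if "0 < s" for s
      unfolding G_def[abs_def] D_def
      by (rule weighted_integral_time_derivative[OF j(1) cj(2) continuous_cutoff(1) that])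
    note ci = continuous_on_mult continuous_cutoff cjw continuous_along continuous_on_id continuous_on_const continuous_on_power
    have D_le: "D s \<le> 16 * M ^ 3 / R + 3 * K * G R s" if s: "0 < s" for s
    proof -
      have I: "(\<lambda>x. cutoff R x * (j' (w x s) * wxx x s)) integrable_on {- R..c}"
        "(\<lambda>x. cutoff R x * (j'' (w x s) * (wx x s)\<^sup>2)) integrable_on {- R..c}"
        "(\<lambda>x. cutoff'' R x * j (w x s)) integrable_on {- R..c}"
        "(\<lambda>x. cutoff R x * j (w x s)) integrable_on {- R..c}"
        "(\<lambda>x. cutoff R x * (j' (w x s) * wt x s)) integrable_on {- R..c}"
        using s by (intro integrable_continuous_real ci; simp)+
      have "D s \<le> integral {- R..c} (\<lambda>x. cutoff R x * (j' (w x s) * wxx x s) + 3 * K * (cutoff R x * j (w x s)))"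
        unfolding D_def
      proof (rule integral_le)
        fix x assume x: "x \<in> {- R..c}"
        have "j' (w x s) * wt x s \<le> j' (w x s) * wxx x s + 3 * K * j (w x s)"
        proof (cases "0 < w x s")
          case True
          have "x \<noteq> c" using True edge[OF s] by auto
          then have "wt x s \<le> wxx x s + K * w x s"
            using sub[OF s _ True] x by auto
          then have "j' (w x s) * wt x s \<le> j' (w x s) * (wxx x s + K * w x s)"
            using j_nonneg by (intro mult_left_mono) auto
          also have "j' (w x s) * (wxx x s + K * w x s) = j' (w x s) * wxx x s + 3 * K * j (w x s)"
            using True by (simp add: j_def j'_def algebra_simps power2_eq_square power3_eq_cube)
          finally show ?thesis .
        qed (auto simp: j_def j'_def)
        from mult_left_mono[OF this cutoff_nonneg[of R x]]
        show "cutoff R x * (j' (w x s) * wt x s) \<le> cutoff R x * (j' (w x s) * wxx x s) + 3 * K * (cutoff R x * j (w x s))"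
          by (simp add: algebra_simps)
      qed (use I in \<open>auto intro!: integrable_add integrable_on_mult_right\<close>)
      also have "\<dots> = integral {- R..c} (\<lambda>x. cutoff R x * (j' (w x s) * wxx x s)) + 3 * K * G R s"
        unfolding G_def using I by (subst integral_add) (auto intro!: integrable_on_mult_right)
      also have "integral {- R..c} (\<lambda>x. cutoff R x * (j' (w x s) * wxx x s)) =
          integral {- R..c} (\<lambda>x. cutoff'' R x * j (w x s)) - integral {- R..c} (\<lambda>x. cutoff R x * (j'' (w x s) * (wx x s)\<^sup>2))"
        using R edge[OF s]
        by (intro weighted_integration_by_parts[where \<eta>' = "cutoff' R"] j cj cutoff_deriv continuous_cutoff s cutoff_boundary) (auto simp: j_def j'_def)
      also have "\<dots> \<le> integral {- R..c} (\<lambda>x. 8 / R\<^sup>2 * M ^ 3) - 0"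
      proof (rule diff_mono)
        show "integral {- R..c} (\<lambda>x. cutoff'' R x * j (w x s)) \<le> integral {- R..c} (\<lambda>x. 8 / R\<^sup>2 * M ^ 3)"
        proof (rule integral_le)
          fix x assume x: "x \<in> {- R..c}"
          have "- R \<le> x" "x \<le> R"
            using x R by auto
          then have "cutoff'' R x \<le> 8 / R\<^sup>2"
            using cutoff_bounds(2)[OF R(1)] abs_le_D1 by blast
          then show "cutoff'' R x * j (w x s) \<le> 8 / R\<^sup>2 * M ^ 3"
            using jw[OF s] j_nonneg R M by (intro mult_mono) auto
        qed (use I in auto)
        show "0 \<le> integral {- R..c} (\<lambda>x. cutoff R x * (j'' (w x s) * (wx x s)\<^sup>2))"
          by (intro integral_nonneg I mult_nonneg_nonneg cutoff_nonneg j_nonneg) auto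
      qed
      also have "\<dots> = (c + R) * (8 / R\<^sup>2 * M ^ 3)"
        using R by simp
      also have "\<dots> \<le> (2 * R) * (8 / R\<^sup>2 * M ^ 3)"
        using R M by (intro mult_right_mono) auto
      also have "\<dots> = 16 * M ^ 3 / R"
        using R by (simp add: power2_eq_square)
      finally show ?thesis by simp
    qed
    define C where "C = 16 * M ^ 3 / R"
    have C: "C \<ge> 0" using M R by (simp add: C_def)
    \<comment> \<open>Gronwall: this quantity is nonincreasing in time.\<close>
    define E where "E s = exp (- 3 * K * s) * G R s - C * s" for s
    have E_mono: "E t \<le> E s" if s: "0 < s" "s \<le> t" for s
    proof (rule DERIV_nonpos_imp_nonincreasing[OF s(2)])
      fix r assume "s \<le> r" "r \<le> t"
      with s have r: "0 < r" by simp
      have "(E has_real_derivative exp (- 3 * K * r) * (D r - 3 * K * G R r) - C) (at r)"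
        unfolding E_def[abs_def] using dG[OF r] by (auto intro!: derivative_eq_intros simp: algebra_simps)
      moreover have "exp (- 3 * K * r) * (D r - 3 * K * G R r) \<le> exp (- 3 * K * r) * C"
        using D_le[OF r] by (intro mult_left_mono) (auto simp: C_def)
      moreover have "exp (- 3 * K * r) * C \<le> 1 * C"
        using r K C by (intro mult_right_mono) auto
      ultimately show "\<exists>y. (E has_real_derivative y) (at r) \<and> y \<le> 0"
        by (intro exI[of _ "exp (- 3 * K * r) * (D r - 3 * K * G R r) - C"] conjI) (assumption, linarith)
    qed
    have "E t \<le> 0"
    proof (rule tendsto_lowerbound)
      show "((\<lambda>s. integral {- R..c} (\<lambda>x. max 0 (w x s) ^ 3)) \<longlongrightarrow> 0) (at_right 0)" by (rule init)
      show "\<forall>\<^sub>F s in at_right 0. E t \<le> integral {- R..c} (\<lambda>x. max 0 (w x s) ^ 3)"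
        unfolding eventually_at_right_field
      proof (intro exI[of _ t] conjI allI impI)
        fix s assume s: "0 < s" "s < t"
        have G_le: "G R s \<le> integral {- R..c} (\<lambda>x. max 0 (w x s) ^ 3)"
          unfolding G_def
        proof (rule integral_le)
          show "(\<lambda>x. cutoff R x * j (w x s)) integrable_on {- R..c}"
            using s by (intro integrable_continuous_real ci; simp)
          show "(\<lambda>x. max 0 (w x s) ^ 3) integrable_on {- R..c}"
            using integrable_continuous_real[OF cjw(1)[OF s(1)]] by (simp add: j_def)
          show "cutoff R x * j (w x s) \<le> max 0 (w x s) ^ 3" if "x \<in> {- R..c}" for x
          proof -
            have "- R \<le> x" "x \<le> R"
              using that R by auto
            from mult_right_mono[OF cutoff_bounds(1)[OF R(1) this] j_nonneg(1)[of "w x s"]]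
            show ?thesis by (simp add: j_def)
          qed
        qed
        have "0 \<le> G R s"
          unfolding G_def using s
          by (intro integral_nonneg integrable_continuous_real ci mult_nonneg_nonneg cutoff_nonneg j_nonneg; simp)
        then have "exp (- 3 * K * s) * G R s \<le> 1 * G R s"
          using s K by (intro mult_right_mono) auto
        then have "E s \<le> G R s"
          using C s by (simp add: E_def) (smt (verit) mult_nonneg_nonneg)
        then show "E t \<le> integral {- R..c} (\<lambda>x. max 0 (w x s) ^ 3)"
          using E_mono[of s] s G_le by simp
      qed (use t in auto)
    qed simp
    then have "exp (3 * K * t) * (exp (- 3 * K * t) * G R t) \<le> exp (3 * K * t) * (C * t)"
      by (intro mult_left_mono) (auto simp: E_def)
    then show ?thesis
      by (simp add: C_def flip: mult.assoc exp_add)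
  qed
  show ?thesis
  proof (cases "x = c")
    case True
    then show ?thesis using edge[OF t] by simp
  next
    case False
    with x have xc: "x < c" by simp
    define P where "P = integral {x..c} (\<lambda>y. j (w y t))"
    have "P / 2 \<le> exp (3 * K * t) * (16 * M ^ 3 / R * t)" if R: "R > 2 * (\<bar>x\<bar> + \<bar>c\<bar>)" for R
    proof -
      have iG: "(\<lambda>x. cutoff R x * j (w x t)) integrable_on {p..q}" for p q
        using t by (intro integrable_continuous_real continuous_on_mult continuous_cutoff cjw)
      have "P / 2 = integral {x..c} (\<lambda>y. 1 / 2 * j (w y t))"
        unfolding P_def by simp
      also have "\<dots> \<le> integral {x..c} (\<lambda>y. cutoff R y * j (w y t))"
      proof (rule integral_le)
        show "(\<lambda>y. 1 / 2 * j (w y t)) integrable_on {x..c}"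
          using t by (intro integrable_continuous_real continuous_on_mult continuous_on_const cjw)
        show "1 / 2 * j (w y t) \<le> cutoff R y * j (w y t)" if "y \<in> {x..c}" for y
          using that R by (intro mult_right_mono j_nonneg cutoff_ge_half) auto
      qed (rule iG)
      also have "\<dots> \<le> G R t"
        unfolding G_def using R
        by (intro integral_subset_le iG) (auto intro!: mult_nonneg_nonneg cutoff_nonneg j_nonneg)
      also have "\<dots> \<le> exp (3 * K * t) * (16 * M ^ 3 / R * t)"
        using R by (intro G_bound) auto
      finally show ?thesis .
    qed
    then have "\<forall>\<^sub>F R in at_top. P / 2 \<le> exp (3 * K * t) * (16 * M ^ 3 / R * t)"
      unfolding eventually_at_top_dense by blast
    moreover have "((\<lambda>R. exp (3 * K * t) * (16 * M ^ 3 / R * t)) \<longlongrightarrow> exp (3 * K * t) * (0 * t)) at_top"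
      by (intro tendsto_intros real_tendsto_divide_at_top[where c = "16 * M ^ 3"] filterlim_ident)
    ultimately have "P / 2 \<le> exp (3 * K * t) * (0 * t)"
      by (intro tendsto_lowerbound) auto
    moreover have "0 \<le> P"
      unfolding P_def using t by (intro integral_nonneg integrable_continuous_real cjw j_nonneg)
    ultimately have "P = 0" by simp
    then have "\<forall>y\<in>{x..c}. j (w y t) = 0"
      using integral_eq_0_iff[OF cjw(1)[OF t] xc] j_nonneg unfolding P_def by blast
    then have "j (w x t) = 0" using xc by auto
    then show ?thesis by (auto simp: j_def max_def split: if_splits)
  qed
qed

end

section \<open>Symmetry and monotonicity\<close>

locale bounded_solution = smooth_evolution u ux uxx ut
  for u ux uxx ut :: "real \<Rightarrow> real \<Rightarrow> real" +
  fixes g :: "real \<Rightarrow> real" and M K :: real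
  assumes pde: "\<And>x t. 0 < t \<Longrightarrow> ut x t = uxx x t + g (u x t)"
    and u_nonneg: "\<And>x t. 0 < t \<Longrightarrow> 0 \<le> u x t"
    and u_le: "\<And>x t. 0 < t \<Longrightarrow> u x t \<le> M"
    and cont_g: "continuous_on UNIV g"
    and lip: "\<And>a b. 0 \<le> a \<Longrightarrow> a \<le> M \<Longrightarrow> 0 \<le> b \<Longrightarrow> b \<le> M \<Longrightarrow> \<bar>g a - g b\<bar> \<le> K * \<bar>a - b\<bar>"
    and K_nonneg: "0 \<le> K"
    and M_ge_1: "1 \<le> M"
begin

text \<open>Composing \<open>u(\<cdot>,t)\<close> with an isometry \<open>x \<mapsto> c\<^sub>i + e\<^sub>i x\<close> of the line gives another solution. Two such
  solutions that agree at \<open>c\<close> and are ordered initially to the left of \<open>c\<close> stay ordered there. The order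
  of the data is required almost everywhere only, because \<open>\<phi>\<close> may take any value at the origin.\<close>

lemma isometric_comparison:
  fixes \<phi> :: "real \<Rightarrow> real"
  assumes int: "\<And>s. 0 < s \<Longrightarrow> integrable lebesgue (\<lambda>x. (u x s - \<phi> x)\<^sup>2)"
    and lim: "((\<lambda>s. LINT x|lebesgue. (u x s - \<phi> x)\<^sup>2) \<longlongrightarrow> 0) (at_right 0)"
    and iso: "e1 = 1 \<or> e1 = -1" "e2 = 1 \<or> e2 = -1"
    and meet: "c1 + e1 * c = c2 + e2 * c"
    and ordered: "AE x in lebesgue. x \<le> c \<longrightarrow> \<phi> (c1 + e1 * x) \<le> \<phi> (c2 + e2 * x)"
    and x: "x \<le> c" and t: "0 < t"
  shows "u (c1 + e1 * x) t \<le> u (c2 + e2 * x) t"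
proof -
  define w where "w x t = u (c1 + e1 * x) t - u (c2 + e2 * x) t" for x t
  define wx where "wx x t = e1 * ux (c1 + e1 * x) t - e2 * ux (c2 + e2 * x) t" for x t
  define wxx where "wxx x t = uxx (c1 + e1 * x) t - uxx (c2 + e2 * x) t" for x t
  define wt where "wt x t = ut (c1 + e1 * x) t - ut (c2 + e2 * x) t" for x t
  have aff: "((\<lambda>x. p + e * x) has_real_derivative e) (at x)" for p e x :: real
    by (auto intro!: derivative_eq_intros)
  have sq_sum: "(\<bar>p\<bar> + \<bar>q\<bar>)\<^sup>2 \<le> 2 * (p\<^sup>2 + q\<^sup>2)" for p q :: real
    using zero_le_power2[of "\<bar>p\<bar> - \<bar>q\<bar>"] by (simp add: power2_sum power2_diff)
  have sq: "e1 * e1 = 1" "e2 * e2 = 1" using iso by auto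
  interpret w: smooth_evolution w wx wxx wt
  proof
    fix x t :: real assume t: "0 < t"
    show "((\<lambda>y. w y t) has_real_derivative wx x t) (at x)"
      unfolding w_def wx_def using DERIV_chain2[OF dx[OF t] aff, of c1 e1 x] DERIV_chain2[OF dx[OF t] aff, of c2 e2 x]
      by (auto intro!: derivative_eq_intros)
    have "((\<lambda>y. e1 * ux (c1 + e1 * y) t - e2 * ux (c2 + e2 * y) t) has_real_derivative
        e1 * (uxx (c1 + e1 * x) t * e1) - e2 * (uxx (c2 + e2 * x) t * e2)) (at x)"
      by (intro DERIV_diff DERIV_cmult DERIV_chain2[OF dxx[OF t] aff])
    also have "e1 * (uxx (c1 + e1 * x) t * e1) - e2 * (uxx (c2 + e2 * x) t * e2) = wxx x t"
      using sq by (simp add: wxx_def algebra_simps flip: mult.assoc)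
    finally show "((\<lambda>y. wx y t) has_real_derivative wxx x t) (at x)"
      unfolding wx_def .
    show "((\<lambda>s. w x s) has_real_derivative wt x t) (at t)"
      unfolding w_def wt_def using dt[OF t] by (auto intro!: derivative_eq_intros)
  next
    show "continuous_on (UNIV \<times> {0<..}) (\<lambda>(x, t). w x t)" "continuous_on (UNIV \<times> {0<..}) (\<lambda>(x, t). wx x t)"
      "continuous_on (UNIV \<times> {0<..}) (\<lambda>(x, t). wxx x t)" "continuous_on (UNIV \<times> {0<..}) (\<lambda>(x, t). wt x t)"
      unfolding w_def wx_def wxx_def wt_def split_beta'
      by (intro continuous_on_diff continuous_on_mult continuous_along continuous_on_add continuous_on_const
          continuous_on_fst continuous_on_snd continuous_on_id; auto)+
  qed
  have "w x t \<le> 0"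
  proof (rule w.nonpos_on_half_line[where K = K and M = M and c = c])
    fix y s :: real assume s: "0 < s"
    show "\<bar>w y s\<bar> \<le> M"
      unfolding w_def using u_nonneg[OF s] u_le[OF s] by (smt (verit))
    show "w c s = 0"
      unfolding w_def by (simp add: meet)
    show "wt y s \<le> wxx y s + K * w y s" if "0 < w y s"
      using lip[of "u (c1 + e1 * y) s" "u (c2 + e2 * y) s"] u_nonneg[OF s] u_le[OF s] that
      unfolding wt_def wxx_def w_def by (simp add: pde[OF s] abs_if split: if_splits)
  next
    fix R :: real
    define I where "I s = (LINT x|lebesgue. (u x s - \<phi> x)\<^sup>2)" for s
    have bound: "integral {- R..c} (\<lambda>x. max 0 (w x s) ^ 3) \<le> 4 * M * I s \<and>
        0 \<le> integral {- R..c} (\<lambda>x. max 0 (w x s) ^ 3)" if s: "0 < s" for s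
    proof
      have cw: "continuous_on {- R..c} (\<lambda>x. max 0 (w x s) ^ 3)"
        using s by (intro continuous_intros w.continuous_along) auto
      show "0 \<le> integral {- R..c} (\<lambda>x. max 0 (w x s) ^ 3)"
        using cw by (intro integral_nonneg integrable_continuous_real) auto
      define A where "A p e x = (u (p + e * x) s - \<phi> (p + e * x))\<^sup>2" for p e x
      have A: "integrable lebesgue (A p e)" "integral\<^sup>L lebesgue (A p e) = I s" if "e = 1 \<or> e = -1" for p e
        unfolding A_def[abs_def] I_def
        using that lebesgue_integrable_real_affine[OF int[OF s], of e p] lebesgue_integral_real_affine[of e "\<lambda>x. (u x s - \<phi> x)\<^sup>2" p]
        by auto
      have iw: "integrable (lebesgue_on {- R..c}) (\<lambda>x. max 0 (w x s) ^ 3)"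
        using cw by (rule continuous_imp_integrable_real)
      have "integral {- R..c} (\<lambda>x. max 0 (w x s) ^ 3) = integral\<^sup>L (lebesgue_on {- R..c}) (\<lambda>x. max 0 (w x s) ^ 3)"
        using iw by (simp add: lebesgue_integral_eq_integral)
      also have "\<dots> = (LINT x|lebesgue. indicator {- R..c} x *\<^sub>R (max 0 (w x s) ^ 3))"
        by (simp add: integral_restrict_space)
      also have "\<dots> \<le> (LINT x|lebesgue. 2 * M * (A c1 e1 x + A c2 e2 x))"
      proof (rule integral_mono_AE)
        show "integrable lebesgue (\<lambda>x. indicator {- R..c} x *\<^sub>R (max 0 (w x s) ^ 3))"
          using iw by (simp add: integrable_restrict_space)
        show "integrable lebesgue (\<lambda>x. 2 * M * (A c1 e1 x + A c2 e2 x))"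
          using A iso by auto
        show "AE x in lebesgue. indicator {- R..c} x *\<^sub>R (max 0 (w x s) ^ 3) \<le> 2 * M * (A c1 e1 x + A c2 e2 x)"
          using ordered
        proof eventually_elim
          case (elim x)
          have A0: "0 \<le> 2 * M * (A c1 e1 x + A c2 e2 x)"
            using M_ge_1 by (simp add: A_def)
          show ?case
          proof (cases "x \<in> {- R..c} \<and> 0 < w x s")
            case True
            then have "\<phi> (c1 + e1 * x) \<le> \<phi> (c2 + e2 * x)" using elim by auto
            then have "w x s \<le> \<bar>u (c1 + e1 * x) s - \<phi> (c1 + e1 * x)\<bar> + \<bar>u (c2 + e2 * x) s - \<phi> (c2 + e2 * x)\<bar>" (is "_ \<le> \<bar>?p\<bar> + \<bar>?q\<bar>")
              unfolding w_def by linarith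
            then have "(w x s)\<^sup>2 \<le> (\<bar>?p\<bar> + \<bar>?q\<bar>)\<^sup>2"
              using True by (intro power_mono) auto
            also have "\<dots> \<le> 2 * (A c1 e1 x + A c2 e2 x)"
              unfolding A_def by (rule sq_sum)
            finally have "w x s * (w x s)\<^sup>2 \<le> M * (2 * (A c1 e1 x + A c2 e2 x))"
              using True M_ge_1 u_le[OF s, of "c1 + e1 * x"] u_nonneg[OF s, of "c2 + e2 * x"]
              by (intro mult_mono) (auto simp: w_def)
            then show ?thesis
              using True by (simp add: power3_eq_cube power2_eq_square algebra_simps)
          next
            case False
            then have "indicator {- R..c} x *\<^sub>R (max 0 (w x s) ^ 3) = 0"
              by (auto simp: indicator_def max_def)
            with A0 show ?thesis by (simp only:)
          qed
        qed
      qed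
      also have "\<dots> = 4 * M * I s"
        using A iso by (simp add: algebra_simps)
      finally show "integral {- R..c} (\<lambda>x. max 0 (w x s) ^ 3) \<le> 4 * M * I s" .
    qed
    show "((\<lambda>s. integral {- R..c} (\<lambda>x. max 0 (w x s) ^ 3)) \<longlongrightarrow> 0) (at_right 0)"
    proof (rule tendsto_sandwich)
      show "\<forall>\<^sub>F s in at_right 0. 0 \<le> integral {- R..c} (\<lambda>x. max 0 (w x s) ^ 3)"
        "\<forall>\<^sub>F s in at_right 0. integral {- R..c} (\<lambda>x. max 0 (w x s) ^ 3) \<le> 4 * M * I s"
        unfolding eventually_at_right_field using bound by (auto intro!: exI[of _ 1])
      show "((\<lambda>s. 4 * M * I s) \<longlongrightarrow> 0) (at_right 0)"
        using tendsto_mult_right_zero[OF lim, of "4 * M"] by (simp add: I_def)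
    qed simp
  qed (use x t K_nonneg in auto)
  then show ?thesis by (simp add: w_def)
qed

text \<open>Evenness comes from comparing \<open>u(-x,t)\<close> and \<open>u(x,t)\<close> on \<open>x \<le> 0\<close> in both directions; monotonicity from
  comparing \<open>u\<close> with its reflection in the midpoint of \<open>x\<close> and \<open>y\<close>.\<close>

lemma symmetric_decreasing:
  fixes \<phi> :: "real \<Rightarrow> real"
  assumes int: "\<And>s. 0 < s \<Longrightarrow> integrable lebesgue (\<lambda>x. (u x s - \<phi> x)\<^sup>2)"
    and lim: "((\<lambda>s. LINT x|lebesgue. (u x s - \<phi> x)\<^sup>2) \<longlongrightarrow> 0) (at_right 0)"
    and even: "\<And>x. \<phi> (- x) = \<phi> x" and anti: "antimono_on {0<..} \<phi>" and t: "0 < t"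
  shows "u (- x) t = u x t" "0 \<le> x \<Longrightarrow> x \<le> y \<Longrightarrow> u y t \<le> u x t"
proof -
  have "u (0 + (-1) * z) t \<le> u (0 + 1 * z) t" "u (0 + 1 * z) t \<le> u (0 + (-1) * z) t" if "z \<le> 0" for z
    by (rule isometric_comparison[OF int lim, where c = 0]; use t that even in auto)+
  then have "u (- z) t = u z t" if "z \<le> 0" for z
    using that by (simp add: order_antisym)
  from this[of x] this[of "- x"] show "u (- x) t = u x t"
    by (cases "x \<le> 0") auto
  show "u y t \<le> u x t" if "0 \<le> x" "x \<le> y"
  proof -
    define c where "c = (x + y) / 2"
    then have c: "2 * c = x + y" by simp
    \<comment> \<open>The origin is excluded because \<open>\<phi>\<close> is monotone only on \<open>(0,\<infinity>)\<close>.\<close>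
    have "AE z in lebesgue. z \<noteq> (0::real)"
      by (intro AE_completion AE_lborel_singleton)
    then have "AE z in lebesgue. z \<le> c \<longrightarrow> \<phi> (2 * c + (-1) * z) \<le> \<phi> (0 + 1 * z)"
    proof eventually_elim
      case (elim z)
      show ?case
      proof
        assume "z \<le> c"
        moreover have "0 \<le> c" using that by (simp add: c_def)
        ultimately have "0 < \<bar>z\<bar>" "\<bar>z\<bar> \<le> 2 * c - z"
          using elim by auto
        then have "\<phi> (2 * c - z) \<le> \<phi> \<bar>z\<bar>"
          using anti by (auto simp: monotone_on_def)
        also have "\<phi> \<bar>z\<bar> = \<phi> z"
          using even[of z] by (simp add: abs_if)
        finally show "\<phi> (2 * c + (-1) * z) \<le> \<phi> (0 + 1 * z)" by simp
      qed
    qed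
    then have "u (2 * c + (-1) * x) t \<le> u (0 + 1 * x) t"
      by (intro isometric_comparison[OF int lim, where c = c]) (use t that c in auto)
    then show ?thesis by (simp add: c)
  qed
qed

end

section \<open>Spreading\<close>

text \<open>The nonlinearity \<open>h\<close> agrees with \<open>g\<close> on \<open>[0,1]\<close> and is globally bounded, Lipschitz continuous and nonnegative, as the
  construction of stationary profiles requires.\<close>

locale monostable_solution = bounded_solution +
  fixes h H :: "real \<Rightarrow> real"
  assumes even: "\<And>x t. 0 < t \<Longrightarrow> u (- x) t = u x t"
    and decreasing: "\<And>x y t. 0 < t \<Longrightarrow> 0 \<le> x \<Longrightarrow> x \<le> y \<Longrightarrow> u y t \<le> u x t"
    and g_zeros: "g 0 = 0" "g 1 = 0"
    and g_pos: "\<And>s. 0 < s \<Longrightarrow> s < 1 \<Longrightarrow> 0 < g s"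
    and g_neg: "\<And>s. 1 < s \<Longrightarrow> g s < 0"
    and h_def: "h = (\<lambda>s. g (max 0 (min s 1)))"
    and H_deriv: "\<And>s. (H has_real_derivative h s) (at s)" and H_0: "H 0 = 0"
begin

lemma abs_bound: "0 < t \<Longrightarrow> \<bar>x\<bar> \<le> y \<Longrightarrow> u y t \<le> u x t"
  using decreasing[of t "\<bar>x\<bar>" y] even[of t x] by (auto simp: abs_if split: if_splits)

lemma max_at_centre: "0 < t \<Longrightarrow> u x t \<le> u 0 t"
  using decreasing[of t 0 x] decreasing[of t 0 "- x"] even[of t x] by (cases "0 \<le> x") auto

lemma centre_derivatives:
  assumes "0 < t"
  shows "ux 0 t = 0" "uxx 0 t \<le> 0"
proof -
  show "ux 0 t = 0"
    using DERIV_local_max[OF dx[OF assms, of 0], of 1] max_at_centre[OF assms] by auto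
  have "0 \<le> - uxx 0 t"
    using second_derivative_nonneg_at_minimum[of UNIV 0 "\<lambda>y. - u y t" "\<lambda>y. - ux y t" "- uxx 0 t"]
      DERIV_minus[OF dx[OF assms]] DERIV_minus[OF dxx[OF assms]] max_at_centre[OF assms] by auto
  then show "uxx 0 t \<le> 0" by simp
qed

lemma centre_growth: "0 < t \<Longrightarrow> ut 0 t \<le> g (u 0 t)"
  using centre_derivatives[of t] pde[of t 0] by simp

lemma g_nonneg: "0 \<le> s \<Longrightarrow> s \<le> 1 \<Longrightarrow> 0 \<le> g s"
  using g_pos[of s] g_zeros by (cases "s = 0 \<or> s = 1") (auto simp: less_eq_real_def)

lemma g_le_linear: "0 \<le> s \<Longrightarrow> s \<le> M \<Longrightarrow> g s \<le> K * s"
  using lip[of s 0] g_zeros M_ge_1 by auto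

lemma h_lipschitz: "\<bar>h x - h y\<bar> \<le> K * \<bar>x - y\<bar>"
proof -
  have "\<bar>h x - h y\<bar> \<le> K * \<bar>max 0 (min x 1) - max 0 (min y 1)\<bar>"
    unfolding h_def using M_ge_1 by (intro lip) auto
  also have "\<dots> \<le> K * \<bar>x - y\<bar>"
    using K_nonneg by (intro mult_left_mono) auto
  finally show ?thesis .
qed

lemma h_nonneg: "0 \<le> h s"
  unfolding h_def by (rule g_nonneg) auto

lemma h_bounded: "\<bar>h s\<bar> \<le> K"
proof -
  have "h s \<le> K * max 0 (min s 1)"
    unfolding h_def using M_ge_1 by (intro g_le_linear) auto
  also have "\<dots> \<le> K * 1"
    using K_nonneg by (intro mult_left_mono) auto
  finally show ?thesis using h_nonneg[of s] by simp
qed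

text \<open>The compactly supported profile below the plateau is a stationary subsolution; the solution stays above
  it because it is nonnegative at the endpoints of the support.\<close>

lemma plateau_persists:
  assumes \<delta>: "0 < \<delta>" "\<delta> \<le> 1" and x: "0 < x" "4 * \<delta>\<^sup>2 \<le> H \<delta> * x\<^sup>2" and t0: "0 < t0" "\<delta> \<le> u x t0"
  obtains a where "0 < a" "a \<le> 1" "\<And>t. t0 \<le> t \<Longrightarrow> a \<le> u 0 t"
proof -
  obtain a v v' l r where a: "0 < a" "a \<le> \<delta>" "v 0 = a" and lr: "- x \<le> l" "l < 0" "0 < r" "r \<le> x"
    "v l = 0" "v r = 0" and v: "\<And>y. l \<le> y \<Longrightarrow> y \<le> r \<Longrightarrow> 0 \<le> v y \<and> v y \<le> a"
    and dv: "\<And>y. (v has_real_derivative v' y) (at y)" "\<And>y. (v' has_real_derivative - h (v y)) (at y)"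
    using compact_stationary_profile[OF h_lipschitz h_bounded h_nonneg H_deriv H_0 \<delta>(1) x] by metis
  have cv: "continuous_on S v" for S
    using dv(1) by (meson DERIV_continuous_on DERIV_subset subset_UNIV)
  have "a \<le> u 0 t" if t: "t0 \<le> t" for t
  proof -
    have "0 \<le> u 0 t - v 0"
    proof (rule parabolic_minimum_principle[where w = "\<lambda>x t. u x t - v x" and wx = "\<lambda>x t. ux x t - v' x"
          and wxx = "\<lambda>x t. uxx x t + h (v x)" and wt = ut and a = l and b = r and ?t0.0 = t0 and ?t1.0 = t and L = K])
      show "continuous_on ({l..r} \<times> {t0..t}) (\<lambda>(x, t). u x t - v x)"
        unfolding split_beta' using t0
        by (intro continuous_on_diff continuous_along continuous_on_compose2[OF cv[of UNIV]] continuous_on_fst continuous_on_snd continuous_on_id) auto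
      fix y s assume ys: "l < y" "y < r" "t0 < s" "s \<le> t"
      then have s: "0 < s" using t0 by simp
      show "((\<lambda>y. u y s - v y) has_real_derivative ux y s - v' y) (at y)"
        using dx[OF s] dv by (auto intro!: derivative_eq_intros)
      show "((\<lambda>y. ux y s - v' y) has_real_derivative uxx y s + h (v y)) (at y)"
        using dxx[OF s] dv by (auto intro!: derivative_eq_intros)
      show "((\<lambda>s. u y s - v y) has_real_derivative ut y s) (at s)"
        using dt[OF s] by (auto intro!: derivative_eq_intros)
      show "uxx y s + h (v y) + K * (u y s - v y) \<le> ut y s" if "u y s - v y < 0"
      proof -
        have "u y s < 1" using that v[of y] ys a \<delta> by auto
        then have "g (u y s) = h (u y s)"
          using u_nonneg[OF s, of y] by (simp add: h_def)
        moreover have "h (v y) - h (u y s) \<le> K * (v y - u y s)"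
          using h_lipschitz[of "v y" "u y s"] that by auto
        ultimately show ?thesis
          by (simp add: pde[OF s] algebra_simps)
      qed
    next
      fix y assume y: "l \<le> y" "y \<le> r"
      then have "\<bar>y\<bar> \<le> x" using lr by linarith
      then show "0 \<le> u y t0 - v y"
        using v[OF y] a abs_bound[of t0 y x] t0 by linarith
    qed (use lr t t0 u_nonneg in auto)
    then show ?thesis using a by simp
  qed
  then show ?thesis using that[of a] a \<delta> by auto
qed

text \<open>The function \<open>q - 2 exp (- \<mu>\<^sup>2 (t - T)) cos (\<mu> (x - m))\<close>, where \<open>q\<close> is the parabola and \<open>m\<close> the midpoint of
  \<open>[l,r]\<close>, is a subsolution. The frequency \<open>\<mu>\<close> is such that the cosine lies between \<open>1/2\<close> and \<open>1\<close> on \<open>[l,r]\<close>: the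
  subtracted term is at least \<open>1\<close> at time \<open>T\<close>, so that the subsolution starts below \<open>0\<close>, and it
  decays exponentially. Touching can only happen below \<open>q\<close>, where the reaction outweighs the curvature \<open>k\<close>.\<close>

lemma relaxation_to_parabola:
  assumes lr: "l < r" and T: "0 < T" and \<epsilon>: "0 < \<epsilon>"
    and q: "\<And>x. l \<le> x \<Longrightarrow> x \<le> r \<Longrightarrow> A + B * x - k / 2 * x\<^sup>2 \<le> 1"
    and left: "\<And>t. T \<le> t \<Longrightarrow> A + B * l - k / 2 * l\<^sup>2 \<le> u l t"
    and right: "\<And>t. T \<le> t \<Longrightarrow> A + B * r - k / 2 * r\<^sup>2 \<le> u r t"
    and source: "\<And>x t. T \<le> t \<Longrightarrow> l < x \<Longrightarrow> x < r \<Longrightarrow> u x t < A + B * x - k / 2 * x\<^sup>2 \<Longrightarrow> k \<le> g (u x t)"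
  obtains T' where "T \<le> T'" "\<And>t x. T' \<le> t \<Longrightarrow> l \<le> x \<Longrightarrow> x \<le> r \<Longrightarrow> A + B * x - k / 2 * x\<^sup>2 - \<epsilon> \<le> u x t"
proof -
  define m where "m = (l + r) / 2"
  define \<mu> where "\<mu> = 2 * pi / (3 * (r - l))"
  have \<mu>: "0 < \<mu>" using lr by (simp add: \<mu>_def)
  have cos_ge: "1 / 2 \<le> cos (\<mu> * (x - m))" if "l \<le> x" "x \<le> r" for x
  proof -
    have "\<bar>x - m\<bar> \<le> (r - l) / 2"
      using that by (auto simp: m_def abs_le_iff field_simps)
    then have "\<bar>\<mu> * (x - m)\<bar> \<le> \<mu> * ((r - l) / 2)"
      using \<mu> by (simp add: abs_mult)
    also have "\<dots> = pi / 3"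
    proof -
      obtain d where "r = l + d" "0 < d" using lr by (metis add.commute diff_add_cancel diff_gt_0_iff_gt)
      then show ?thesis by (simp add: \<mu>_def)
    qed
    finally have "cos (pi / 3) \<le> cos \<bar>\<mu> * (x - m)\<bar>"
      using pi_gt_zero by (intro cos_monotone_0_pi_le) auto
    then show ?thesis by (simp add: cos_60)
  qed
  define b where "b x t = 2 * exp (- \<mu>\<^sup>2 * (t - T)) * cos (\<mu> * (x - m))" for x t
  have b_nonneg: "0 \<le> b x t" if "l \<le> x" "x \<le> r" for x t
    unfolding b_def using cos_ge[OF that] by (intro mult_nonneg_nonneg) auto
  have above: "0 \<le> u x t - (A + B * x - k / 2 * x\<^sup>2) + b x t" if x: "l \<le> x" "x \<le> r" and t: "T \<le> t" for x t
  proof (rule parabolic_minimum_principle[where w = "\<lambda>x t. u x t - (A + B * x - k / 2 * x\<^sup>2) + b x t"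
        and wx = "\<lambda>x t. ux x t - (B - k * x) - 2 * exp (- \<mu>\<^sup>2 * (t - T)) * \<mu> * sin (\<mu> * (x - m))"
        and wxx = "\<lambda>x t. uxx x t + k - \<mu>\<^sup>2 * b x t" and wt = "\<lambda>x t. ut x t - \<mu>\<^sup>2 * b x t"
        and a = l and b = r and ?t0.0 = T and ?t1.0 = t and L = 0])
    show "continuous_on ({l..r} \<times> {T..t}) (\<lambda>(x, t). u x t - (A + B * x - k / 2 * x\<^sup>2) + b x t)"
      unfolding split_beta' b_def using T
      by (intro continuous_on_diff continuous_on_add continuous_along continuous_on_mult continuous_on_exp continuous_on_cos
          continuous_on_power continuous_on_const continuous_on_fst continuous_on_snd continuous_on_id) auto
    fix y s assume ys: "l < y" "y < r" "T < s" "s \<le> t"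
    then have s: "0 < s" using T by simp
    show "((\<lambda>x. u x s - (A + B * x - k / 2 * x\<^sup>2) + b x s) has_real_derivative
        ux y s - (B - k * y) - 2 * exp (- \<mu>\<^sup>2 * (s - T)) * \<mu> * sin (\<mu> * (y - m))) (at y)"
      unfolding b_def using dx[OF s] by (auto intro!: derivative_eq_intros)
    show "((\<lambda>x. ux x s - (B - k * x) - 2 * exp (- \<mu>\<^sup>2 * (s - T)) * \<mu> * sin (\<mu> * (x - m))) has_real_derivative
        uxx y s + k - \<mu>\<^sup>2 * b y s) (at y)"
      unfolding b_def using dxx[OF s] by (auto intro!: derivative_eq_intros simp: power2_eq_square)
    show "((\<lambda>s. u y s - (A + B * y - k / 2 * y\<^sup>2) + b y s) has_real_derivative ut y s - \<mu>\<^sup>2 * b y s) (at s)"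
      unfolding b_def using dt[OF s] by (auto intro!: derivative_eq_intros)
    assume "u y s - (A + B * y - k / 2 * y\<^sup>2) + b y s < 0"
    then have "u y s < A + B * y - k / 2 * y\<^sup>2"
      using b_nonneg[of y s] ys by simp
    then have "k \<le> g (u y s)"
      using source ys by simp
    then show "uxx y s + k - \<mu>\<^sup>2 * b y s + 0 * (u y s - (A + B * y - k / 2 * y\<^sup>2) + b y s) \<le> ut y s - \<mu>\<^sup>2 * b y s"
      by (simp add: pde[OF s])
  next
    fix y assume y: "l \<le> y" "y \<le> r"
    show "0 \<le> u y T - (A + B * y - k / 2 * y\<^sup>2) + b y T"
      using q[OF y] u_nonneg[OF T, of y] cos_ge[OF y] by (simp add: b_def)
  next
    fix s assume "T \<le> s"
    then show "0 \<le> u l s - (A + B * l - k / 2 * l\<^sup>2) + b l s" "0 \<le> u r s - (A + B * r - k / 2 * r\<^sup>2) + b r s"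
      using left right b_nonneg[of l s] b_nonneg[of r s] lr by auto
  qed (use x t in auto)
  define T' where "T' = T + \<bar>ln (2 / \<epsilon>)\<bar> / \<mu>\<^sup>2"
  show ?thesis
  proof (rule that[of T'])
    show "T \<le> T'" by (simp add: T'_def)
    fix t x assume t: "T' \<le> t" and x: "l \<le> x" "x \<le> r"
    have "\<bar>ln (2 / \<epsilon>)\<bar> / \<mu>\<^sup>2 \<le> t - T"
      using t by (simp add: T'_def)
    then have "ln (2 / \<epsilon>) \<le> \<mu>\<^sup>2 * (t - T)"
      using \<mu> by (simp add: divide_le_eq mult.commute)
    then have "exp (- \<mu>\<^sup>2 * (t - T)) \<le> exp (- ln (2 / \<epsilon>))"
      by simp
    also have "\<dots> = \<epsilon> / 2"
      using \<epsilon> by (simp add: exp_minus)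
    finally have e: "2 * exp (- \<mu>\<^sup>2 * (t - T)) \<le> \<epsilon>" by simp
    have "b x t \<le> 2 * exp (- \<mu>\<^sup>2 * (t - T)) * 1"
      unfolding b_def by (intro mult_left_mono) auto
    with e have "b x t \<le> \<epsilon>" by simp
    moreover have "T \<le> t"
      using t \<open>T \<le> T'\<close> by simp
    ultimately show "A + B * x - k / 2 * x\<^sup>2 - \<epsilon> \<le> u x t"
      using above[OF x] by force
  qed
qed

text \<open>The relaxation lemma is used twice: with the line from \<open>(0, a)\<close> to \<open>(4 X, 0)\<close>, where \<open>g \<ge> 0\<close> suffices, to
  get \<open>u \<ge> a/2\<close> on \<open>[-X,X]\<close>; and then with the parabola that equals \<open>a/2\<close> at \<open>\<plusminus>X\<close> and \<open>1 - \<epsilon>\<close> at the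
  centre. For large \<open>X\<close> its curvature is smaller than the minimum of \<open>g\<close> on \<open>[a/2, 1 - \<epsilon>]\<close>, and it is almost
  constant on \<open>[-Y,Y]\<close>.\<close>

lemma spreads_if_centre_bounded_below:
  assumes a: "0 < a" "a \<le> 1" and t0: "0 < t0" "\<And>t. t0 \<le> t \<Longrightarrow> a \<le> u 0 t" and Y: "0 < Y" and \<epsilon>: "0 < \<epsilon>" "\<epsilon> \<le> 1 / 2"
  obtains T where "\<And>t x. T \<le> t \<Longrightarrow> \<bar>x\<bar> \<le> Y \<Longrightarrow> 1 - 2 * \<epsilon> - \<epsilon> \<le> u x t"
proof -
  obtain c where c: "0 < c" "\<And>s. a / 2 \<le> s \<Longrightarrow> s \<le> 1 - \<epsilon> \<Longrightarrow> c \<le> g s"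
  proof -
    have "continuous_on {a / 2..1 - \<epsilon>} g"
      using cont_g continuous_on_subset by blast
    then obtain s where s: "s \<in> {a / 2..1 - \<epsilon>}" "\<And>r. r \<in> {a / 2..1 - \<epsilon>} \<Longrightarrow> g s \<le> g r"
      using continuous_attains_inf[of "{a / 2..1 - \<epsilon>}" g] a \<epsilon> by auto
    show ?thesis
      by (rule that[of "g s"]) (use s g_pos[of s] a \<epsilon> in auto)
  qed
  \<comment> \<open>Since \<open>X \<ge> 1\<close>, also \<open>X\<^sup>2\<close> is at least \<open>2 / c\<close> and \<open>Y\<^sup>2 / \<epsilon>\<close>, which makes the parabola flat enough.\<close>
  define X where "X = Y + 1 + 2 / c + Y\<^sup>2 / \<epsilon>"
  have X: "1 \<le> X" "Y \<le> X" "2 / c \<le> X" "Y\<^sup>2 / \<epsilon> \<le> X"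
    using Y c \<epsilon> by (auto simp: X_def)
  have "X * 1 \<le> X * X"
    using X by (intro mult_left_mono) auto
  then have X2: "X \<le> X\<^sup>2" by (simp add: power2_eq_square)
  obtain T1 where T1: "t0 \<le> T1" "\<And>t x. T1 \<le> t \<Longrightarrow> 0 \<le> x \<Longrightarrow> x \<le> 4 * X \<Longrightarrow> a + - (a / (4 * X)) * x - 0 / 2 * x\<^sup>2 - a / 4 \<le> u x t"
  proof (rule relaxation_to_parabola[of 0 "4 * X" t0 "a / 4" a "- (a / (4 * X))" 0])
    fix x :: real assume x: "0 \<le> x" "x \<le> 4 * X"
    have "0 \<le> a / (4 * X) * x"
      using x X a by simp
    then show "a + - (a / (4 * X)) * x - 0 / 2 * x\<^sup>2 \<le> 1" using a by simp
  next
    fix x t assume t: "t0 \<le> t" and x: "0 < x" "x < 4 * X" and less: "u x t < a + - (a / (4 * X)) * x - 0 / 2 * x\<^sup>2"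
    have "0 \<le> a / (4 * X) * x"
      using x X a by simp
    then have "u x t \<le> 1" using less a by simp
    then show "0 \<le> g (u x t)"
      using u_nonneg[of t x] t t0 by (intro g_nonneg) auto
  next
    fix t assume "t0 \<le> t"
    then show "a + - (a / (4 * X)) * (4 * X) - 0 / 2 * (4 * X)\<^sup>2 \<le> u (4 * X) t"
      using u_nonneg[of t] t0 X by simp
  qed (use X a t0 in auto)
  have half: "a / 2 \<le> u x t" if "T1 \<le> t" "\<bar>x\<bar> \<le> X" for x t
  proof -
    have "a / 2 \<le> u X t"
      using T1(2)[of t X] X that(1) by (simp add: field_simps)
    also have "\<dots> \<le> u x t"
      using that T1 t0 by (intro abs_bound) auto
    finally show ?thesis .
  qed
  define k where "k = 2 * (1 - \<epsilon> - a / 2) / X\<^sup>2"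
  have k0: "0 \<le> k" using a \<epsilon> by (simp add: k_def)
  have k2: "k \<le> 2 / X\<^sup>2"
    unfolding k_def using a \<epsilon> by (intro divide_right_mono) auto
  have "2 / X\<^sup>2 \<le> c"
  proof -
    have "2 \<le> X * c" using X(3) c by (simp add: divide_le_eq)
    also have "\<dots> \<le> X\<^sup>2 * c" using X2 c by (intro mult_right_mono) auto
    finally show ?thesis using X by (simp add: divide_le_eq mult.commute)
  qed
  with k2 have kc: "k \<le> c" by simp
  have kX: "k / 2 * X\<^sup>2 = 1 - \<epsilon> - a / 2"
    using X by (simp add: k_def)
  have "0 < T1" using T1 t0 by simp
  obtain T where T: "T1 \<le> T" "\<And>t x. T \<le> t \<Longrightarrow> - X \<le> x \<Longrightarrow> x \<le> X \<Longrightarrow> (1 - \<epsilon>) + 0 * x - k / 2 * x\<^sup>2 - \<epsilon> \<le> u x t"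
  proof (rule relaxation_to_parabola[of "- X" X T1 \<epsilon> "1 - \<epsilon>" 0 k])
    fix x :: real
    have "0 \<le> k / 2 * x\<^sup>2" using k0 by simp
    then show "1 - \<epsilon> + 0 * x - k / 2 * x\<^sup>2 \<le> 1" using \<epsilon> by simp
    fix t assume t: "T1 \<le> t" and x: "- X < x" "x < X" and less: "u x t < 1 - \<epsilon> + 0 * x - k / 2 * x\<^sup>2"
    have "c \<le> g (u x t)"
      using less \<open>0 \<le> k / 2 * x\<^sup>2\<close> half[of t x] t x by (intro c) auto
    then show "k \<le> g (u x t)" using kc by simp
  next
    fix t assume "T1 \<le> t"
    then show "1 - \<epsilon> + 0 * X - k / 2 * X\<^sup>2 \<le> u X t" "1 - \<epsilon> + 0 * (- X) - k / 2 * (- X)\<^sup>2 \<le> u (- X) t"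
    proof -
      have "a / 2 \<le> u X t" "a / 2 \<le> u (- X) t"
        using half[of t X] half[of t "- X"] X \<open>T1 \<le> t\<close> by auto
      then show "1 - \<epsilon> + 0 * X - k / 2 * X\<^sup>2 \<le> u X t" "1 - \<epsilon> + 0 * (- X) - k / 2 * (- X)\<^sup>2 \<le> u (- X) t"
        unfolding power2_minus kX by linarith+
    qed
  qed (use X \<epsilon> \<open>0 < T1\<close> in auto)
  show ?thesis
  proof (rule that[of T])
    fix t x assume t: "T \<le> t" and x: "\<bar>x\<bar> \<le> Y"
    have "x\<^sup>2 \<le> Y\<^sup>2"
      using x Y by (metis abs_le_square_iff abs_of_pos)
    then have "k / 2 * x\<^sup>2 \<le> k / 2 * Y\<^sup>2"
      using k0 by (intro mult_left_mono) auto
    also have "\<dots> \<le> (2 / X\<^sup>2) / 2 * Y\<^sup>2"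
      using k2 by (intro mult_right_mono divide_right_mono) auto
    also have "\<dots> = Y\<^sup>2 / X\<^sup>2" by simp
    also have "\<dots> \<le> \<epsilon>"
    proof -
      have "Y\<^sup>2 \<le> X * \<epsilon>" using X(4) \<epsilon> by (simp add: divide_le_eq)
      also have "\<dots> \<le> X\<^sup>2 * \<epsilon>" using X2 \<epsilon> by (intro mult_right_mono) auto
      finally show ?thesis using X by (simp add: divide_le_eq mult.commute)
    qed
    finally have small: "k / 2 * x\<^sup>2 \<le> \<epsilon>" .
    have "- X \<le> x" "x \<le> X" using x X(2) by linarith+
    from T(2)[OF t this] small show "1 - 2 * \<epsilon> - \<epsilon> \<le> u x t"
      by linarith
  qed
qed

text \<open>The centre value grows at most exponentially, so it cannot have been much smaller shortly before. This
  allows moving from a time where \<open>u(0,t)\<close> is large to a nearby quiet time.\<close>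

lemma centre_decay_bound:
  assumes "0 < s" "s \<le> t" "t \<le> s + 1"
  shows "exp (- K) * u 0 t \<le> u 0 s"
proof -
  have "exp (- K * t) * u 0 t \<le> exp (- K * s) * u 0 s"
  proof (rule DERIV_nonpos_imp_nonincreasing[OF assms(2)])
    fix r assume "s \<le> r" "r \<le> t"
    then have r: "0 < r" using assms by simp
    have "((\<lambda>t. exp (- K * t) * u 0 t) has_real_derivative exp (- K * r) * (ut 0 r - K * u 0 r)) (at r)"
      using dt[OF r, of 0] by (auto intro!: derivative_eq_intros simp: algebra_simps)
    moreover have "ut 0 r - K * u 0 r \<le> 0"
      using centre_growth[OF r] g_le_linear[OF u_nonneg[OF r] u_le[OF r], of 0] by simp
    then have "exp (- K * r) * (ut 0 r - K * u 0 r) \<le> 0"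
      by (simp add: mult_nonneg_nonpos)
    ultimately show "\<exists>y. ((\<lambda>t. exp (- K * t) * u 0 t) has_real_derivative y) (at r) \<and> y \<le> 0"
      by blast
  qed
  then have "exp (K * s) * (exp (- K * t) * u 0 t) \<le> exp (K * s) * (exp (- K * s) * u 0 s)"
    by (intro mult_left_mono) auto
  then have "exp (K * s - K * t) * u 0 t \<le> u 0 s"
    by (simp flip: mult.assoc exp_add)
  moreover have "exp (- K) \<le> exp (K * s - K * t)"
    using mult_left_mono[OF assms(3) K_nonneg] by (simp add: algebra_simps)
  then have "exp (- K) * u 0 t \<le> exp (K * s - K * t) * u 0 t"
    using u_nonneg[of t 0] assms by (intro mult_right_mono) auto
  ultimately show ?thesis by simp
qed

lemma eventually_le:
  assumes \<epsilon>: "0 < \<epsilon>"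
  obtains T where "0 < T" "\<And>t x. T \<le> t \<Longrightarrow> u x t \<le> 1 + \<epsilon>"
proof -
  have "\<exists>t\<ge>1. u 0 t \<le> 1 + \<epsilon>"
  proof (rule ccontr)
    assume "\<not> ?thesis"
    then have big: "1 + \<epsilon> < u 0 t" if "1 \<le> t" for t using that by force
    have ne: "1 + \<epsilon> \<le> M" using big[of 1] u_le[of 1 0] by simp
    have "continuous_on {1 + \<epsilon>..M} g"
      using cont_g continuous_on_subset by blast
    then obtain s where s: "s \<in> {1 + \<epsilon>..M}" "\<And>r. r \<in> {1 + \<epsilon>..M} \<Longrightarrow> g r \<le> g s"
      using continuous_attains_sup[of "{1 + \<epsilon>..M}" g] ne by auto
    have gs: "g s < 0" using s \<epsilon> by (intro g_neg) auto
    \<comment> \<open>By this time \<open>u(0,t)\<close>, decreasing at least at the rate \<open>- g s\<close>, would have lost \<open>M\<close>.\<close>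
    define t where "t = 1 + M / (- g s)"
    have t: "1 \<le> t" using divide_nonneg_pos[of M "- g s"] gs M_ge_1 unfolding t_def by linarith
    have "u 0 t - g s * t \<le> u 0 1 - g s * 1"
    proof (rule DERIV_nonpos_imp_nonincreasing[OF t])
      fix r assume r: "1 \<le> r" "r \<le> t"
      have "((\<lambda>t. u 0 t - g s * t) has_real_derivative ut 0 r - g s) (at r)"
        using dt[of r 0] r by (auto intro!: derivative_eq_intros)
      moreover have "g (u 0 r) \<le> g s"
        using big[OF r(1)] u_le[of r 0] r by (intro s) auto
      then have "ut 0 r - g s \<le> 0"
        using centre_growth[of r] r by simp
      ultimately show "\<exists>y. ((\<lambda>t. u 0 t - g s * t) has_real_derivative y) (at r) \<and> y \<le> 0" by blast
    qed
    moreover have "g s * t = g s - M"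
      using gs by (simp add: t_def field_simps)
    ultimately have "u 0 t \<le> u 0 1 - M" by simp
    then show False
      using big[OF t] u_le[of 1 0] \<epsilon> by simp
  qed
  then obtain T where T: "1 \<le> T" "u 0 T \<le> 1 + \<epsilon>" by auto
  show ?thesis
  proof (rule that[of T])
    fix t x assume t: "T \<le> t"
    have "max 0 (u 0 t - (1 + \<epsilon>)) ^ Suc (Suc 0) \<le> max 0 (u 0 T - (1 + \<epsilon>)) ^ Suc (Suc 0)"
    proof (rule DERIV_nonpos_imp_nonincreasing[OF t])
      fix r assume r: "T \<le> r" "r \<le> t"
      then have r0: "0 < r" using T by simp
      have "((\<lambda>t. max 0 (u 0 t - (1 + \<epsilon>)) ^ Suc (Suc 0)) has_real_derivative
          real (Suc (Suc 0)) * max 0 (u 0 r - (1 + \<epsilon>)) ^ Suc 0 * (ut 0 r - 0)) (at r)"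
        by (intro DERIV_chain2[OF has_real_derivative_max_zero_power] DERIV_diff dt DERIV_const r0)
      moreover have "real (Suc (Suc 0)) * max 0 (u 0 r - (1 + \<epsilon>)) ^ Suc 0 * (ut 0 r - 0) \<le> 0"
      proof (cases "1 + \<epsilon> \<le> u 0 r")
        case True
        then have "ut 0 r \<le> 0"
          using centre_growth[OF r0] g_neg[of "u 0 r"] \<epsilon> by simp
        then show ?thesis by (intro mult_nonneg_nonpos) auto
      qed simp
      ultimately show "\<exists>y. ((\<lambda>t. max 0 (u 0 t - (1 + \<epsilon>)) ^ Suc (Suc 0)) has_real_derivative y) (at r) \<and> y \<le> 0"
        by blast
    qed
    moreover have "max 0 (u 0 T - (1 + \<epsilon>)) = 0"
      using T by simp
    ultimately have "max 0 (u 0 t - (1 + \<epsilon>)) ^ Suc (Suc 0) \<le> 0"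
      by (simp only: power_0_Suc)
    moreover have "0 < max 0 (u 0 t - (1 + \<epsilon>)) ^ Suc (Suc 0)" if "1 + \<epsilon> < u 0 t"
      using that by (intro zero_less_power) simp
    ultimately have "u 0 t \<le> 1 + \<epsilon>" by linarith
    then show "u x t \<le> 1 + \<epsilon>"
      using max_at_centre[of t x] T t by simp
  qed (use T in auto)
qed

end

section \<open>Mass and energy with a cutoff\<close>

context smooth_evolution
begin

text \<open>The mixed derivative \<open>w\<^sub>x\<^sub>t\<close> need not exist, so the integral cannot be differentiated under the integral
  sign. Instead the difference of the two squares is integrated by parts first, which leaves
  \<open>w(x,s) - w(x,t) = (s - t) Q(x,s)\<close> with the continuous mean \<open>Q\<close> of \<open>w\<^sub>t\<close>; the difference quotient is then
  a continuous function of \<open>s\<close>.\<close>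

lemma weighted_gradient_derivative:
  fixes \<eta> \<eta>' :: "real \<Rightarrow> real"
  assumes \<eta>: "\<And>x. (\<eta> has_real_derivative \<eta>' x) (at x)" "continuous_on UNIV \<eta>'"
    and ab: "a \<le> b" "\<eta> a = 0" "\<eta> b = 0" and t: "0 < t"
  shows "((\<lambda>t. integral {a..b} (\<lambda>x. \<eta> x * ((wx x t)\<^sup>2 / 2))) has_real_derivative
           - integral {a..b} (\<lambda>x. (\<eta>' x * wx x t + \<eta> x * wxx x t) * wt x t)) (at t)"
proof -
  have c\<eta>: "continuous_on UNIV \<eta>"
    using \<eta>(1) by (auto intro: DERIV_continuous_on)
  note ci = continuous_on_mult continuous_on_add continuous_on_diff continuous_along continuous_on_id continuous_on_const
    continuous_on_divide continuous_on_power continuous_on_fst continuous_on_snd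
    continuous_on_compose2[OF c\<eta>] continuous_on_compose2[OF \<eta>(2)]
  define Q where "Q x s = integral {0..1} (\<lambda>\<theta>. wt x (t + \<theta> * (s - t)))" for x s
  define A where "A x s = (\<eta>' x * (wx x s + wx x t) + \<eta> x * (wxx x s + wxx x t)) / 2" for x s
  define N where "N s = integral {a..b} (\<lambda>x. A x s * Q x s)" for s
  have between: "0 < t + \<theta> * (s - t)" if "0 < s" "0 \<le> \<theta>" "\<theta> \<le> 1" for s \<theta>
  proof -
    have "t + \<theta> * (s - t) = (1 - \<theta>) * t + \<theta> * s" by (simp add: algebra_simps)
    moreover have "0 \<le> (1 - \<theta>) * t" "0 \<le> \<theta> * s" "0 < (1 - \<theta>) * t \<or> 0 < \<theta> * s"
      using that t by (auto simp: zero_less_mult_iff)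
    ultimately show ?thesis by linarith
  qed
  have Q: "w x s - w x t = (s - t) * Q x s" if s: "0 < s" for x s
  proof -
    have "((\<lambda>\<theta>. (s - t) * wt x (t + \<theta> * (s - t))) has_integral w x (t + 1 * (s - t)) - w x (t + 0 * (s - t))) {0..1}"
    proof (rule fundamental_theorem_of_calculus)
      fix \<theta> :: real assume "\<theta> \<in> {0..1}"
      then have "0 < t + \<theta> * (s - t)" using between[OF s] by auto
      moreover have "((\<lambda>\<theta>. t + \<theta> * (s - t)) has_real_derivative s - t) (at \<theta>)"
        by (auto intro!: derivative_eq_intros)
      ultimately have "((\<lambda>\<theta>. w x (t + \<theta> * (s - t))) has_real_derivative (s - t) * wt x (t + \<theta> * (s - t))) (at \<theta>)"
        using DERIV_chain2[of "w x" "wt x (t + \<theta> * (s - t))" "\<lambda>\<theta>. t + \<theta> * (s - t)" \<theta> "s - t" UNIV] dt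
        by (simp add: mult.commute)
      then show "((\<lambda>\<theta>. w x (t + \<theta> * (s - t))) has_vector_derivative (s - t) * wt x (t + \<theta> * (s - t))) (at \<theta> within {0..1})"
        by (simp add: has_real_derivative_iff_has_vector_derivative has_vector_derivative_at_within)
    qed simp
    then have "integral {0..1} (\<lambda>\<theta>. (s - t) * wt x (t + \<theta> * (s - t))) = w x s - w x t"
      by (auto dest: integral_unique)
    then show ?thesis by (simp add: Q_def)
  qed
  have Q_t: "Q x t = wt x t" for x by (simp add: Q_def)
  have contQ: "continuous_on ({0<..} \<times> {a..b}) (\<lambda>p. Q (snd p) (fst p))"
    unfolding Q_def box_real(2)[symmetric]
    by (rule integral_continuous_on_param) (auto simp: split_beta' intro!: ci between)
  have "continuous_on ({0<..} \<times> cbox a b) (\<lambda>(s, x). A x s * Q x s)"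
    unfolding split_beta' box_real(2) A_def using contQ t by (intro ci) auto
  then have "continuous_on {0<..} N"
    unfolding N_def box_real(2)[symmetric] by (rule integral_continuous_on_param)
  then have "isCont N t"
    using t continuous_on_eq_continuous_at[of "{0<..}" N] by auto
  define \<Phi> where "\<Phi> s = integral {a..b} (\<lambda>x. \<eta> x * ((wx x s)\<^sup>2 / 2))" for s
  have \<Phi>: "\<Phi> s - \<Phi> t = - N s * (s - t)" if s: "0 < s" for s
  proof -
    have I: "(\<lambda>x. \<eta> x * ((wx x s)\<^sup>2 / 2)) integrable_on {a..b}" "(\<lambda>x. \<eta> x * ((wx x t)\<^sup>2 / 2)) integrable_on {a..b}"
      using s t by (intro integrable_continuous_real ci; simp)+
    have IA: "(\<lambda>x. A x s * (w x s - w x t)) integrable_on {a..b}"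
      unfolding A_def using s t by (intro integrable_continuous_real ci; simp)
    have "((\<lambda>x. (\<eta> x * ((wx x s)\<^sup>2 / 2) - \<eta> x * ((wx x t)\<^sup>2 / 2)) + A x s * (w x s - w x t)) has_integral
       \<eta> b * (wx b s + wx b t) * (w b s - w b t) / 2 - \<eta> a * (wx a s + wx a t) * (w a s - w a t) / 2) {a..b}"
    proof (rule fundamental_theorem_of_calculus[OF ab(1)])
      fix x
      have "((\<lambda>x. \<eta> x * (wx x s + wx x t) * (w x s - w x t) / 2) has_real_derivative
          ((\<eta>' x * (wx x s + wx x t) + (wxx x s + wxx x t) * \<eta> x) * (w x s - w x t)
            + (wx x s - wx x t) * (\<eta> x * (wx x s + wx x t))) / 2) (at x)"
        by (intro DERIV_cdivide DERIV_mult DERIV_add DERIV_diff \<eta> dx dxx s t)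
      also have "((\<eta>' x * (wx x s + wx x t) + (wxx x s + wxx x t) * \<eta> x) * (w x s - w x t)
            + (wx x s - wx x t) * (\<eta> x * (wx x s + wx x t))) / 2 =
          (\<eta> x * ((wx x s)\<^sup>2 / 2) - \<eta> x * ((wx x t)\<^sup>2 / 2)) + A x s * (w x s - w x t)"
        unfolding A_def by (simp add: diff_divide_distrib add_divide_distrib power2_eq_square algebra_simps)
      finally have "((\<lambda>x. \<eta> x * (wx x s + wx x t) * (w x s - w x t) / 2) has_real_derivative
          (\<eta> x * ((wx x s)\<^sup>2 / 2) - \<eta> x * ((wx x t)\<^sup>2 / 2)) + A x s * (w x s - w x t)) (at x)" .
      then show "((\<lambda>x. \<eta> x * (wx x s + wx x t) * (w x s - w x t) / 2) has_vector_derivative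
          (\<eta> x * ((wx x s)\<^sup>2 / 2) - \<eta> x * ((wx x t)\<^sup>2 / 2)) + A x s * (w x s - w x t)) (at x within {a..b})"
        by (simp add: has_real_derivative_iff_has_vector_derivative has_vector_derivative_at_within)
    qed
    then have "integral {a..b} (\<lambda>x. (\<eta> x * ((wx x s)\<^sup>2 / 2) - \<eta> x * ((wx x t)\<^sup>2 / 2)) + A x s * (w x s - w x t)) = 0"
      using ab by (auto dest: integral_unique)
    then have "\<Phi> s - \<Phi> t + integral {a..b} (\<lambda>x. A x s * (w x s - w x t)) = 0"
      unfolding \<Phi>_def using I IA by (simp add: integral_add integral_diff integrable_diff)
    moreover have "integral {a..b} (\<lambda>x. A x s * (w x s - w x t)) = integral {a..b} (\<lambda>x. (s - t) * (A x s * Q x s))"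
      by (simp add: Q[OF s] mult.left_commute)
    then have "integral {a..b} (\<lambda>x. A x s * (w x s - w x t)) = (s - t) * N s"
      by (simp add: N_def)
    ultimately show ?thesis by (simp add: algebra_simps)
  qed
  have "(\<Phi> has_real_derivative - N t) (at t)"
    unfolding has_field_derivative_iff
  proof (rule Lim_transform_within_open[of "\<lambda>s. - N s" _ t UNIV "{0<..}"])
    show "((\<lambda>s. - N s) \<longlongrightarrow> - N t) (at t)"
      using \<open>isCont N t\<close> by (intro tendsto_minus) (simp add: isCont_def)
    show "- N s = (\<Phi> s - \<Phi> t) / (s - t)" if "s \<in> {0<..}" "s \<noteq> t" for s
      using \<Phi>[of s] that by simp
  qed (use t in auto)
  moreover have "N t = integral {a..b} (\<lambda>x. (\<eta>' x * wx x t + \<eta> x * wxx x t) * wt x t)"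
    unfolding N_def A_def Q_t by (intro integral_cong) (simp add: algebra_simps)
  ultimately show ?thesis by (simp only: \<Phi>_def[abs_def])
qed

end

context bounded_solution
begin

definition weighted_mass :: "real \<Rightarrow> real \<Rightarrow> real" where
  "weighted_mass R t = integral {- R..R} (\<lambda>x. cutoff R x * ((u x t)\<^sup>2 / 2))"

definition weighted_mass_rate :: "real \<Rightarrow> real \<Rightarrow> real" where
  "weighted_mass_rate R t = integral {- R..R} (\<lambda>x. cutoff R x * (u x t * ut x t))"

lemma integrable_expressions:
  assumes "0 < t"
  shows "(\<lambda>x. cutoff R x * ((u x t)\<^sup>2 / 2)) integrable_on {a..b}"
    "(\<lambda>x. cutoff R x * (ux x t)\<^sup>2) integrable_on {a..b}"
    "(\<lambda>x. (ux x t)\<^sup>2) integrable_on {a..b}"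
    "(\<lambda>x. cutoff R x * (ut x t)\<^sup>2) integrable_on {a..b}"
    "(\<lambda>x. (ut x t)\<^sup>2) integrable_on {a..b}"
    "(\<lambda>x. cutoff R x * (u x t * ut x t)) integrable_on {a..b}"
    "(\<lambda>x. cutoff R x * (u x t * uxx x t)) integrable_on {a..b}"
    "(\<lambda>x. cutoff R x * (u x t * g (u x t))) integrable_on {a..b}"
    "(\<lambda>x. cutoff'' R x * ((u x t)\<^sup>2 / 2)) integrable_on {a..b}"
    "(\<lambda>x. cutoff' R x * ux x t * ut x t) integrable_on {a..b}"
    "(\<lambda>x. cutoff R x * (g (u x t) * ut x t)) integrable_on {a..b}"
    "(\<lambda>x. (cutoff' R x * ux x t + cutoff R x * uxx x t) * ut x t) integrable_on {a..b}"
proof -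
  have c: "continuous_on {a..b} (\<lambda>x. u x t)" "continuous_on {a..b} (\<lambda>x. ux x t)"
    "continuous_on {a..b} (\<lambda>x. uxx x t)" "continuous_on {a..b} (\<lambda>x. ut x t)"
    using assms by (intro continuous_along continuous_on_id continuous_on_const; simp)+
  have cg: "continuous_on {a..b} (\<lambda>x. g (u x t))"
    by (rule continuous_on_compose2[OF cont_g c(1)]) simp
  have half: "continuous_on {a..b} (\<lambda>x. (u x t)\<^sup>2 / 2)"
    by (intro continuous_on_divide continuous_on_power c continuous_on_const) simp
  show "(\<lambda>x. cutoff R x * ((u x t)\<^sup>2 / 2)) integrable_on {a..b}"
    "(\<lambda>x. cutoff R x * (ux x t)\<^sup>2) integrable_on {a..b}"
    "(\<lambda>x. (ux x t)\<^sup>2) integrable_on {a..b}"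
    "(\<lambda>x. cutoff R x * (ut x t)\<^sup>2) integrable_on {a..b}"
    "(\<lambda>x. (ut x t)\<^sup>2) integrable_on {a..b}"
    "(\<lambda>x. cutoff R x * (u x t * ut x t)) integrable_on {a..b}"
    "(\<lambda>x. cutoff R x * (u x t * uxx x t)) integrable_on {a..b}"
    "(\<lambda>x. cutoff R x * (u x t * g (u x t))) integrable_on {a..b}"
    "(\<lambda>x. cutoff'' R x * ((u x t)\<^sup>2 / 2)) integrable_on {a..b}"
    "(\<lambda>x. cutoff' R x * ux x t * ut x t) integrable_on {a..b}"
    "(\<lambda>x. cutoff R x * (g (u x t) * ut x t)) integrable_on {a..b}"
    "(\<lambda>x. (cutoff' R x * ux x t + cutoff R x * uxx x t) * ut x t) integrable_on {a..b}"
    by (intro integrable_continuous_real continuous_on_mult continuous_on_add continuous_on_power continuous_cutoff c cg half)+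
qed

lemma weighted_mass_derivative:
  assumes t: "0 < t"
  shows "(weighted_mass R has_real_derivative weighted_mass_rate R t) (at t)"
  unfolding weighted_mass_def[abs_def] weighted_mass_rate_def
  by (rule weighted_integral_time_derivative[where j = "\<lambda>s. s\<^sup>2 / 2" and j' = "\<lambda>s. s"])
    (auto intro!: derivative_eq_intros continuous_intros continuous_cutoff t)

lemma weighted_mass_bounds:
  assumes R: "0 < R" and t: "0 < t"
  shows "0 \<le> weighted_mass R t" "weighted_mass R t \<le> R * M\<^sup>2"
proof -
  show "0 \<le> weighted_mass R t"
    unfolding weighted_mass_def using t
    by (intro integral_nonneg integrable_expressions mult_nonneg_nonneg cutoff_nonneg) auto
  have "weighted_mass R t \<le> integral {- R..R} (\<lambda>x. 1 * (M\<^sup>2 / 2))"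
    unfolding weighted_mass_def
  proof (rule integral_le)
    show "cutoff R x * ((u x t)\<^sup>2 / 2) \<le> 1 * (M\<^sup>2 / 2)" if "x \<in> {- R..R}" for x
      using that R u_nonneg[OF t, of x] u_le[OF t, of x]
      by (intro mult_mono cutoff_bounds divide_right_mono power_mono) auto
  qed (rule integrable_expressions[OF t] integrable_const_ivl)+
  also have "\<dots> = R * M\<^sup>2" using R by simp
  finally show "weighted_mass R t \<le> R * M\<^sup>2" .
qed

lemma weighted_mass_rate_le:
  assumes R: "0 < R" and t: "0 < t" and g0: "g 0 = 0"
  shows "weighted_mass_rate R t \<le> 8 * M\<^sup>2 / R + 2 * K * weighted_mass R t - integral {- R..R} (\<lambda>x. cutoff R x * (ux x t)\<^sup>2)"
proof -
  have "weighted_mass_rate R t = integral {- R..R} (\<lambda>x. cutoff R x * (u x t * uxx x t) + cutoff R x * (u x t * g (u x t)))"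
    unfolding weighted_mass_rate_def by (intro integral_cong) (simp add: pde[OF t] algebra_simps)
  also have "\<dots> = integral {- R..R} (\<lambda>x. cutoff R x * (u x t * uxx x t)) + integral {- R..R} (\<lambda>x. cutoff R x * (u x t * g (u x t)))"
    using t by (intro integral_add integrable_expressions)
  also have "integral {- R..R} (\<lambda>x. cutoff R x * (u x t * uxx x t)) =
      integral {- R..R} (\<lambda>x. cutoff'' R x * ((u x t)\<^sup>2 / 2)) - integral {- R..R} (\<lambda>x. cutoff R x * (1 * (ux x t)\<^sup>2))"
    using R t
    by (intro weighted_integration_by_parts[where \<eta>' = "cutoff' R" and j = "\<lambda>s. s\<^sup>2 / 2" and j' = "\<lambda>s. s" and j'' = "\<lambda>s. 1"]
        cutoff_deriv cutoff_boundary continuous_cutoff)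
      (auto intro!: derivative_eq_intros simp: cutoff_boundary)
  also have "integral {- R..R} (\<lambda>x. cutoff'' R x * ((u x t)\<^sup>2 / 2)) \<le> integral {- R..R} (\<lambda>x. 8 / R\<^sup>2 * (M\<^sup>2 / 2))"
  proof (rule integral_le)
    fix x assume x: "x \<in> {- R..R}"
    then have "cutoff'' R x \<le> 8 / R\<^sup>2"
      using cutoff_bounds(2)[OF R, of x] by (simp add: abs_le_iff)
    then show "cutoff'' R x * ((u x t)\<^sup>2 / 2) \<le> 8 / R\<^sup>2 * (M\<^sup>2 / 2)"
      using u_nonneg[OF t, of x] u_le[OF t, of x] by (intro mult_mono divide_right_mono power_mono) auto
  qed (rule integrable_expressions[OF t] integrable_const_ivl)+
  also have "\<dots> = 8 * M\<^sup>2 / R"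
    using R by (simp add: power2_eq_square)
  also have "integral {- R..R} (\<lambda>x. cutoff R x * (u x t * g (u x t))) \<le> integral {- R..R} (\<lambda>x. 2 * K * (cutoff R x * ((u x t)\<^sup>2 / 2)))"
  proof (rule integral_le)
    fix x
    have "g (u x t) \<le> K * u x t"
      using lip[of "u x t" 0] u_nonneg[OF t, of x] u_le[OF t, of x] M_ge_1 g0 by auto
    then have "cutoff R x * (u x t * g (u x t)) \<le> cutoff R x * (u x t * (K * u x t))"
      using u_nonneg[OF t, of x] by (intro mult_left_mono cutoff_nonneg)
    then show "cutoff R x * (u x t * g (u x t)) \<le> 2 * K * (cutoff R x * ((u x t)\<^sup>2 / 2))"
      by (simp add: power2_eq_square algebra_simps)
  qed (rule integrable_expressions[OF t] integrable_on_mult_right)+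
  also have "\<dots> = 2 * K * weighted_mass R t"
    by (simp add: weighted_mass_def)
  finally show ?thesis by simp
qed

end

locale monostable_energy = monostable_solution +
  fixes G :: "real \<Rightarrow> real"
  assumes G_deriv: "\<And>s. (G has_real_derivative g s) (at s)" and G_0: "G 0 = 0"
    and square_integrable: "integrable lebesgue (\<lambda>x. (u x 1)\<^sup>2)"
begin

definition energy :: "real \<Rightarrow> real \<Rightarrow> real" where
  "energy R t = integral {- R..R} (\<lambda>x. cutoff R x * ((ux x t)\<^sup>2 / 2)) - integral {- R..R} (\<lambda>x. cutoff R x * G (u x t))"

definition energy_rate :: "real \<Rightarrow> real \<Rightarrow> real" where
  "energy_rate R t = - integral {- R..R} (\<lambda>x. cutoff R x * (ut x t)\<^sup>2) - integral {- R..R} (\<lambda>x. cutoff' R x * ux x t * ut x t)"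

lemma integrable_G:
  assumes "0 < t"
  shows "(\<lambda>x. cutoff R x * G (u x t)) integrable_on {a..b}"
proof -
  have "continuous_on UNIV G" using G_deriv by (auto intro: DERIV_continuous_on)
  moreover have "continuous_on {a..b} (\<lambda>x. u x t)"
    using assms by (intro continuous_along continuous_on_id continuous_on_const) simp
  ultimately have "continuous_on {a..b} (\<lambda>x. G (u x t))"
    by (rule continuous_on_compose2) simp
  then show ?thesis
    by (intro integrable_continuous_real continuous_on_mult continuous_cutoff)
qed

lemma energy_derivative:
  assumes R: "0 < R" and t: "0 < t"
  shows "(energy R has_real_derivative energy_rate R t) (at t)"
proof -
  have "(energy R has_real_derivative
      - integral {- R..R} (\<lambda>x. (cutoff' R x * ux x t + cutoff R x * uxx x t) * ut x t) -
      integral {- R..R} (\<lambda>x. cutoff R x * (g (u x t) * ut x t))) (at t)"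
    unfolding energy_def[abs_def] using R t
    by (intro DERIV_diff weighted_gradient_derivative weighted_integral_time_derivative G_deriv cont_g cutoff_deriv
        continuous_cutoff cutoff_boundary) auto
  moreover have "- integral {- R..R} (\<lambda>x. (cutoff' R x * ux x t + cutoff R x * uxx x t) * ut x t) -
      integral {- R..R} (\<lambda>x. cutoff R x * (g (u x t) * ut x t)) = energy_rate R t"
  proof -
    have "integral {- R..R} (\<lambda>x. (cutoff' R x * ux x t + cutoff R x * uxx x t) * ut x t) +
        integral {- R..R} (\<lambda>x. cutoff R x * (g (u x t) * ut x t)) =
      integral {- R..R} (\<lambda>x. (cutoff' R x * ux x t + cutoff R x * uxx x t) * ut x t + cutoff R x * (g (u x t) * ut x t))"
      using t by (intro integral_add[symmetric] integrable_expressions)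
    also have "\<dots> = integral {- R..R} (\<lambda>x. cutoff R x * (ut x t)\<^sup>2 + cutoff' R x * ux x t * ut x t)"
      by (intro integral_cong) (simp add: pde[OF t] power2_eq_square algebra_simps)
    also have "\<dots> = - energy_rate R t"
      unfolding energy_rate_def using t by (subst integral_add) (auto intro!: integrable_expressions)
    finally show ?thesis by simp
  qed
  ultimately show ?thesis by simp
qed

text \<open>Young's inequality absorbs half of the cross term, using \<open>\<eta>'\<^sup>2 \<le> (16 / R\<^sup>2) \<eta>\<close> for the cutoff.\<close>

lemma energy_rate_le:
  assumes R: "0 < R" and t: "0 < t"
  shows "energy_rate R t \<le> - (1 / 2 * integral {- R..R} (\<lambda>x. cutoff R x * (ut x t)\<^sup>2)) + 8 / R\<^sup>2 * integral {- R..R} (\<lambda>x. (ux x t)\<^sup>2)"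
proof -
  have young: "- (d * p * q) \<le> 1 / 2 * (e * q\<^sup>2) + c * p\<^sup>2" if "0 \<le> e" "0 \<le> c" "d\<^sup>2 \<le> 2 * c * e" for d p q e c :: real
  proof (cases "e = 0")
    case True
    then have "d = 0" using that by simp
    then show ?thesis using True that by simp
  next
    case False
    have "0 \<le> (e * q + d * p)\<^sup>2 + (2 * c * e - d\<^sup>2) * p\<^sup>2"
      using that by simp
    also have "\<dots> = e * (e * q\<^sup>2 + 2 * c * p\<^sup>2 + 2 * (d * p * q))"
      by (simp add: power2_eq_square algebra_simps)
    finally have "0 \<le> e * q\<^sup>2 + 2 * c * p\<^sup>2 + 2 * (d * p * q)"
      using False that by (simp add: zero_le_mult_iff)
    then show ?thesis by simp
  qed
  have "- integral {- R..R} (\<lambda>x. cutoff' R x * ux x t * ut x t) =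
      integral {- R..R} (\<lambda>x. - (cutoff' R x * ux x t * ut x t))"
    by simp
  also have "\<dots> \<le> integral {- R..R} (\<lambda>x. 1 / 2 * (cutoff R x * (ut x t)\<^sup>2) + 8 / R\<^sup>2 * (ux x t)\<^sup>2)"
  proof (rule integral_le)
    show "- (cutoff' R x * ux x t * ut x t) \<le> 1 / 2 * (cutoff R x * (ut x t)\<^sup>2) + 8 / R\<^sup>2 * (ux x t)\<^sup>2" if "x \<in> {- R..R}" for x
      using cutoff_bounds(3)[OF R, of x] that by (intro young cutoff_nonneg) auto
  qed (intro integrable_neg integrable_add integrable_on_mult_right integrable_expressions t)+
  also have "\<dots> = 1 / 2 * integral {- R..R} (\<lambda>x. cutoff R x * (ut x t)\<^sup>2) + 8 / R\<^sup>2 * integral {- R..R} (\<lambda>x. (ux x t)\<^sup>2)"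
    by (subst integral_add) (intro integrable_on_mult_right integrable_expressions t, intro integrable_on_mult_right integrable_expressions t, simp only: integral_mult_right)
  finally show ?thesis
    unfolding energy_rate_def by linarith
qed

end

section \<open>Dissipation of energy\<close>

lemma increment_le:
  fixes p p' :: "real \<Rightarrow> real"
  assumes "a \<le> b" "\<And>y. a \<le> y \<Longrightarrow> y \<le> b \<Longrightarrow> (p has_real_derivative p' y) (at y)"
    "\<And>y. a \<le> y \<Longrightarrow> y \<le> b \<Longrightarrow> p' y \<le> c"
  shows "p b - p a \<le> c * (b - a)"
proof -
  have "p b - c * b \<le> p a - c * a"
  proof (rule DERIV_nonpos_imp_nonincreasing[OF assms(1)])
    fix y assume y: "a \<le> y" "y \<le> b"
    have "((\<lambda>y. p y - c * y) has_real_derivative p' y - c) (at y)"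
      using assms(2)[OF y] by (auto intro!: derivative_eq_intros)
    then show "\<exists>z. ((\<lambda>y. p y - c * y) has_real_derivative z) (at y) \<and> z \<le> 0"
      using assms(3)[OF y] by (intro exI[of _ "p' y - c"]) simp
  qed
  then show ?thesis by (simp add: algebra_simps)
qed

context monostable_energy
begin

text \<open>The negation of the criterion in \<open>plateau_persists\<close>; by monotonicity the value at \<open>x\<close> bounds \<open>u\<close> below on \<open>[-x,x]\<close>.\<close>

definition never_wide :: bool where
  "never_wide \<longleftrightarrow> (\<forall>t x \<delta>. 0 < t \<longrightarrow> 0 < x \<longrightarrow> 0 < \<delta> \<longrightarrow> \<delta> \<le> 1 \<longrightarrow> \<delta> \<le> u x t \<longrightarrow> H \<delta> * x\<^sup>2 < 4 * \<delta>\<^sup>2)"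

lemma H_mono: "r \<le> s \<Longrightarrow> H r \<le> H s"
  by (rule DERIV_nonneg_imp_nondecreasing) (use H_deriv h_nonneg in blast)+

lemma H_pos: "0 < s \<Longrightarrow> 0 < H s"
proof -
  assume s: "0 < s"
  define r where "r = min s (1 / 2)"
  have r: "0 < r" "r \<le> s" "r < 1" using s by (auto simp: r_def)
  obtain z where "0 < z" "z < r" "H r - H 0 = (r - 0) * h z"
    using MVT2[of 0 r H h] r(1) H_deriv by blast
  then have "0 < H r"
    using r g_pos[of z] by (simp add: H_0 h_def)
  then show "0 < H s" using H_mono[OF r(2)] by simp
qed

lemma G_le_H:
  assumes "0 \<le> s"
  shows "G s \<le> H (min s 1)"
proof -
  have "G s - H s \<le> G 0 - H 0"
  proof (rule DERIV_nonpos_imp_nonincreasing[OF assms])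
    fix r assume "0 \<le> r" "r \<le> s"
    then have "g r - h r \<le> 0"
      using g_neg[of r] g_zeros by (cases "r \<le> 1") (auto simp: h_def)
    moreover have "((\<lambda>r. G r - H r) has_real_derivative g r - h r) (at r)"
      by (intro DERIV_diff G_deriv H_deriv)
    ultimately show "\<exists>y. ((\<lambda>r. G r - H r) has_real_derivative y) (at r) \<and> y \<le> 0" by blast
  qed
  moreover have "H s \<le> H (min s 1)"
  proof (cases "s \<le> 1")
    case False
    have "H s \<le> H 1"
    proof (rule DERIV_nonpos_imp_nonincreasing[of 1])
      fix r :: real assume "1 \<le> r" "r \<le> s"
      then have "h r = 0" using g_zeros by (simp add: h_def)
      then show "\<exists>y. (H has_real_derivative y) (at r) \<and> y \<le> 0"
        using H_deriv[of r] by auto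
    qed (use False in simp)
    then show ?thesis using False by simp
  qed simp
  ultimately show ?thesis using G_0 H_0 by simp
qed

text \<open>This decay of the potential, uniform in time and integrable in space, is what the absence of wide
  plateaus provides.\<close>

lemma potential_tail:
  assumes "never_wide" "0 < t"
  shows "G (u x t) \<le> (H 1 + 4) / (1 + x\<^sup>2)"
proof -
  define \<delta> where "\<delta> = min (u x t) 1"
  have \<delta>: "0 \<le> \<delta>" "\<delta> \<le> 1" using u_nonneg[OF assms(2)] by (auto simp: \<delta>_def)
  have "H \<delta> * x\<^sup>2 \<le> 4"
  proof (cases "0 < \<delta> \<and> x \<noteq> 0")
    case True
    have "\<delta> \<le> u \<bar>x\<bar> t"
      using even[OF assms(2), of x] by (simp add: \<delta>_def abs_if)
    then have "H \<delta> * \<bar>x\<bar>\<^sup>2 < 4 * \<delta>\<^sup>2"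
      using assms(1)[unfolded never_wide_def, rule_format, OF assms(2), of "\<bar>x\<bar>" \<delta>] True \<delta>(2) by simp
    also have "\<dots> \<le> 4 * 1" using \<delta> by (intro mult_left_mono power_le_one) auto
    finally show ?thesis by simp
  next
    case False
    then have "\<delta> = 0 \<or> x = 0" using \<delta>(1) by auto
    then show ?thesis using H_0 by auto
  qed
  moreover have "H \<delta> \<le> H 1" using \<delta> by (intro H_mono)
  ultimately have "H \<delta> * (1 + x\<^sup>2) \<le> H 1 + 4" by (simp add: algebra_simps)
  moreover have p: "0 < 1 + x\<^sup>2" by (simp add: add_pos_nonneg)
  ultimately have "H \<delta> \<le> (H 1 + 4) / (1 + x\<^sup>2)" by (simp add: pos_le_divide_eq)
  then show ?thesis using G_le_H[OF u_nonneg[OF assms(2)], of x] by (simp add: \<delta>_def)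
qed

lemma energy_lower_bound:
  assumes nw: "never_wide" and R: "0 < R" and t: "0 < t"
  shows "- ((H 1 + 4) * pi) \<le> energy R t"
proof -
  define C where "C = H 1 + 4"
  have C: "0 \<le> C" using H_pos[of 1] by (simp add: C_def)
  have "((\<lambda>x. C * (1 / (1 + x\<^sup>2))) has_integral C * arctan R - C * arctan (- R)) {- R..R}"
  proof (rule fundamental_theorem_of_calculus)
    fix x
    have "((\<lambda>x. C * arctan x) has_real_derivative C * (1 / (1 + x\<^sup>2))) (at x)"
      by (auto intro!: derivative_eq_intros simp: inverse_eq_divide)
    then show "((\<lambda>x. C * arctan x) has_vector_derivative C * (1 / (1 + x\<^sup>2))) (at x within {- R..R})"
      by (simp add: has_real_derivative_iff_has_vector_derivative has_vector_derivative_at_within)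
  qed (use R in simp)
  then have I: "(\<lambda>x. C * (1 / (1 + x\<^sup>2))) integrable_on {- R..R}"
    "integral {- R..R} (\<lambda>x. C * (1 / (1 + x\<^sup>2))) = C * (2 * arctan R)"
    by (auto simp: arctan_minus dest: integral_unique)
  have "integral {- R..R} (\<lambda>x. cutoff R x * G (u x t)) \<le> integral {- R..R} (\<lambda>x. C * (1 / (1 + x\<^sup>2)))"
  proof (rule integral_le[OF integrable_G[OF t] I(1)])
    fix x assume x: "x \<in> {- R..R}"
    have bd: "G (u x t) \<le> C * (1 / (1 + x\<^sup>2))" "0 \<le> C * (1 / (1 + x\<^sup>2))"
      using potential_tail[OF nw t, of x] C by (auto simp: C_def)
    have "cutoff R x * G (u x t) \<le> cutoff R x * (C * (1 / (1 + x\<^sup>2)))"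
      by (intro mult_left_mono bd cutoff_nonneg)
    also have "\<dots> \<le> 1 * (C * (1 / (1 + x\<^sup>2)))"
      using x R by (intro mult_right_mono bd cutoff_bounds) auto
    finally show "cutoff R x * G (u x t) \<le> C * (1 / (1 + x\<^sup>2))" by simp
  qed
  also have "\<dots> \<le> C * pi"
    unfolding I(2) using C arctan_ubound[of R] by (intro mult_left_mono) auto
  finally have "integral {- R..R} (\<lambda>x. cutoff R x * G (u x t)) \<le> C * pi" .
  moreover have "0 \<le> integral {- R..R} (\<lambda>x. cutoff R x * (ux x t)\<^sup>2)"
    using t by (intro integral_nonneg integrable_expressions mult_nonneg_nonneg cutoff_nonneg) auto
  ultimately show ?thesis
    unfolding energy_def C_def by simp
qed

text \<open>The gradient term that the cutoff adds to the energy rate is compensated by the decay of the mass on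
  the doubled interval. The mass term itself is \<open>O(1/R)\<close>.\<close>

definition lyapunov :: "real \<Rightarrow> real \<Rightarrow> real" where
  "lyapunov R t = energy R t + 16 / R\<^sup>2 * weighted_mass (2 * R) t"

lemma lyapunov_decay:
  assumes R: "1 \<le> R" "2 * L \<le> R" and L: "0 \<le> L" and st: "0 < s" "s \<le> t"
    and diss: "\<And>r. s \<le> r \<Longrightarrow> r \<le> t \<Longrightarrow> \<epsilon> \<le> integral {- L..L} (\<lambda>x. (ut x r)\<^sup>2)"
  shows "lyapunov R t - lyapunov R s \<le> (64 * (1 + K) * M\<^sup>2 / R - \<epsilon> / 4) * (t - s)"
proof (rule increment_le[OF st(2)])
  fix r assume r: "s \<le> r" "r \<le> t"
  then have r0: "0 < r" using st by simp
  have R0: "0 < R" "0 < 2 * R" using R by auto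
  show "(lyapunov R has_real_derivative energy_rate R r + 16 / R\<^sup>2 * weighted_mass_rate (2 * R) r) (at r)"
    unfolding lyapunov_def[abs_def]
    by (intro DERIV_add DERIV_cmult energy_derivative weighted_mass_derivative r0 R0)
  define P where "P = integral {- R..R} (\<lambda>x. (ux x r)\<^sup>2)"
  have "1 / 2 * P = integral {- R..R} (\<lambda>x. 1 / 2 * (ux x r)\<^sup>2)"
    unfolding P_def by simp
  also have "\<dots> \<le> integral {- R..R} (\<lambda>x. cutoff (2 * R) x * (ux x r)\<^sup>2)"
  proof (rule integral_le)
    show "1 / 2 * (ux x r)\<^sup>2 \<le> cutoff (2 * R) x * (ux x r)\<^sup>2" if "x \<in> {- R..R}" for x
      using that R0 by (intro mult_right_mono cutoff_ge_half) auto
  qed (intro integrable_on_mult_right integrable_expressions r0)+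
  also have "\<dots> \<le> integral {- (2 * R)..2 * R} (\<lambda>x. cutoff (2 * R) x * (ux x r)\<^sup>2)"
    using R0 by (intro integral_subset_le integrable_expressions r0) (auto intro!: mult_nonneg_nonneg cutoff_nonneg)
  finally have P: "1 / 2 * P \<le> integral {- (2 * R)..2 * R} (\<lambda>x. cutoff (2 * R) x * (ux x r)\<^sup>2)" .
  have "2 * K * weighted_mass (2 * R) r \<le> 2 * K * (2 * R * M\<^sup>2)"
    using weighted_mass_bounds(2)[OF R0(2) r0] K_nonneg by (intro mult_left_mono) auto
  then have "weighted_mass_rate (2 * R) r \<le> 8 * M\<^sup>2 / (2 * R) + 2 * K * (2 * R * M\<^sup>2) - 1 / 2 * P"
    using weighted_mass_rate_le[OF R0(2) r0 g_zeros(1)] P by linarith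
  also have "8 * M\<^sup>2 / (2 * R) \<le> 4 * R * M\<^sup>2"
  proof -
    have "8 * M\<^sup>2 / (2 * R) \<le> 4 * M\<^sup>2 / 1"
      using R by (simp add: divide_le_eq mult_le_cancel_left1)
    also have "\<dots> \<le> R * (4 * M\<^sup>2)" using R mult_right_mono[of 1 R "4 * M\<^sup>2"] by simp
    finally show ?thesis by simp
  qed
  finally have "weighted_mass_rate (2 * R) r \<le> 4 * (1 + K) * R * M\<^sup>2 - 1 / 2 * P"
    by (simp add: algebra_simps)
  then have "16 / R\<^sup>2 * weighted_mass_rate (2 * R) r \<le> 16 / R\<^sup>2 * (4 * (1 + K) * R * M\<^sup>2 - 1 / 2 * P)"
    by (intro mult_left_mono) auto
  also have "\<dots> = 64 * (1 + K) * M\<^sup>2 / R - 8 / R\<^sup>2 * P"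
    using R0 by (simp add: field_simps power2_eq_square)
  finally have mass: "16 / R\<^sup>2 * weighted_mass_rate (2 * R) r \<le> 64 * (1 + K) * M\<^sup>2 / R - 8 / R\<^sup>2 * P" .
  have "1 / 2 * \<epsilon> \<le> 1 / 2 * integral {- L..L} (\<lambda>x. (ut x r)\<^sup>2)"
    using diss[OF r] by simp
  also have "\<dots> = integral {- L..L} (\<lambda>x. 1 / 2 * (ut x r)\<^sup>2)" by simp
  also have "\<dots> \<le> integral {- L..L} (\<lambda>x. cutoff R x * (ut x r)\<^sup>2)"
  proof (rule integral_le)
    show "1 / 2 * (ut x r)\<^sup>2 \<le> cutoff R x * (ut x r)\<^sup>2" if "x \<in> {- L..L}" for x
      using that R R0 by (intro mult_right_mono cutoff_ge_half) auto
  qed (intro integrable_on_mult_right integrable_expressions r0)+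
  also have "\<dots> \<le> integral {- R..R} (\<lambda>x. cutoff R x * (ut x r)\<^sup>2)"
    using R L by (intro integral_subset_le integrable_expressions r0) (auto intro!: mult_nonneg_nonneg cutoff_nonneg)
  finally have "1 / 2 * \<epsilon> \<le> integral {- R..R} (\<lambda>x. cutoff R x * (ut x r)\<^sup>2)" .
  then show "energy_rate R r + 16 / R\<^sup>2 * weighted_mass_rate (2 * R) r \<le> 64 * (1 + K) * M\<^sup>2 / R - \<epsilon> / 4"
    using energy_rate_le[OF R0(1) r0] mass unfolding P_def by linarith
qed

text \<open>Square integrability at time \<open>1\<close> gives a bound independent of \<open>R\<close>, and Gronwall's inequality keeps it
  up to time \<open>2\<close>.\<close>

lemma weighted_mass_uniform:
  obtains N where "0 \<le> N" "\<And>R t. 1 \<le> R \<Longrightarrow> 1 \<le> t \<Longrightarrow> t \<le> 2 \<Longrightarrow> weighted_mass R t \<le> N"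
proof -
  define N0 where "N0 = integral UNIV (\<lambda>x. (u x 1)\<^sup>2)"
  have int: "(\<lambda>x. (u x 1)\<^sup>2) integrable_on UNIV"
    using square_integrable by (rule integrable_on_lebesgue)
  have N0: "0 \<le> N0" unfolding N0_def using int by (intro integral_nonneg) auto
  have start: "weighted_mass R 1 \<le> N0" if R: "1 \<le> R" for R
  proof -
    have i: "(\<lambda>x. (u x 1)\<^sup>2) integrable_on {- R..R}"
      using int integrable_on_subinterval by blast
    have "weighted_mass R 1 \<le> integral {- R..R} (\<lambda>x. (u x 1)\<^sup>2)"
      unfolding weighted_mass_def
    proof (rule integral_le[OF integrable_expressions(1) i])
      fix x assume "x \<in> {- R..R}"
      then have "cutoff R x * ((u x 1)\<^sup>2 / 2) \<le> 1 * ((u x 1)\<^sup>2 / 2)"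
        using R by (intro mult_right_mono cutoff_bounds) auto
      then show "cutoff R x * ((u x 1)\<^sup>2 / 2) \<le> (u x 1)\<^sup>2"
        using zero_le_power2[of "u x 1"] by linarith
    qed simp
    also have "\<dots> \<le> N0"
      unfolding N0_def by (intro integral_subset_le i int) auto
    finally show ?thesis .
  qed
  define N where "N = exp (4 * K) * (N0 + 8 * M\<^sup>2)"
  show ?thesis
  proof (rule that[of N])
    show "0 \<le> N" using N0 by (simp add: N_def)
    fix R t :: real assume R: "1 \<le> R" and t: "1 \<le> t" "t \<le> 2"
    define E where "E t = exp (- 2 * K * t) * weighted_mass R t" for t
    have "E t - E 1 \<le> 8 * M\<^sup>2 * (t - 1)"
    proof (rule increment_le[OF t(1)])
      fix r assume r: "1 \<le> r" "r \<le> t"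
      then have r0: "0 < r" by simp
      have R0: "0 < R" using R by simp
      show "(E has_real_derivative exp (- 2 * K * r) * (weighted_mass_rate R r - 2 * K * weighted_mass R r)) (at r)"
        unfolding E_def[abs_def] using weighted_mass_derivative[OF r0, of R]
        by (auto intro!: derivative_eq_intros simp: algebra_simps)
      have "0 \<le> integral {- R..R} (\<lambda>x. cutoff R x * (ux x r)\<^sup>2)"
        using r0 by (intro integral_nonneg integrable_expressions mult_nonneg_nonneg cutoff_nonneg) auto
      then have "weighted_mass_rate R r - 2 * K * weighted_mass R r \<le> 8 * M\<^sup>2 / R"
        using weighted_mass_rate_le[OF R0 r0 g_zeros(1)] by linarith
      also have "\<dots> \<le> 8 * M\<^sup>2"
        using R by (simp add: divide_le_eq mult_le_cancel_left1)
      finally have "exp (- 2 * K * r) * (weighted_mass_rate R r - 2 * K * weighted_mass R r) \<le> exp (- 2 * K * r) * (8 * M\<^sup>2)"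
        by (intro mult_left_mono) auto
      also have "\<dots> \<le> 1 * (8 * M\<^sup>2)"
        using K_nonneg r0 by (intro mult_right_mono) auto
      finally show "exp (- 2 * K * r) * (weighted_mass_rate R r - 2 * K * weighted_mass R r) \<le> 8 * M\<^sup>2" by simp
    qed
    also have "\<dots> \<le> 8 * M\<^sup>2 * 1"
      using t by (intro mult_left_mono) auto
    finally have "E t \<le> E 1 + 8 * M\<^sup>2" by simp
    moreover have "E 1 \<le> 1 * weighted_mass R 1"
      unfolding E_def using K_nonneg weighted_mass_bounds(1)[of R 1] R by (intro mult_right_mono) auto
    ultimately have "E t \<le> N0 + 8 * M\<^sup>2" using start[OF R] by simp
    then have "exp (2 * K * t) * E t \<le> exp (2 * K * t) * (N0 + 8 * M\<^sup>2)"
      by (intro mult_left_mono) auto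
    also have "\<dots> \<le> exp (4 * K) * (N0 + 8 * M\<^sup>2)"
      using K_nonneg t N0 mult_left_mono[of t 2 "2 * K"] by (intro mult_right_mono) auto
    finally show "weighted_mass R t \<le> N"
      unfolding E_def N_def by (simp flip: mult.assoc exp_add)
  qed
qed

text \<open>Up to terms of bounded size, the energy at time \<open>2\<close> is at most its value at a time
  \<open>\<tau> \<in> (1,2)\<close>, which the mean value theorem applied to the mass supplies: there \<open>\<integral> \<eta> u\<^sub>x\<^sup>2\<close> is controlled by the mass.\<close>

lemma lyapunov_initial_bound:
  obtains C where "\<And>R. 1 \<le> R \<Longrightarrow> lyapunov R 2 \<le> C"
proof -
  obtain N where N: "0 \<le> N" "\<And>R t. 1 \<le> R \<Longrightarrow> 1 \<le> t \<Longrightarrow> t \<le> 2 \<Longrightarrow> weighted_mass R t \<le> N"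
    using weighted_mass_uniform by blast
  define C where "C = 1 / 2 * (N + 8 * M\<^sup>2 + 2 * K * N) + K * N + 16 * (2 * M\<^sup>2) + 64 * (1 + K) * M\<^sup>2"
  show ?thesis
  proof (rule that[of C])
    fix R :: real assume R: "1 \<le> R"
    then have R0: "0 < R" "0 < 2 * R" by auto
    obtain \<tau> where \<tau>: "1 < \<tau>" "\<tau> < 2" "weighted_mass R 2 - weighted_mass R 1 = (2 - 1) * weighted_mass_rate R \<tau>"
      using MVT2[of 1 2 "weighted_mass R" "weighted_mass_rate R"] weighted_mass_derivative by force
    have \<tau>0: "0 < \<tau>" using \<tau> by simp
    define P where "P = integral {- R..R} (\<lambda>x. cutoff R x * (ux x \<tau>)\<^sup>2)"
    have "8 * M\<^sup>2 / R \<le> 8 * M\<^sup>2"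
      using R by (simp add: divide_le_eq mult_le_cancel_left1)
    moreover have "2 * K * weighted_mass R \<tau> \<le> 2 * K * N"
      using N(2)[OF R, of \<tau>] \<tau> K_nonneg by (intro mult_left_mono) auto
    ultimately have P: "P \<le> N + 8 * M\<^sup>2 + 2 * K * N"
      using weighted_mass_rate_le[OF R0(1) \<tau>0 g_zeros(1)] \<tau>(3) weighted_mass_bounds(1)[OF R0(1), of 2] N(2)[OF R, of 1]
      unfolding P_def by simp
    have G_ge: "- G s \<le> K * s\<^sup>2 / 2" if s: "0 \<le> s" "s \<le> M" for s
    proof -
      have "- G s - K * s\<^sup>2 / 2 \<le> - G 0 - K * 0\<^sup>2 / 2"
      proof (rule DERIV_nonpos_imp_nonincreasing[OF s(1)])
        fix r assume r: "0 \<le> r" "r \<le> s"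
        have "((\<lambda>s. - G s - K * s\<^sup>2 / 2) has_real_derivative - g r - K * r) (at r)"
          using G_deriv[of r] by (auto intro!: derivative_eq_intros)
        moreover have "- g r - K * r \<le> 0"
          using lip[of r 0] r s M_ge_1 g_zeros by auto
        ultimately show "\<exists>y. ((\<lambda>s. - G s - K * s\<^sup>2 / 2) has_real_derivative y) (at r) \<and> y \<le> 0" by blast
      qed
      then show ?thesis using G_0 by simp
    qed
    have "- integral {- R..R} (\<lambda>x. cutoff R x * G (u x \<tau>)) = integral {- R..R} (\<lambda>x. - (cutoff R x * G (u x \<tau>)))"
      by simp
    also have "\<dots> \<le> integral {- R..R} (\<lambda>x. K * (cutoff R x * ((u x \<tau>)\<^sup>2 / 2)))"
    proof (rule integral_le)
      show "- (cutoff R x * G (u x \<tau>)) \<le> K * (cutoff R x * ((u x \<tau>)\<^sup>2 / 2))" for x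
        using mult_left_mono[OF G_ge[OF u_nonneg[OF \<tau>0] u_le[OF \<tau>0]] cutoff_nonneg[of R x], of x]
        by (simp add: mult.left_commute)
    qed (intro integrable_neg integrable_on_mult_right integrable_expressions integrable_G \<tau>0)+
    also have "\<dots> = K * weighted_mass R \<tau>" by (simp add: weighted_mass_def)
    also have "\<dots> \<le> K * N"
      using N(2)[OF R, of \<tau>] \<tau> K_nonneg by (intro mult_left_mono) auto
    finally have E: "energy R \<tau> \<le> 1 / 2 * P + K * N"
      unfolding energy_def P_def by simp
    have W: "16 / R\<^sup>2 * weighted_mass (2 * R) \<tau> \<le> 16 * (2 * M\<^sup>2)"
    proof -
      have "16 / R\<^sup>2 * weighted_mass (2 * R) \<tau> \<le> 16 / R\<^sup>2 * (2 * R * M\<^sup>2)"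
        by (intro mult_left_mono weighted_mass_bounds R0 \<tau>0) simp
      also have "\<dots> = 16 * (2 * M\<^sup>2) / R" using R0 by (simp add: power2_eq_square)
      also have "\<dots> \<le> 16 * (2 * M\<^sup>2)"
        using R by (simp add: divide_le_eq mult_le_cancel_left1)
      finally show ?thesis .
    qed
    have "lyapunov R \<tau> \<le> 1 / 2 * P + K * N + 16 * (2 * M\<^sup>2)"
      unfolding lyapunov_def by (rule add_mono[OF E W])
    moreover have "lyapunov R 2 - lyapunov R \<tau> \<le> (64 * (1 + K) * M\<^sup>2 / R - 0 / 4) * (2 - \<tau>)"
      using R \<tau> by (intro lyapunov_decay[of _ 0]) auto
    then have "lyapunov R 2 - lyapunov R \<tau> \<le> 64 * (1 + K) * M\<^sup>2 * 1"
    proof (rule order_trans)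
      show "(64 * (1 + K) * M\<^sup>2 / R - 0 / 4) * (2 - \<tau>) \<le> 64 * (1 + K) * M\<^sup>2 * 1"
      proof (rule mult_mono)
        have "0 \<le> 64 * (1 + K) * M\<^sup>2" using K_nonneg by simp
        then show "64 * (1 + K) * M\<^sup>2 / R - 0 / 4 \<le> 64 * (1 + K) * M\<^sup>2"
          using R mult_left_mono[of 1 R "64 * (1 + K) * M\<^sup>2"] by (simp add: divide_le_eq)
      qed (use \<tau> K_nonneg in auto)
    qed
    moreover have "1 / 2 * P \<le> 1 / 2 * (N + 8 * M\<^sup>2 + 2 * K * N)"
      using P by simp
    ultimately show "lyapunov R 2 \<le> C"
      unfolding C_def mult_1_right by linarith
  qed
qed

text \<open>Each time window of length \<open>1\<close> in which \<open>\<integral> u\<^sub>t\<^sup>2 \<ge> \<epsilon>\<close> lowers the Lyapunov function by \<open>\<epsilon>/4\<close>, up to an error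
  \<open>O(1/R)\<close>. After finitely many of them it would fall below the lower bound of the energy. The number of
  windows is fixed first and \<open>R\<close> is chosen afterwards, in terms of the last window.\<close>

lemma dissipation_vanishes:
  assumes nw: "never_wide" and L: "0 \<le> L" and \<epsilon>: "0 < \<epsilon>"
  obtains T where "2 \<le> T" "\<And>t. T \<le> t \<Longrightarrow> \<exists>s. t - 1 \<le> s \<and> s \<le> t \<and> integral {- L..L} (\<lambda>x. (ut x s)\<^sup>2) < \<epsilon>"
proof -
  have "\<exists>T\<ge>2. \<forall>t\<ge>T. \<exists>s. t - 1 \<le> s \<and> s \<le> t \<and> integral {- L..L} (\<lambda>x. (ut x s)\<^sup>2) < \<epsilon>"
  proof (rule ccontr)
    assume "\<not> ?thesis"
    then have windows: "\<exists>t\<ge>T. \<forall>s. t - 1 \<le> s \<longrightarrow> s \<le> t \<longrightarrow> \<epsilon> \<le> integral {- L..L} (\<lambda>x. (ut x s)\<^sup>2)" if "2 \<le> T" for T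
      using that by (metis not_less)
    obtain C where C: "\<And>R. 1 \<le> R \<Longrightarrow> lyapunov R 2 \<le> C"
      using lyapunov_initial_bound by blast
    \<comment> \<open>The constant of the error term in \<open>lyapunov_decay\<close>.\<close>
    define c where "c = 64 * (1 + K) * M\<^sup>2"
    have drops: "\<exists>T\<ge>2. \<forall>R. 1 \<le> R \<longrightarrow> 2 * L \<le> R \<longrightarrow> lyapunov R T \<le> C + c / R * (T - 2) - real n * (\<epsilon> / 4)" for n
    proof (induction n)
      case 0
      then show ?case using C by (intro exI[of _ 2]) auto
    next
      case (Suc n)
      then obtain T where T: "2 \<le> T" "\<And>R. 1 \<le> R \<Longrightarrow> 2 * L \<le> R \<Longrightarrow> lyapunov R T \<le> C + c / R * (T - 2) - real n * (\<epsilon> / 4)"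
        by auto
      obtain t where t: "T + 1 \<le> t" "\<And>s. t - 1 \<le> s \<Longrightarrow> s \<le> t \<Longrightarrow> \<epsilon> \<le> integral {- L..L} (\<lambda>x. (ut x s)\<^sup>2)"
        using windows[of "T + 1"] T by auto
      have "lyapunov R t \<le> C + c / R * (t - 2) - real (Suc n) * (\<epsilon> / 4)" if R: "1 \<le> R" "2 * L \<le> R" for R
      proof -
        have "lyapunov R (t - 1) - lyapunov R T \<le> (64 * (1 + K) * M\<^sup>2 / R - 0 / 4) * (t - 1 - T)"
          using R T t by (intro lyapunov_decay[of _ 0]) auto
        moreover have "lyapunov R t - lyapunov R (t - 1) \<le> (64 * (1 + K) * M\<^sup>2 / R - \<epsilon> / 4) * (t - (t - 1))"
          using R T t L by (intro lyapunov_decay[of _ L]) auto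
        ultimately have "lyapunov R t \<le> lyapunov R T + c / R * (t - 1 - T) + (c / R - \<epsilon> / 4)"
          by (simp add: c_def)
        then show ?thesis
          using T(2)[OF R] by (simp add: algebra_simps add_divide_distrib diff_divide_distrib)
      qed
      then show ?case using t(1) T(1) by (intro exI[of _ t]) auto
    qed
    define D where "D = (H 1 + 4) * pi"
    obtain n where n: "C + 1 + D < real n * (\<epsilon> / 4)"
    proof -
      have "0 < \<epsilon> / 4" using \<epsilon> by simp
      with that show ?thesis using reals_Archimedean3 by blast
    qed
    obtain T where T: "2 \<le> T" "\<And>R. 1 \<le> R \<Longrightarrow> 2 * L \<le> R \<Longrightarrow> lyapunov R T \<le> C + c / R * (T - 2) - real n * (\<epsilon> / 4)"
      using drops[of n] by auto
    define R where "R = 1 + 2 * L + c * (T - 2)"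
    have c: "0 \<le> c" using K_nonneg by (simp add: c_def)
    then have cT: "0 \<le> c * (T - 2)" using T by simp
    have R: "1 \<le> R" "2 * L \<le> R" "c * (T - 2) \<le> R" using cT L by (auto simp: R_def)
    have "c / R * (T - 2) \<le> 1"
      using R by (simp add: divide_le_eq)
    moreover have "0 \<le> 16 / R\<^sup>2 * weighted_mass (2 * R) T"
      using weighted_mass_bounds(1)[of "2 * R" T] R T by (intro mult_nonneg_nonneg) auto
    then have "- D \<le> lyapunov R T"
      using energy_lower_bound[OF nw, of R T] R T by (simp add: lyapunov_def D_def)
    ultimately show False
      using T(2)[OF R(1,2)] n by linarith
  qed
  then show ?thesis using that by blast
qed

end

section \<open>Quiet times and the dichotomy\<close>

context monostable_energy
begin

text \<open>Removing from \<open>u\<^sub>x\<close> the antiderivative \<open>P\<close> of \<open>u\<^sub>t\<close>, which is at most \<open>e\<close> on \<open>[0,L]\<close> because the time is quiet,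
  leaves a function \<open>N\<close> with \<open>N' = - g(u)\<close> and \<open>N(0) = 0\<close>. The slope of \<open>u\<close> on \<open>[0,X]\<close> is bounded by
  \<open>1 + K M X\<close>, so \<open>u\<close> needs at least the length \<open>\<alpha> / (2 (1 + K M X))\<close> to fall from \<open>\<alpha>\<close> to \<open>\<alpha>/2\<close>, and \<open>N\<close> loses at
  least \<open>\<kappa>\<close> on the way. The constant \<open>L\<close> is the point by which the slope \<open>- \<kappa>/2\<close> has brought \<open>u\<close> from at
  most \<open>M\<close> down to at most \<open>- M\<close>.\<close>

lemma quiet_time_contradiction:
  assumes s: "0 < s" and X: "0 < X" and \<alpha>: "0 < \<alpha>" "\<alpha> \<le> u 0 s" "u X s \<le> \<alpha> / 2"
    and c: "0 < c" "\<And>v. \<alpha> / 2 \<le> v \<Longrightarrow> v \<le> \<alpha> \<Longrightarrow> c \<le> g v"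
    and \<kappa>: "\<kappa> = c * \<alpha> / (2 * (1 + K * M * X))" and L: "L = X + 4 * M / \<kappa>"
    and e: "0 < e" "e \<le> 1" "e \<le> \<kappa> / 4"
    and \<eta>: "\<And>x. - \<eta> \<le> g (u x s)" "0 \<le> \<eta>" "\<eta> * L \<le> \<kappa> / 4"
    and quiet: "integral {- L..L} (\<lambda>x. (ut x s)\<^sup>2) \<le> e\<^sup>2 / L"
  shows False
proof -
  have "0 \<le> K * M * X" using K_nonneg M_ge_1 X by simp
  define \<Gamma> where "\<Gamma> = 1 + K * M * X"
  have \<Gamma>: "1 \<le> \<Gamma>" using \<open>0 \<le> K * M * X\<close> by (simp add: \<Gamma>_def)
  have \<kappa>0: "0 < \<kappa>" using c \<alpha> \<Gamma> unfolding \<kappa> \<Gamma>_def[symmetric] by simp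
  have LX: "X < L" using \<kappa>0 M_ge_1 by (simp add: L)
  then have L0: "0 < L" using X by simp
  have "continuous_on UNIV (\<lambda>y. ut y s)"
    using s by (intro continuous_along continuous_on_id continuous_on_const) simp
  then obtain P where P: "P 0 = 0" "\<And>y. (P has_real_derivative ut y s) (at y)"
    using global_antiderivative by blast
  have P_small: "\<bar>P x\<bar> \<le> e" if x: "0 \<le> x" "x \<le> L" for x
  proof -
    have "((\<lambda>y. ut y s) has_integral P x - P 0) {0..x}"
      using P(2) x by (intro fundamental_theorem_of_calculus)
        (auto simp: has_real_derivative_iff_has_vector_derivative intro: has_vector_derivative_at_within)
    then have Px: "P x = integral {0..x} (\<lambda>y. ut y s)" and I: "(\<lambda>y. ut y s) integrable_on {0..x}"
      using P(1) by (auto dest: integral_unique)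
    \<comment> \<open>The bound \<open>\<bar>u\<^sub>t\<bar> \<le> \<theta>/2 + u\<^sub>t\<^sup>2 / (2 \<theta>)\<close> integrates to exactly \<open>e\<close> for this \<open>\<theta>\<close>.\<close>
    define \<theta> where "\<theta> = e / L"
    have \<theta>: "0 < \<theta>" using e L0 by (simp add: \<theta>_def)
    have i2: "(\<lambda>y. 1 / (2 * \<theta>) * (ut y s)\<^sup>2) integrable_on {0..x}"
      by (intro integrable_on_mult_right integrable_expressions s)
    have "norm (integral {0..x} (\<lambda>y. ut y s)) \<le> integral {0..x} (\<lambda>y. \<theta> / 2 + 1 / (2 * \<theta>) * (ut y s)\<^sup>2)"
    proof (rule integral_norm_bound_integral[OF I integrable_add[OF integrable_const_ivl i2]])
      fix y
      have "0 \<le> (\<bar>ut y s\<bar> - \<theta>)\<^sup>2" by simp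
      then have "2 * \<theta> * \<bar>ut y s\<bar> \<le> \<theta>\<^sup>2 + (ut y s)\<^sup>2"
        by (simp add: power2_diff algebra_simps)
      then show "norm (ut y s) \<le> \<theta> / 2 + 1 / (2 * \<theta>) * (ut y s)\<^sup>2"
        using \<theta> by (simp add: field_simps power2_eq_square)
    qed
    also have "\<dots> = \<theta> / 2 * x + 1 / (2 * \<theta>) * integral {0..x} (\<lambda>y. (ut y s)\<^sup>2)"
      using integral_add[OF integrable_const_ivl i2, of "\<theta> / 2"] x by simp
    also have "\<dots> \<le> \<theta> / 2 * L + 1 / (2 * \<theta>) * (e\<^sup>2 / L)"
    proof (intro add_mono mult_left_mono)
      have "integral {0..x} (\<lambda>y. (ut y s)\<^sup>2) \<le> integral {- L..L} (\<lambda>y. (ut y s)\<^sup>2)"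
        using x by (intro integral_subset_le integrable_expressions s) auto
      with quiet show "integral {0..x} (\<lambda>y. (ut y s)\<^sup>2) \<le> e\<^sup>2 / L" by simp
    qed (use x \<theta> in auto)
    also have "\<dots> = e"
      using e L0 by (simp add: \<theta>_def power2_eq_square)
    finally show ?thesis by (simp add: Px)
  qed
  define N where "N y = ux y s - P y" for y
  have dN: "(N has_real_derivative - g (u y s)) (at y)" for y
    using DERIV_diff[OF dxx[OF s, of y] P(2)[of y]] unfolding N_def[abs_def] by (simp add: pde[OF s])
  have sink: "- g (u y s) \<le> \<eta>" for y using \<eta>(1)[of y] by linarith
  have N0: "N 0 = 0" using centre_derivatives(1)[OF s] P(1) by (simp add: N_def)
  have cont_u: "continuous_on S (\<lambda>y. u y s)" for S
    using s by (intro continuous_along continuous_on_id continuous_on_const) simp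
  have slope: "- \<Gamma> \<le> ux y s" if y: "0 \<le> y" "y \<le> X" for y
  proof -
    have "(- N y) - (- N 0) \<le> (K * M) * (y - 0)"
    proof (rule increment_le[OF y(1)])
      show "((\<lambda>y. - N y) has_real_derivative g (u z s)) (at z)" for z
        using DERIV_minus[OF dN[of z]] by simp
      have "g (u z s) \<le> K * u z s" for z
        by (intro g_le_linear u_nonneg u_le s)
      also have "K * u z s \<le> K * M" for z
        using K_nonneg by (intro mult_left_mono u_le s)
      finally show "g (u z s) \<le> K * M" for z .
    qed
    also have "(K * M) * (y - 0) \<le> K * M * X"
      using y K_nonneg M_ge_1 by (intro mult_left_mono) auto
    finally show ?thesis
      using P_small[of y] y LX e(2) N0 by (simp add: N_def \<Gamma>_def)
  qed
  obtain p where p: "0 \<le> p" "p \<le> X" "u p s = \<alpha>"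
    using IVT2'[of "\<lambda>y. u y s" X \<alpha> 0] \<alpha> X cont_u by auto
  obtain q where q: "p \<le> q" "q \<le> X" "u q s = \<alpha> / 2"
    using IVT2'[of "\<lambda>y. u y s" X "\<alpha> / 2" p] \<alpha> p cont_u by auto
  have "(- u q s) - (- u p s) \<le> \<Gamma> * (q - p)"
  proof (rule increment_le[OF q(1)])
    show "((\<lambda>y. - u y s) has_real_derivative - ux z s) (at z)" for z
      using DERIV_minus[OF dx[OF s, of z]] by simp
    show "- ux z s \<le> \<Gamma>" if "p \<le> z" "z \<le> q" for z
      using slope[of z] that p q by simp
  qed
  then have width: "\<alpha> / 2 \<le> \<Gamma> * (q - p)" using p q by simp
  have "N q - N p \<le> (- c) * (q - p)"
  proof (rule increment_le[OF q(1) dN])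
    fix z assume "p \<le> z" "z \<le> q"
    then have "c \<le> g (u z s)"
      using decreasing[OF s, of z q] decreasing[OF s, of p z] p q by (intro c) auto
    then show "- g (u z s) \<le> - c" by simp
  qed
  moreover have "\<kappa> \<le> c * (q - p)"
  proof -
    have "c * (\<alpha> / 2) \<le> c * (\<Gamma> * (q - p))"
      using width c by (intro mult_left_mono) auto
    then have "c * \<alpha> \<le> c * (q - p) * (2 * \<Gamma>)"
      by (simp add: algebra_simps)
    then show ?thesis
      unfolding \<kappa> \<Gamma>_def[symmetric] using \<Gamma> by (subst pos_divide_le_eq) auto
  qed
  moreover have "N p - N 0 \<le> \<eta> * (p - 0)"
    by (rule increment_le[OF p(1) dN sink])
  ultimately have Nq: "N q \<le> \<eta> * p - \<kappa>" using N0 by simp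
  have steep: "ux x s \<le> - \<kappa> / 2" if x: "X \<le> x" "x \<le> L" for x
  proof -
    have "q \<le> x" using q x by simp
    then have "N x - N q \<le> \<eta> * (x - q)"
      by (rule increment_le[OF _ dN sink])
    moreover have "\<eta> * p + \<eta> * (x - q) \<le> \<eta> * L"
    proof -
      have "\<eta> * (p + (x - q)) \<le> \<eta> * L"
        using \<eta>(2) q x by (intro mult_left_mono) auto
      then show ?thesis by (simp add: algebra_simps)
    qed
    ultimately have "N x \<le> - (3 / 4) * \<kappa>" using Nq \<eta>(3) by linarith
    then show ?thesis
      using P_small[of x] x X e(3) by (simp add: N_def)
  qed
  have "u L s - u X s \<le> (- \<kappa> / 2) * (L - X)"
    using LX by (intro increment_le[OF _ dx[OF s]] steep) auto
  moreover have "(- \<kappa> / 2) * (L - X) = - 2 * M"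
    using \<kappa>0 by (simp add: L)
  ultimately have "u L s \<le> - M" using u_le[OF s, of X] by simp
  then show False using u_nonneg[OF s, of L] M_ge_1 by simp
qed

text \<open>The point \<open>X\<close> solves \<open>H(\<alpha>/2) X\<^sup>2 = 4 (\<alpha>/2)\<^sup>2\<close>, so that \<open>u(X,t) \<ge> \<alpha>/2\<close> would be a wide plateau. The late
  time \<open>t\<close> is chosen last, once all constants are fixed.\<close>

lemma vanishes_if_never_wide:
  assumes nw: "never_wide" and \<delta>: "0 < \<delta>"
  shows "\<exists>T>0. \<forall>t\<ge>T. u 0 t \<le> \<delta>"
proof (rule ccontr)
  assume "\<not> ?thesis"
  then have often: "\<exists>t\<ge>T. \<delta> < u 0 t" if "0 < T" for T
    using that by (meson not_le)
  define \<alpha> where "\<alpha> = exp (- K) * min \<delta> (1 / 2)"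
  have \<alpha>: "0 < \<alpha>" "\<alpha> \<le> 1 / 2"
  proof -
    show "0 < \<alpha>" using \<delta> by (simp add: \<alpha>_def)
    have "\<alpha> \<le> 1 * min \<delta> (1 / 2)"
      unfolding \<alpha>_def using K_nonneg \<delta> by (intro mult_right_mono) auto
    then show "\<alpha> \<le> 1 / 2" by simp
  qed
  define X where "X = \<alpha> / sqrt (H (\<alpha> / 2))"
  have H\<alpha>: "0 < H (\<alpha> / 2)" using \<alpha> by (intro H_pos) simp
  then have X: "0 < X" using \<alpha> by (simp add: X_def)
  have "H (\<alpha> / 2) * X\<^sup>2 = 4 * (\<alpha> / 2)\<^sup>2"
    using H\<alpha> by (simp add: X_def power_divide)
  then have at_X: "u X t \<le> \<alpha> / 2" if "0 < t" for t
    using nw[unfolded never_wide_def, rule_format, OF that X, of "\<alpha> / 2"] \<alpha> by fastforce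
  obtain c where c: "0 < c" "\<And>v. \<alpha> / 2 \<le> v \<Longrightarrow> v \<le> \<alpha> \<Longrightarrow> c \<le> g v"
  proof -
    have "continuous_on {\<alpha> / 2..\<alpha>} g"
      using cont_g continuous_on_subset by blast
    then obtain r where r: "r \<in> {\<alpha> / 2..\<alpha>}" "\<And>v. v \<in> {\<alpha> / 2..\<alpha>} \<Longrightarrow> g r \<le> g v"
      using continuous_attains_inf[of "{\<alpha> / 2..\<alpha>}" g] \<alpha> by auto
    show ?thesis
      by (rule that[of "g r"]) (use r g_pos[of r] \<alpha> in auto)
  qed
  define \<kappa> where "\<kappa> = c * \<alpha> / (2 * (1 + K * M * X))"
  define L where "L = X + 4 * M / \<kappa>"
  define e where "e = min 1 (\<kappa> / 4)"
  define \<eta> where "\<eta> = \<kappa> / (4 * L)"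
  have "0 < 1 + K * M * X"
    using K_nonneg M_ge_1 X by (intro add_pos_nonneg mult_nonneg_nonneg) auto
  then have \<kappa>: "0 < \<kappa>" using c \<alpha> by (simp add: \<kappa>_def)
  have L: "0 < L" using X \<kappa> M_ge_1 by (simp add: L_def add_pos_nonneg)
  have e: "0 < e" "e \<le> 1" "e \<le> \<kappa> / 4" using \<kappa> by (auto simp: e_def)
  have \<eta>: "0 < \<eta>" using \<kappa> L by (simp add: \<eta>_def)
  obtain T1 where T1: "0 < T1" "\<And>t x. T1 \<le> t \<Longrightarrow> u x t \<le> 1 + \<eta> / (K + 1)"
    using eventually_le[of "\<eta> / (K + 1)"] \<eta> K_nonneg by auto
  have "0 < e\<^sup>2 / L" using e L by simp
  then obtain T2 where T2: "2 \<le> T2" "\<And>t. T2 \<le> t \<Longrightarrow> \<exists>s. t - 1 \<le> s \<and> s \<le> t \<and> integral {- L..L} (\<lambda>x. (ut x s)\<^sup>2) < e\<^sup>2 / L"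
    using dissipation_vanishes[OF nw, of L "e\<^sup>2 / L"] L by auto
  obtain t where t: "T1 + T2 \<le> t" "\<delta> < u 0 t"
    using often[of "T1 + T2"] T1(1) T2(1) by auto
  obtain s where s: "t - 1 \<le> s" "s \<le> t" "integral {- L..L} (\<lambda>x. (ut x s)\<^sup>2) < e\<^sup>2 / L"
    using T2(2)[of t] t T1 by auto
  have s0: "0 < s" "T1 \<le> s" using s t T1 T2 by auto
  have "\<alpha> \<le> exp (- K) * u 0 t"
    unfolding \<alpha>_def using t by (intro mult_left_mono) auto
  also have "\<dots> \<le> u 0 s" using s s0 by (intro centre_decay_bound) auto
  finally have centre: "\<alpha> \<le> u 0 s" .
  have g_ge: "- \<eta> \<le> g (u x s)" for x
  proof (cases "u x s \<le> 1")
    case True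
    then have "0 \<le> g (u x s)" using u_nonneg[OF s0(1)] by (intro g_nonneg)
    then show ?thesis using \<eta> by simp
  next
    case False
    have "\<bar>g (u x s) - g 1\<bar> \<le> K * \<bar>u x s - 1\<bar>"
      using u_nonneg[OF s0(1)] u_le[OF s0(1)] M_ge_1 by (intro lip) auto
    also have "\<dots> \<le> (K + 1) * (\<eta> / (K + 1))"
      using False T1(2)[OF s0(2), of x] K_nonneg by (intro mult_mono) auto
    also have "\<dots> = \<eta>" using K_nonneg by simp
    finally show ?thesis using g_zeros by (simp add: abs_le_iff)
  qed
  show False
  proof (rule quiet_time_contradiction[OF s0(1) X \<alpha>(1) centre at_X[OF s0(1)] c \<kappa>_def L_def e g_ge])
    show "0 \<le> \<eta>" using \<eta> by simp
    show "\<eta> * L \<le> \<kappa> / 4" using L by (simp add: \<eta>_def)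
    show "integral {- L..L} (\<lambda>x. (ut x s)\<^sup>2) \<le> e\<^sup>2 / L" using s by simp
  qed
qed

lemma spreading_vanishing_dichotomy:
  "(\<forall>C. compact C \<longrightarrow> uniform_limit C (\<lambda>t x. u x t) (\<lambda>_. 1) at_top) \<or>
    uniform_limit UNIV (\<lambda>t x. u x t) (\<lambda>_. 0) at_top"
proof (cases never_wide)
  case True
  have "\<forall>\<^sub>F t in at_top. \<forall>x\<in>UNIV. dist (u x t) 0 < e" if e: "0 < e" for e
  proof -
    obtain T where T: "0 < T" "\<forall>t\<ge>T. u 0 t \<le> e / 2"
      using vanishes_if_never_wide[OF True, of "e / 2"] e by auto
    have "dist (u x t) 0 < e" if "T \<le> t" for t x
    proof -
      have "0 < t" using that T by simp
      then show ?thesis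
        using T(2) that max_at_centre[of t x] u_nonneg[of t x] e by (fastforce simp: dist_real_def)
    qed
    then show ?thesis unfolding eventually_at_top_linorder by blast
  qed
  then show ?thesis by (simp add: uniform_limit_iff)
next
  case False
  then obtain t0 x \<delta> where w: "0 < t0" "0 < x" "0 < \<delta>" "\<delta> \<le> 1" "\<delta> \<le> u x t0" "4 * \<delta>\<^sup>2 \<le> H \<delta> * x\<^sup>2"
    unfolding never_wide_def by (auto simp: not_less)
  obtain a where a: "0 < a" "a \<le> 1" "\<And>t. t0 \<le> t \<Longrightarrow> a \<le> u 0 t"
    using plateau_persists[OF w(3,4,2,6,1,5)] by blast
  have "\<forall>\<^sub>F t in at_top. \<forall>x\<in>C. dist (u x t) 1 < e" if C: "compact C" and e: "0 < e" for C e
  proof -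
    obtain Y where Y: "0 < Y" "\<And>x. x \<in> C \<Longrightarrow> \<bar>x\<bar> \<le> Y"
      using compact_imp_bounded[OF C] unfolding bounded_pos by auto
    define \<epsilon> where "\<epsilon> = min (e / 4) (1 / 2)"
    have \<epsilon>: "0 < \<epsilon>" "\<epsilon> \<le> 1 / 2" "\<epsilon> \<le> e / 4" using e by (auto simp: \<epsilon>_def)
    obtain T1 where T1: "\<And>t x. T1 \<le> t \<Longrightarrow> \<bar>x\<bar> \<le> Y \<Longrightarrow> 1 - 2 * \<epsilon> - \<epsilon> \<le> u x t"
      using spreads_if_centre_bounded_below[OF a(1,2) w(1) a(3) Y(1) \<epsilon>(1,2)] by blast
    obtain T2 where T2: "0 < T2" "\<And>t x. T2 \<le> t \<Longrightarrow> u x t \<le> 1 + \<epsilon>"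
      using eventually_le[OF \<epsilon>(1)] by blast
    have "\<forall>x\<in>C. dist (u x t) 1 < e" if t: "max T1 T2 \<le> t" for t
    proof
      fix x assume "x \<in> C"
      then have "1 - 2 * \<epsilon> - \<epsilon> \<le> u x t" "u x t \<le> 1 + \<epsilon>"
        using T1 T2 Y(2) t by auto
      then show "dist (u x t) 1 < e"
        using \<epsilon> e unfolding dist_real_def by linarith
    qed
    then show ?thesis unfolding eventually_at_top_linorder by blast
  qed
  then show ?thesis by (simp add: uniform_limit_iff)
qed

end

text \<open>The set where a continuous function exceeds an essential bound is open and null, hence empty.\<close>

lemma in_Linf_continuous_bound:
  fixes v :: "real \<times> real \<Rightarrow> real"
  assumes S: "open S" and cont: "continuous_on S v" and v: "in_Linf (lebesgue_on S) v"
  obtains C where "\<And>z. z \<in> S \<Longrightarrow> \<bar>v z\<bar> \<le> C"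
proof -
  obtain C where C: "AE z in lebesgue_on S. \<bar>v z\<bar> \<le> C"
    using v by (auto simp: in_Linf_def)
  have "S \<in> sets lebesgue" using S by auto
  then have "AE z in lebesgue. z \<in> S \<longrightarrow> \<bar>v z\<bar> \<le> C"
    using C by (subst (asm) AE_restrict_space_iff) auto
  then obtain N where N: "{z \<in> space lebesgue. \<not> (z \<in> S \<longrightarrow> \<bar>v z\<bar> \<le> C)} \<subseteq> N" "emeasure lebesgue N = 0" "N \<in> sets lebesgue"
    by (rule AE_E)
  have "open {z \<in> S. C < \<bar>v z\<bar>}"
    using continuous_on_open_vimage[OF S, of "\<lambda>z. \<bar>v z\<bar>"] cont
    by (auto simp: vimage_def Int_def conj_commute intro!: continuous_on_rabs dest!: spec[of _ "{C<..}"])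
  moreover have "negligible {z \<in> S. C < \<bar>v z\<bar>}"
  proof (rule negligible_subset)
    show "negligible N"
      using N(2,3) by (intro negligible_iff_null_sets[THEN iffD2] null_setsI)
    show "{z \<in> S. C < \<bar>v z\<bar>} \<subseteq> N"
      using N(1) by (force simp: not_le)
  qed
  ultimately have "{z \<in> S. C < \<bar>v z\<bar>} = {}"
    using open_not_negligible by blast
  then show ?thesis using that[of C] by (metis (mono_tags, lifting) empty_Collect_eq not_le)
qed

lemma in_L2_diff:
  assumes "in_L2 v" "in_L2 w"
  shows "integrable lebesgue (\<lambda>x. (v x - w x)\<^sup>2)"
proof (rule Bochner_Integration.integrable_bound)
  show "integrable lebesgue (\<lambda>x. 2 * (v x)\<^sup>2 + 2 * (w x)\<^sup>2)"
    using assms by (auto simp: in_L2_def)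
  have [measurable]: "v \<in> borel_measurable lebesgue" "w \<in> borel_measurable lebesgue"
    using assms by (auto simp: in_L2_def)
  show "(\<lambda>x. (v x - w x)\<^sup>2) \<in> borel_measurable lebesgue" by measurable
  have "(v x - w x)\<^sup>2 \<le> 2 * (v x)\<^sup>2 + 2 * (w x)\<^sup>2" for x
    using zero_le_power2[of "v x + w x"] by (simp add: power2_sum power2_diff)
  then show "AE x in lebesgue. norm ((v x - w x)\<^sup>2) \<le> norm (2 * (v x)\<^sup>2 + 2 * (w x)\<^sup>2)"
    by auto
qed

lemma initial_trace_L2:
  assumes cont: "continuous_in_L2 {0..} u" and init: "AE x in lebesgue. u x 0 = \<phi> x" and \<phi>: "in_L2 \<phi>"
  shows "0 < s \<Longrightarrow> integrable lebesgue (\<lambda>x. (u x s - \<phi> x)\<^sup>2)"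
    "((\<lambda>s. LINT x|lebesgue. (u x s - \<phi> x)\<^sup>2) \<longlongrightarrow> 0) (at_right 0)"
proof -
  have L2: "in_L2 (\<lambda>x. u x t)" if "0 \<le> t" for t
    using cont that by (auto simp: continuous_in_L2_def)
  show "integrable lebesgue (\<lambda>x. (u x s - \<phi> x)\<^sup>2)" if "0 < s" for s
    using that by (intro in_L2_diff L2 \<phi>) simp
  have eq: "(L2_norm (\<lambda>x. u x s - u x 0))\<^sup>2 = (LINT x|lebesgue. (u x s - \<phi> x)\<^sup>2)" if "0 < s" for s
  proof -
    have "(L2_norm (\<lambda>x. u x s - u x 0))\<^sup>2 = (LINT x|lebesgue. (u x s - u x 0)\<^sup>2)"
      unfolding L2_norm_def by (simp add: integral_nonneg_AE)
    also have "\<dots> = (LINT x|lebesgue. (u x s - \<phi> x)\<^sup>2)"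
    proof (rule integral_cong_AE)
      show "(\<lambda>x. (u x s - u x 0)\<^sup>2) \<in> borel_measurable lebesgue" "(\<lambda>x. (u x s - \<phi> x)\<^sup>2) \<in> borel_measurable lebesgue"
        using in_L2_diff[OF L2[of s] L2[of 0]] in_L2_diff[OF L2[of s] \<phi>] that by auto
      show "AE x in lebesgue. (u x s - u x 0)\<^sup>2 = (u x s - \<phi> x)\<^sup>2"
        using init by eventually_elim simp
    qed
    finally show ?thesis .
  qed
  have "((\<lambda>t. L2_norm (\<lambda>x. u x t - u x 0)) \<longlongrightarrow> 0) (at 0 within {0..})"
    using cont by (simp add: continuous_in_L2_def)
  then have "((\<lambda>t. L2_norm (\<lambda>x. u x t - u x 0)) \<longlongrightarrow> 0) (at_right 0)"
    by (simp only: at_within_Ici_at_right)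
  then have "((\<lambda>t. (L2_norm (\<lambda>x. u x t - u x 0))\<^sup>2) \<longlongrightarrow> 0) (at_right 0)"
    using tendsto_power[of _ 0 _ 2] by force
  moreover have "\<forall>\<^sub>F s in at_right 0. (L2_norm (\<lambda>x. u x s - u x 0))\<^sup>2 = (LINT x|lebesgue. (u x s - \<phi> x)\<^sup>2)"
    unfolding eventually_at_right_field using eq by (auto intro!: exI[of _ 1])
  ultimately show "((\<lambda>s. LINT x|lebesgue. (u x s - \<phi> x)\<^sup>2) \<longlongrightarrow> 0) (at_right 0)"
    by (rule Lim_transform_eventually)
qed

theorem theorem4:
  fixes f f' \<phi> :: "real \<Rightarrow> real" and u :: "real \<Rightarrow> real \<Rightarrow> real"
  assumes f_deriv: "\<And>v. v \<ge> 0 \<Longrightarrow> (f has_real_derivative f' v) (at v within {0..})"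
    and f'_cont: "continuous_on {0..} f'"
    and f_zeros: "f 0 = 0" "f 1 = 0"
    and f_pos: "\<And>v. 0 < v \<Longrightarrow> v < 1 \<Longrightarrow> f v > 0"
    and f_neg: "\<And>v. v > 1 \<Longrightarrow> f v < 0"
    and f'_0: "f' 0 = 0"
    and phi_L2: "in_L2 \<phi>"
    and phi_Linf: "in_Linf lebesgue \<phi>"
    and phi_nonneg: "\<And>x. \<phi> x \<ge> 0"
    and phi_even: "\<And>x. \<phi> (- x) = \<phi> x"
    and phi_mono: "antimono_on {0<..} \<phi>"
    and u_sol: "is_solution f \<phi> u"
  shows "(\<forall>K. compact K \<longrightarrow> uniform_limit K (\<lambda>t x. u x t) (\<lambda>_. 1) at_top) \<or>
         uniform_limit UNIV (\<lambda>t x. u x t) (\<lambda>_. 0) at_top"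
proof -
  obtain ux uxx ut where evolution: "smooth_evolution u ux uxx ut"
    and pde: "\<And>x t. 0 < t \<Longrightarrow> ut x t = uxx x t + f (u x t)"
    using u_sol unfolding is_solution_def smooth_evolution_def by blast
  have nonneg: "0 \<le> u x t" if "0 < t" for x t
    using u_sol that unfolding is_solution_def by blast
  have L2: "continuous_in_L2 {0..} u" and init: "AE x in lebesgue. u x 0 = \<phi> x"
    and Linf: "in_Linf (lebesgue_on (UNIV \<times> {0<..})) (\<lambda>(x, t). u x t)"
    using u_sol unfolding is_solution_def by blast+
  have "open (UNIV \<times> {0<..} :: (real \<times> real) set)"
    by (intro open_Times) auto
  then obtain C where C: "\<And>z. z \<in> UNIV \<times> {0<..} \<Longrightarrow> \<bar>case z of (x, t) \<Rightarrow> u x t\<bar> \<le> C"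
    using in_Linf_continuous_bound[OF _ smooth_evolution.cont_w[OF evolution] Linf] by blast
  define M where "M = max C 1"
  have le_M: "u x t \<le> M" if "0 < t" for x t
    using C[of "(x, t)"] that by (auto simp: M_def)
  have "continuous_on {0..M} f'"
    using f'_cont by (rule continuous_on_subset) auto
  then have "bounded (f' ` {0..M})"
    by (intro compact_imp_bounded compact_continuous_image) auto
  then obtain K where K: "0 < K" "\<And>v. 0 \<le> v \<Longrightarrow> v \<le> M \<Longrightarrow> \<bar>f' v\<bar> \<le> K"
    unfolding bounded_pos by auto
  have lip: "\<bar>f a - f b\<bar> \<le> K * \<bar>a - b\<bar>" if "0 \<le> a" "a \<le> M" "0 \<le> b" "b \<le> M" for a b
    using field_differentiable_bound[of "{0..M}" f f' K a b] that K(2)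
      DERIV_subset[OF f_deriv, of _ "{0..M}"] by auto
  \<comment> \<open>Extending \<open>f\<close> by \<open>f(0)\<close> to the negative half-line makes it continuous on the whole line, with a global primitive.\<close>
  define g where "g v = f (max 0 v)" for v
  define h where "h v = g (max 0 (min v 1))" for v
  have "continuous_on {0..} f"
    using f_deriv by (intro DERIV_continuous_on) auto
  then have cont_g: "continuous_on UNIV g"
    unfolding g_def[abs_def] by (rule continuous_on_compose2) (auto intro!: continuous_intros)
  have cont_h: "continuous_on UNIV h"
    unfolding h_def[abs_def] by (rule continuous_on_compose2[OF cont_g]) (auto intro!: continuous_intros)
  obtain G where G: "G 0 = 0" "\<And>s. (G has_real_derivative g s) (at s)"
    using global_antiderivative[OF cont_g] by blast
  obtain H where H: "H 0 = 0" "\<And>s. (H has_real_derivative h s) (at s)"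
    using global_antiderivative[OF cont_h] by blast
  interpret bounded_solution u ux uxx ut g M K
    using evolution nonneg le_M cont_g lip K(1) pde
    by (auto simp: bounded_solution_def bounded_solution_axioms_def g_def M_def)
  note symmetric = symmetric_decreasing[OF initial_trace_L2[OF L2 init phi_L2] phi_even phi_mono]
  have "in_L2 (\<lambda>x. u x 1)"
    using L2 by (auto simp: continuous_in_L2_def)
  then interpret monostable_energy u ux uxx ut g M K h H G
    by unfold_locales (use symmetric f_zeros f_pos f_neg G H in \<open>auto simp: g_def h_def[abs_def] in_L2_def\<close>)
  show ?thesis by (rule spreading_vanishing_dichotomy)
qed

end
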